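(* Consider the majority voter model with generator $L$ on the directed tree $\mathcal T=\mathcal T^3$. There exists a stationary, $\operatorname{Aut}(\mathcal T)$-invariant Markov process $(\omega(t))_t$ with generator $L$, which is supported on non-frozen states, and which has the following two properties: (1) The opinion of each vertex $x\in\mathbb V$ mixes exponentially fast in time, that is, $\mathbb E[\omega_x(0)\omega_x(t)]:=\mathbb P[\omega_x(0)=\omega_x(t)]-\mathbb P[\omega_x(0)\ne\omega_x(t)]$ decays exponentially fast in $t$, where $\mathbb P,\mathbb E$ refer to the distribution of the stationary process. (2) For each layer $\mathbb V_k$, $k\in\mathbb Z$, the restriction of the configuration (at a fixed time) to $\mathbb V_k$ is i.i.d. over the vertices in that layer.
   Context: $\mathcal T^3=(\mathbb V,\mathbb E)$ is the directed unrooted infinite tree in which each vertex has exactly one parent and exactly $3$ children. $\operatorname{Aut}(\mathcal T)$ is the group of automorphisms of the directed tree. Fix a bi-infinite path $(x_k)_{k\in\mathbb Z}$ such that $x_k$ is the parent of $x_{k-1}$ for each $k$; the layers $(\mathbb V_k)_{k\in\mathbb Z}$ form the partition of $\mathbb V$ such that $x_k\in\mathbb V_k$ and such that the parent of any $x\in\mathbb V_k$ lies in $\mathbb V_{k+1}$. Majority voter model: each vertex carries an independent rate-$1$ Poisson clock; the state space is $\{+,-\}^{\mathbb V}$ with the product topology ($\pm$ identified with $\pm1$). When the clock at $x$ rings, $\omega$ is replaced by $\omega^x$, where $\omega^x_y=\omega_y$ for $y\ne x$ and $\omega^x_x$ is the majority value among the opinions $\omega_z$ of the three children $z$ of $x$.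 $L$ is the generator of this continuous-time Markov process. A configuration is frozen if the opinion of each vertex equals the majority of the opinions of its children; otherwise it is non-frozen. "Supported on non-frozen states" means that almost surely the configuration is non-frozen. "Decays exponentially fast in $t$" means that its absolute value is bounded by $Ce^{-ct}$ for all $t\ge0$, for some constants $C,c>0$. *)

theory Defs
  imports "HOL-Analysis.Analysis" "HOL-Probability.Probability"
begin

section \<open>The directed tree\<close>

text \<open>
  A directed graph on the vertex set \<open>UNIV\<close> is given by its edge relation \<open>E\<close>, where
  \<open>(y, x) \<in> E\<close> means that \<open>y\<close> is the parent of \<open>x\<close>.
\<close>

definition adjacent :: "('v \<times> 'v) set \<Rightarrow> 'v \<Rightarrow> 'v \<Rightarrow> bool" where
  "adjacent E x y \<longleftrightarrow> (x, y) \<in> E \<or> (y, x) \<in> E"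

definition undirected_cycle :: "('v \<times> 'v) set \<Rightarrow> 'v list \<Rightarrow> bool" where
  "undirected_cycle E p \<longleftrightarrow>
     3 \<le> length p \<and> distinct p \<and> successively (adjacent E) p \<and> adjacent E (last p) (hd p)"

text \<open>
  An oriented tree: the underlying undirected graph is connected and has no cycles. Asymmetry
  of \<open>E\<close> excludes loops and pairs of opposite edges.
\<close>

definition directed_tree :: "('v \<times> 'v) set \<Rightarrow> bool" where
  "directed_tree E \<longleftrightarrow>
     asym E \<and> (\<forall>x y. (adjacent E)\<^sup>*\<^sup>* x y) \<and> (\<nexists>p. undirected_cycle E p)"

definition children :: "('v \<times> 'v) set \<Rightarrow> 'v \<Rightarrow> 'v set" where
  "children E x = {z. (x, z) \<in> E}"

text \<open>
  For \<open>d \<ge> 1\<close> these properties determine the directed tree up to isomorphism, and force it to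
  be countably infinite.
\<close>

definition regular_directed_tree :: "nat \<Rightarrow> ('v \<times> 'v) set \<Rightarrow> bool" where
  "regular_directed_tree d E \<longleftrightarrow>
     directed_tree E \<and> (\<forall>x. \<exists>!y. (y, x) \<in> E) \<and> (\<forall>x. card (children E x) = d)"

definition automorphism :: "('v \<times> 'v) set \<Rightarrow> ('v \<Rightarrow> 'v) \<Rightarrow> bool" where
  "automorphism E \<phi> \<longleftrightarrow> bij \<phi> \<and> (\<forall>x y. (\<phi> x, \<phi> y) \<in> E \<longleftrightarrow> (x, y) \<in> E)"

definition layering :: "('v \<times> 'v) set \<Rightarrow> (int \<Rightarrow> 'v) \<Rightarrow> (int \<Rightarrow> 'v set) \<Rightarrow> bool" where
  "layering E r V \<longleftrightarrow>
     disjoint_family V \<and> (\<Union>k. V k) = UNIV \<and> (\<forall>k. r k \<in> V k) \<and>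
     (\<forall>k. \<forall>x\<in>V k. \<forall>y. (y, x) \<in> E \<longrightarrow> y \<in> V (k + 1))"


section \<open>The majority voter dynamics\<close>

text \<open>
  A configuration is a function \<open>'v \<Rightarrow> bool\<close>, where \<open>True\<close> is the opinion \<open>+\<close> and \<open>False\<close> is
  the opinion \<open>-\<close>. The topology on \<open>'v \<Rightarrow> bool\<close> is the product of the discrete topologies.
\<close>

definition majority :: "('v \<times> 'v) set \<Rightarrow> ('v \<Rightarrow> bool) \<Rightarrow> 'v \<Rightarrow> bool" where
  "majority E \<omega> x \<longleftrightarrow> card {z \<in> children E x. \<not> \<omega> z} < card {z \<in> children E x. \<omega> z}"

definition update :: "('v \<times> 'v) set \<Rightarrow> ('v \<Rightarrow> bool) \<Rightarrow> 'v \<Rightarrow> ('v \<Rightarrow> bool)" where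
  "update E \<omega> x = fun_upd \<omega> x (majority E \<omega> x)"

definition frozen :: "('v \<times> 'v) set \<Rightarrow> ('v \<Rightarrow> bool) \<Rightarrow> bool" where
  "frozen E \<omega> \<longleftrightarrow> (\<forall>x. \<omega> x = majority E \<omega> x)"

definition local_function :: "(('v \<Rightarrow> bool) \<Rightarrow> real) \<Rightarrow> bool" where
  "local_function f \<longleftrightarrow>
     (\<exists>A. finite A \<and> (\<forall>\<omega> \<omega>'. (\<forall>x\<in>A. \<omega> x = \<omega>' x) \<longrightarrow> f \<omega> = f \<omega>'))"

text \<open>
  The graph of the pregenerator
  \<open>(L f) \<omega> = (\<Sum>x. f (update E \<omega> x) - f \<omega>)\<close>,
  whose domain consists of the local functions; for these only finitely many summands are nonzero.
\<close>

definition majority_pregenerator ::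
    "('v \<times> 'v) set \<Rightarrow> ((('v \<Rightarrow> bool) \<Rightarrow>\<^sub>C real) \<times> (('v \<Rightarrow> bool) \<Rightarrow>\<^sub>C real)) set" where
  "majority_pregenerator E =
     {(f, g). local_function (apply_bcontfun f) \<and>
              (\<forall>\<omega>. apply_bcontfun g \<omega> =
                 (\<Sum>\<^sub>\<infinity>x. apply_bcontfun f (update E \<omega> x) - apply_bcontfun f \<omega>))}"

text \<open>The generator is the closure of the pregenerator in the supremum norm.\<close>

definition majority_generator ::
    "('v \<times> 'v) set \<Rightarrow> ((('v \<Rightarrow> bool) \<Rightarrow>\<^sub>C real) \<times> (('v \<Rightarrow> bool) \<Rightarrow>\<^sub>C real)) set" where
  "majority_generator E = closure (majority_pregenerator E)"


section \<open>Markov semigroups, generators and Markov processes\<close>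

definition markov_semigroup ::
    "(real \<Rightarrow> ('s::topological_space \<Rightarrow>\<^sub>C real) \<Rightarrow> ('s \<Rightarrow>\<^sub>C real)) \<Rightarrow> bool" where
  "markov_semigroup S \<longleftrightarrow>
     (\<forall>t\<ge>0. linear (S t)) \<and>
     (\<forall>t\<ge>0. S t (const_bcontfun 1) = const_bcontfun 1) \<and>
     (\<forall>t\<ge>0. \<forall>f. (\<forall>s. 0 \<le> apply_bcontfun f s) \<longrightarrow> (\<forall>s. 0 \<le> apply_bcontfun (S t f) s)) \<and>
     (\<forall>f. S 0 f = f) \<and>
     (\<forall>t\<ge>0. \<forall>u\<ge>0. \<forall>f. S (t + u) f = S t (S u f)) \<and>
     (\<forall>f. ((\<lambda>t. S t f) \<longlongrightarrow> f) (at_right 0))"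

definition semigroup_generator ::
    "(real \<Rightarrow> ('s::topological_space \<Rightarrow>\<^sub>C real) \<Rightarrow> ('s \<Rightarrow>\<^sub>C real)) \<Rightarrow>
     (('s \<Rightarrow>\<^sub>C real) \<times> ('s \<Rightarrow>\<^sub>C real)) set" where
  "semigroup_generator S = {(f, g). ((\<lambda>t. (S t f - f) /\<^sub>R t) \<longlongrightarrow> g) (at_right 0)}"

text \<open>
  Processes \<open>X t\<close> are indexed by real \<open>t\<close>, but only the times \<open>t \<ge> 0\<close> are taken into account.
\<close>

definition natural_filtration ::
    "'w measure \<Rightarrow> (real \<Rightarrow> 'w \<Rightarrow> 's::topological_space) \<Rightarrow> real \<Rightarrow> 'w measure" where
  "natural_filtration M X t =
     sigma (space M) (\<Union>u\<in>{0..t}. {X u -` B \<inter> space M |B. B \<in> sets borel})"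

definition cadlag :: "(real \<Rightarrow> 's::topological_space) \<Rightarrow> bool" where
  "cadlag p \<longleftrightarrow>
     (\<forall>t\<ge>0. (p \<longlongrightarrow> p t) (at_right t)) \<and> (\<forall>t>0. \<exists>l. (p \<longlongrightarrow> l) (at_left t))"

definition markov_process_with_generator ::
    "(('s::topological_space \<Rightarrow>\<^sub>C real) \<times> ('s \<Rightarrow>\<^sub>C real)) set \<Rightarrow>
     'w measure \<Rightarrow> (real \<Rightarrow> 'w \<Rightarrow> 's) \<Rightarrow> bool" where
  "markov_process_with_generator L M X \<longleftrightarrow>
     prob_space M \<and>
     (\<forall>t\<ge>0. X t \<in> M \<rightarrow>\<^sub>M borel) \<and>
     (AE w in M. cadlag (\<lambda>t. X t w)) \<and>
     (\<exists>S. markov_semigroup S \<and> semigroup_generator S = L \<and>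
        (\<forall>s\<ge>0. \<forall>t\<ge>0. \<forall>f. AE w in M.
           real_cond_exp M (natural_filtration M X s) (\<lambda>w. apply_bcontfun f (X (s + t) w)) w =
           apply_bcontfun (S t f) (X s w)))"

definition process_law ::
    "'w measure \<Rightarrow> (real \<Rightarrow> 'w \<Rightarrow> 's::topological_space) \<Rightarrow> (real \<Rightarrow> 's) measure" where
  "process_law M X = distr M (\<Pi>\<^sub>M t\<in>{0..}. borel) (\<lambda>w. \<lambda>t\<in>{0..}. X t w)"

definition stationary :: "'w measure \<Rightarrow> (real \<Rightarrow> 'w \<Rightarrow> 's::topological_space) \<Rightarrow> bool" where
  "stationary M X \<longleftrightarrow> (\<forall>h\<ge>0. process_law M (\<lambda>t. X (t + h)) = process_law M X)"

definition automorphism_invariant ::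
    "('v \<times> 'v) set \<Rightarrow> 'w measure \<Rightarrow> (real \<Rightarrow> 'w \<Rightarrow> 'v \<Rightarrow> bool) \<Rightarrow> bool" where
  "automorphism_invariant E M X \<longleftrightarrow>
     (\<forall>\<phi>. automorphism E \<phi> \<longrightarrow> process_law M (\<lambda>t w. X t w \<circ> \<phi>) = process_law M X)"

definition opinion_correlation ::
    "'w measure \<Rightarrow> (real \<Rightarrow> 'w \<Rightarrow> 'v \<Rightarrow> bool) \<Rightarrow> 'v \<Rightarrow> real \<Rightarrow> real" where
  "opinion_correlation M X x t =
     measure M {w \<in> space M. X 0 w x = X t w x} - measure M {w \<in> space M. X 0 w x \<noteq> X t w x}"

definition decays_exponentially :: "(real \<Rightarrow> real) \<Rightarrow> bool" where
  "decays_exponentially f \<longleftrightarrow> (\<exists>C>0. \<exists>c>0. \<forall>t\<ge>0. \<bar>f t\<bar> \<le> C * exp (- c * t))"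

definition iid_on :: "'w measure \<Rightarrow> ('w \<Rightarrow> 'v \<Rightarrow> bool) \<Rightarrow> 'v set \<Rightarrow> bool" where
  "iid_on M Y A \<longleftrightarrow>
     prob_space.indep_vars M (\<lambda>_. count_space UNIV) (\<lambda>x w. Y w x) A \<and>
     (\<forall>x\<in>A. \<forall>y\<in>A. distr M (count_space UNIV) (\<lambda>w. Y w x) = distr M (count_space UNIV) (\<lambda>w. Y w y))"

end

theory Submission imports Defs begin

text \<open>
  The semigroup is built by Hille--Yosida: the operator \<open>f \<mapsto> (\<Sum>x. f(\<omega>\<^sup>x) - f)\<close> on local functions is
  dissipative by the maximum principle, and \<open>1 - hL\<close> has dense range for small \<open>h\<close> since solving it for
  finitely many sites spreads the dependence on a site only to its descendants, with geometric decay.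
  Functions of the opinions on disjoint sets that are closed under taking children evolve independently.

  Start from fair i.i.d. opinions. By symmetry and the previous remark, layers stay fair i.i.d. for all
  times. Write \<open>p\<close>, \<open>q\<close>, \<open>r\<close> for the correlations at times \<open>s \<le> t\<close> of the opinion of \<open>x\<close> with itself, of the opinion
  with the majority of the children, and of that majority with itself. Then \<open>\<partial>p/\<partial>t = q - p\<close> and
  \<open>\<partial>q/\<partial>s = r - q\<close>, and \<open>4r = p\<^sub>1 + p\<^sub>2 + p\<^sub>3 + p\<^sub>1p\<^sub>2p\<^sub>3\<close>
  in terms of the correlations of the three children. A uniform bound \<open>\<bar>p\<bar> \<le> exp(-(t-s)/10) + d exp(s+t)\<close>
  thereby improves itself to the one with \<open>3d/8\<close> in place of \<open>d\<close>, so \<open>d = 0\<close>; and at equal times \<open>q\<close> stays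
  below \<open>7/8\<close>. The opinion of \<open>x\<close> and the majority of its children hence agree with probability at most
  \<open>15/16\<close>, independently over a layer, so frozen configurations have probability zero.

  All these properties survive for a limit point of the time averages of the law, which is moreover
  stationary and invariant under automorphisms. The stationary process with this law exists by
  Kolmogorov's theorem; since the expected number of flips of a vertex on dyadic grids is bounded by the
  elapsed time, taking right limits along the dyadic times gives paths that are right-continuous with left limits.
\<close>

section \<open>Dissipative operators and semigroups\<close>

text \<open>The constants \<open>p = q = r = 1\<close> also solve the correlation equations; they
  describe a frozen state. Only the value \<open>q = 0\<close> at \<open>s = 0\<close>, where an
  opinion is independent of its descendants, excludes them, so the bootstrap must gain strictly. If
  \<open>p\<close> is at most \<open>exp(-a(t-s))\<close>, then \<open>r\<close> is at most
  \<open>3/4 exp(-a(t-s)) + 1/4 exp(-3a(t-s))\<close>. The equation for \<open>q\<close> divides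
  these terms by \<open>1 + a\<close> and \<open>1 + 3a\<close>, and the equation for
  \<open>p\<close> reproduces the ansatz if \<open>3/(4(1+a)) + 1/(4(1+3a)) \<le> 1 - a\<close>. At
  \<open>a = 0\<close> both sides are 1, with slopes \<open>-3/2\<close> and \<open>-1\<close>, so
  every small \<open>a > 0\<close> works; \<open>1/10\<close> is one choice. The generator must be
  exactly the closure of the local pregenerator, so a range condition has to be proved:
  \<open>3^n\<close> descendants in generation \<open>n\<close>, each with influence of order
  \<open>h^n\<close>, lead to \<open>h < 1/3\<close>. Time averages need not preserve independence,
  so only statements linear in the law are carried to the limit: exact probabilities on a layer, and
  bounds for agreement and correlation.\<close>

lemma funpow_contraction_diff:
  fixes P Q :: "'a::real_normed_vector \<Rightarrow> 'a"
  assumes "linear P" "linear Q" and nP: "\<And>x. norm (P x) \<le> norm x" and nQ: "\<And>x. norm (Q x) \<le> norm x"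
    and comm: "\<And>x. P (Q x) = Q (P x)" and e: "norm (P f - Q f) \<le> e"
  shows "norm ((P ^^ n) f - (Q ^^ n) f) \<le> real n * e"
proof (induction n)
  case (Suc n)
  have nPn: "norm ((P ^^ k) x) \<le> norm x" for k x
    by (induction k) (auto intro: order_trans[OF nP])
  have lPn: "linear (P ^^ k)" for k
    by (induction k) (auto intro: linear_compose[unfolded o_def] \<open>linear P\<close> simp: o_def linear_id[unfolded id_def])
  have cPn: "(P ^^ k) (Q x) = Q ((P ^^ k) x)" for k x
    by (induction k) (auto simp: comm)
  \<comment> \<open>Commutation keeps the one-step difference innermost, acting on \<open>f\<close>
    itself, so no bound along the orbit of \<open>f\<close> is required.\<close>
  have "(P ^^ Suc n) f - (Q ^^ Suc n) f = (P ^^ n) (P f - Q f) + Q ((P ^^ n) f - (Q ^^ n) f)"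
    by (simp add: linear_diff[OF lPn] linear_diff[OF \<open>linear Q\<close>] cPn funpow_swap1)
  also have "norm \<dots> \<le> norm (P f - Q f) + norm ((P ^^ n) f - (Q ^^ n) f)"
    by (rule norm_triangle_le[OF add_mono[OF nPn nQ]])
  also have "\<dots> \<le> e + real n * e" using e Suc by linarith
  finally show ?case by (simp add: algebra_simps)
qed simp

text \<open>Contractions are equicontinuous, so pointwise convergence may be evaluated at a moving
  argument; \<open>S_add\<close> needs this for \<open>T n t (T n s f)\<close>.\<close>

lemma tendsto_linear_contractions:
  fixes T :: "'b \<Rightarrow> 'a::real_normed_vector \<Rightarrow> 'a"
  assumes "\<forall>\<^sub>F n in F. linear (T n) \<and> (\<forall>x. norm (T n x) \<le> norm x)"
    and y: "(y \<longlongrightarrow> z) F" and T: "((\<lambda>n. T n z) \<longlongrightarrow> w) F"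
  shows "((\<lambda>n. T n (y n)) \<longlongrightarrow> w) F"
proof -
  have "((\<lambda>n. T n (y n) - T n z) \<longlongrightarrow> 0) F"
  proof (rule Lim_null_comparison)
    show "\<forall>\<^sub>F n in F. norm (T n (y n) - T n z) \<le> norm (y n - z)"
      using assms(1) by eventually_elim (metis linear_diff)
    show "((\<lambda>n. norm (y n - z)) \<longlongrightarrow> 0) F"
      using y by (simp add: tendsto_norm_zero LIM_zero)
  qed
  from tendsto_add[OF this T] show ?thesis by simp
qed

text \<open>The operator enters as its graph because the generator is the closure of a graph. The
  range condition is asked only below \<open>h0\<close>, since the tree supplies it only for small
  steps.\<close>

locale hille_yosida =
  fixes A :: "('a::real_normed_vector \<times> 'a) set" and h0 :: real
  assumes Cauchy_convergent_space: "\<And>X :: nat \<Rightarrow> 'a. Cauchy X \<Longrightarrow> convergent X"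
    and h0: "0 < h0"
    and subspace_A: "subspace A"
    and closed_A: "closed A"
    and dissipative: "\<And>u v h. (u, v) \<in> A \<Longrightarrow> 0 < h \<Longrightarrow> norm u \<le> norm (u - h *\<^sub>R v)"
    and range_A: "\<And>f h. 0 < h \<Longrightarrow> h < h0 \<Longrightarrow> \<exists>(u, v) \<in> A. u - h *\<^sub>R v = f"
    and dense_A: "closure (fst ` A) = UNIV"
begin

section \<open>Resolvents of the relation\<close>

lemma A_add: "(u, v) \<in> A \<Longrightarrow> (u', v') \<in> A \<Longrightarrow> (u + u', v + v') \<in> A"
  using subspace_add[OF subspace_A] by fastforce

lemma A_diff: "(u, v) \<in> A \<Longrightarrow> (u', v') \<in> A \<Longrightarrow> (u - u', v - v') \<in> A"
  using subspace_diff[OF subspace_A] by fastforce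

lemma A_scale: "(u, v) \<in> A \<Longrightarrow> (c *\<^sub>R u, c *\<^sub>R v) \<in> A"
  using subspace_scale[OF subspace_A] by fastforce

text \<open>The relation \<open>A\<close> is dissipative, so for \<open>0 < h < h0\<close> the chosen \<open>u\<close> is the unique solution of \<open>u - h A u = f\<close>.\<close>

definition J :: "real \<Rightarrow> 'a \<Rightarrow> 'a" where
  "J h f = (if h = 0 then f else SOME u. (u, (1 / h) *\<^sub>R (u - f)) \<in> A)"

lemma J_0 [simp]: "J 0 f = f"
  by (simp add: J_def)

lemma J_in:
  assumes "0 < h" "h < h0"
  shows "(J h f, (1 / h) *\<^sub>R (J h f - f)) \<in> A"
proof -
  obtain u v where uv: "(u, v) \<in> A" "u - h *\<^sub>R v = f" using range_A[OF assms] by blast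
  have "v = (1 / h) *\<^sub>R (u - f)" using assms uv(2) by auto
  then have "(u, (1 / h) *\<^sub>R (u - f)) \<in> A" using uv(1) by simp
  then have "(SOME u. (u, (1 / h) *\<^sub>R (u - f)) \<in> A, (1 / h) *\<^sub>R ((SOME u. (u, (1 / h) *\<^sub>R (u - f)) \<in> A) - f)) \<in> A"
    by (rule someI)
  then show ?thesis using assms by (simp add: J_def)
qed

text \<open>Two solutions of the same equation differ by some \<open>w\<close> with
  \<open>(w, (1 / h) w)\<close> in \<open>A\<close>, and dissipativity then gives
  \<open>norm w \<le> norm 0\<close>.\<close>

lemma J_unique:
  assumes "(u, v) \<in> A" "0 \<le> h" "h < h0"
  shows "J h (u - h *\<^sub>R v) = u"
proof (cases "h = 0")
  case False
  let ?f = "u - h *\<^sub>R v"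
  have h: "0 < h" using assms False by simp
  have "(J h ?f - u, (1 / h) *\<^sub>R (J h ?f - ?f) - v) \<in> A"
    by (rule A_diff[OF J_in[OF h assms(3)] assms(1)])
  from dissipative[OF this h] have "norm (J h ?f - u) \<le> 0"
    using h by (simp add: algebra_simps)
  then show ?thesis by simp
qed simp

lemma J_linear:
  assumes "0 \<le> h" "h < h0" shows "linear (J h)"
proof (cases "h = 0")
  case True
  then show ?thesis by (auto intro!: linearI)
next
  case False
  then have h: "0 < h" using assms by simp
  show ?thesis
  proof (rule linearI)
    fix f g
    have "J h ((J h f + J h g) - h *\<^sub>R ((1 / h) *\<^sub>R (J h f - f) + (1 / h) *\<^sub>R (J h g - g))) = J h f + J h g"
      by (rule J_unique[OF A_add[OF J_in[OF h assms(2)] J_in[OF h assms(2)]] assms])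
    then show "J h (f + g) = J h f + J h g" using h by (simp add: algebra_simps)
  next
    fix c f
    have "J h (c *\<^sub>R J h f - h *\<^sub>R c *\<^sub>R (1 / h) *\<^sub>R (J h f - f)) = c *\<^sub>R J h f"
      by (rule J_unique[OF A_scale[OF J_in[OF h assms(2)]] assms])
    then show "J h (c *\<^sub>R f) = c *\<^sub>R J h f" using h by (simp add: algebra_simps)
  qed
qed

lemma J_norm:
  assumes "0 \<le> h" "h < h0" shows "norm (J h f) \<le> norm f"
proof (cases "h = 0")
  case False
  then have h: "0 < h" using assms by simp
  show ?thesis using dissipative[OF J_in[OF h assms(2), of f] h] h by simp
qed simp

text \<open>The resolvent commutes with \<open>A\<close>, so its increment can be expressed through
  \<open>g\<close> alone.\<close>

lemma J_snd:
  assumes "(f, g) \<in> A" "0 \<le> h" "h < h0"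
  shows "J h f - f = h *\<^sub>R J h g"
  using J_unique[OF assms] J_linear[OF assms(2,3)] by (simp add: linear_diff linear_scale algebra_simps)

lemma J_A:
  assumes "(f, g) \<in> A" "0 \<le> h" "h < h0"
  shows "(J h f, J h g) \<in> A"
proof (cases "h = 0")
  case False
  then have h: "0 < h" using assms by simp
  show ?thesis using J_in[OF h assms(3), of f] J_snd[OF assms] h by simp
qed (use assms in simp)

lemma J_commute:
  assumes a: "0 \<le> a" "a < h0" and b: "0 \<le> b" "b < h0"
  shows "J a (J b f) = J b (J a f)"
proof (cases "b = 0")
  case False
  then have "0 < b" using b by simp
  have "J b (J a (J b f) - b *\<^sub>R J a ((1 / b) *\<^sub>R (J b f - f))) = J a (J b f)"
    by (rule J_unique[OF J_A[OF J_in[OF \<open>0 < b\<close> b(2)] a] b])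
  moreover have "J a (J b f) - b *\<^sub>R J a ((1 / b) *\<^sub>R (J b f - f)) = J a f"
    using False J_linear[OF a] by (simp add: linear_diff linear_scale)
  ultimately show ?thesis by simp
qed simp

text \<open>\<open>J a (J b f)\<close> inverts
  \<open>(1 - a A)(1 - b A) = 1 - (a + b) A + a b A^2\<close>, so it solves the equation for
  \<open>J (a + b)\<close> up to the term \<open>a b A^2\<close>. This second-order error is why
  \<open>f\<close> is taken in the domain of the square of \<open>A\<close>.\<close>

lemma J_add_compare:
  assumes fg: "(f, g) \<in> A" and gk: "(g, k) \<in> A" and a: "0 \<le> a" and b: "0 \<le> b" and ab: "a + b < h0"
  shows "norm (J (a + b) f - J a (J b f)) \<le> a * b * norm k"
proof -
  have a': "a < h0" and b': "b < h0" using a b ab by auto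
  define w where "w = J a (J b f)"
  define w1 where "w1 = J a (J b g)"
  define w2 where "w2 = J a (J b k)"
  have w: "(w, w1) \<in> A" unfolding w_def w1_def using fg a b a' b' by (intro J_A)
  have 1: "w - J b f = a *\<^sub>R w1" unfolding w_def w1_def
    by (rule J_snd[OF J_A[OF fg b b'] a a'])
  have 2: "J b f - f = b *\<^sub>R J b g" by (rule J_snd[OF fg b b'])
  have 3: "w1 - J b g = a *\<^sub>R w2" unfolding w1_def w2_def
    by (rule J_snd[OF J_A[OF gk b b'] a a'])
  have f: "f = J b f - b *\<^sub>R J b g" using 2 by (metis add_diff_cancel_left' diff_add_cancel diff_diff_eq2)
  have Jf: "J b f = w - a *\<^sub>R w1" using 1 by (metis diff_diff_eq2 add_diff_cancel_left' add.commute)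
  have Jg: "J b g = w1 - a *\<^sub>R w2" using 3 by (metis diff_diff_eq2 add_diff_cancel_left' add.commute)
  have "w - (a + b) *\<^sub>R w1 = f - (a * b) *\<^sub>R w2"
    by (subst f, subst Jf, subst Jg) (simp add: algebra_simps)
  then have "w = J (a + b) (f - (a * b) *\<^sub>R w2)"
    using J_unique[OF w, of "a + b"] a b ab by simp
  then have "J (a + b) f - w = (a * b) *\<^sub>R J (a + b) w2"
    using J_linear[of "a + b"] a b ab by (simp add: linear_diff linear_scale)
  then have "norm (J (a + b) f - w) \<le> a * b * norm (J (a + b) w2)" using a b by simp
  also have "norm (J (a + b) w2) \<le> norm k"
    unfolding w2_def using a b ab a' b' by (intro order_trans[OF J_norm] order_refl) auto
  finally show ?thesis using a b unfolding w_def by (simp add: mult_left_mono)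
qed

text \<open>The domain of the square of \<open>A\<close>, on which the error of one step is
  quadratic in the step size.\<close>

definition D2 :: "'a set" where
  "D2 = {f. \<exists>g k. (f, g) \<in> A \<and> (g, k) \<in> A}"

lemma J_D2:
  assumes "(f, g) \<in> A" "0 < h" "h < h0"
  shows "(J h g, (1 / h) *\<^sub>R (J h g - g)) \<in> A" "J h f \<in> D2"
  using J_in[OF assms(2,3), of g] J_A[OF assms(1), of h] assms by (auto simp: D2_def)

lemma J_norm_diff:
  assumes "(f, g) \<in> A" "0 \<le> h" "h < h0"
  shows "norm (J h f - f) \<le> h * norm g"
  using J_snd[OF assms] J_norm[OF assms(2,3), of g] assms(2) by (simp add: mult_left_mono)

lemma J_tendsto: "((\<lambda>h. J h f) \<longlongrightarrow> f) (at_right 0)"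
proof (rule tendstoI)
  fix e :: real assume e: "0 < e"
  have "f \<in> closure (fst ` A)" using dense_A by simp
  then obtain u v where uv: "(u, v) \<in> A" "dist u f < e / 3"
    using e closure_approachable[of f "fst ` A"] by (metis divide_pos_pos fst_conv imageE prod.collapse zero_less_numeral)
  have "((\<lambda>h. h * norm v) \<longlongrightarrow> 0 * norm v) (at_right 0)"
    by (intro tendsto_intros)
  then have "\<forall>\<^sub>F h in at_right 0. h * norm v < e / 3"
    using e by (intro order_tendstoD) auto
  moreover have "\<forall>\<^sub>F h in at_right 0. h \<in> {0<..<h0}"
    using h0 by (rule eventually_at_right_real)
  ultimately show "\<forall>\<^sub>F h in at_right 0. dist (J h f) f < e"
  proof eventually_elim
    case (elim h)
    have "J h f - f = J h (f - u) + (J h u - u) + (u - f)"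
      using J_linear[of h] elim by (simp add: linear_diff)
    also have "norm \<dots> \<le> norm (J h (f - u)) + norm (J h u - u) + norm (u - f)"
      by norm
    also have "norm (J h (f - u)) \<le> norm (f - u)" using elim by (intro J_norm) auto
    also have "norm (J h u - u) \<le> h * norm v" using elim uv by (intro J_norm_diff) auto
    finally show ?case using uv elim by (simp add: dist_norm norm_minus_commute)
  qed
qed

text \<open>Resolvents push the domain of \<open>A\<close> into \<open>D2\<close> and converge to
  the identity as the step shrinks.\<close>

lemma D2_dense: "closure D2 = UNIV"
proof -
  have "f \<in> closure D2" if "(f, g) \<in> A" for f g
  proof (rule Lim_in_closed_set[OF closed_closure _ trivial_limit_at_right_real J_tendsto])
    show "\<forall>\<^sub>F h in at_right 0. J h f \<in> closure D2"
      using eventually_at_right_real[OF h0]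
    proof eventually_elim
      case (elim h)
      then show ?case using J_D2(2)[OF that, of h] closure_subset by auto
    qed
  qed
  then have "fst ` A \<subseteq> closure D2" by auto
  from closure_minimal[OF this closed_closure] show ?thesis using dense_A by auto
qed

text \<open>Halving the step size keeps consecutive approximations comparable through \<open>J\<^sub>2\<^sub>h - J\<^sub>h J\<^sub>h = O(h\<^sup>2)\<close> on \<open>D2\<close>,
  so the error telescopes.\<close>

definition T :: "nat \<Rightarrow> real \<Rightarrow> 'a \<Rightarrow> 'a" where
  "T n t = J (t / 2 ^ n) ^^ (2 ^ n)"

section \<open>Convergence of the resolvent powers\<close>

lemma small: "\<forall>\<^sub>F n in sequentially. t / 2 ^ n < h0"
proof -
  have "(\<lambda>n. t * (1 / 2) ^ n) \<longlonglongrightarrow> t * 0"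
    by (intro tendsto_intros) auto
  then have "(\<lambda>n. t / 2 ^ n) \<longlonglongrightarrow> 0"
    by (simp add: power_divide)
  then show ?thesis using h0 by (rule order_tendstoD)
qed

lemma funpow_J:
  assumes "0 \<le> h" "h < h0"
  shows "linear (J h ^^ n)" "norm ((J h ^^ n) f) \<le> norm f"
    "(f, g) \<in> A \<Longrightarrow> ((J h ^^ n) f, (J h ^^ n) g) \<in> A"
    "(f, g) \<in> A \<Longrightarrow> norm ((J h ^^ n) f - f) \<le> real n * h * norm g"
proof -
  show "linear (J h ^^ n)"
    by (induction n) (auto intro!: linearI simp: linear_add linear_scale linear_add[OF J_linear[OF assms]] linear_scale[OF J_linear[OF assms]])
  show "norm ((J h ^^ n) f) \<le> norm f" for f
    by (induction n) (auto intro: order_trans[OF J_norm[OF assms]])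
  show "((J h ^^ n) f, (J h ^^ n) g) \<in> A" if "(f, g) \<in> A"
    using that by (induction n) (auto intro: J_A assms)
  show "norm ((J h ^^ n) f - f) \<le> real n * h * norm g" if "(f, g) \<in> A"
  proof -
    have "((\<lambda>x. x) ^^ n) f = f" by (induction n) auto
    then show ?thesis
      using funpow_contraction_diff[OF J_linear[OF assms] _ J_norm[OF assms], of "\<lambda>x. x" f "h * norm g" n]
        J_norm_diff[OF that assms]
      by (simp add: linear_id[unfolded id_def] mult.assoc)
  qed
qed

lemma T_good: "0 \<le> t \<Longrightarrow> \<forall>\<^sub>F n in sequentially. linear (T n t) \<and> (\<forall>x. norm (T n t x) \<le> norm x)"
  using small[of t] by eventually_elim (simp add: T_def funpow_J)

text \<open>The \<open>2^n\<close> pairs of half steps each cost \<open>(t / 2^(n+1))^2\<close>,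
  together \<open>t^2 / (4 * 2^n)\<close>. This is relaxed to a difference of consecutive powers so
  that \<open>T_Cauchy\<close> telescopes.\<close>

lemma T_step:
  assumes fg: "(f, g) \<in> A" and gk: "(g, k) \<in> A" and t: "0 \<le> t" and n: "t / 2 ^ n < h0"
  shows "norm (T n t f - T (Suc n) t f) \<le> t\<^sup>2 * norm k * (1 / 2 ^ n - 1 / 2 ^ Suc n)"
proof -
  define a where "a = t / 2 ^ Suc n"
  have a: "0 \<le> a" "a + a = t / 2 ^ n" "a < h0" "a + a < h0"
    using t n by (auto simp: a_def field_simps)
  have T2: "T (Suc n) t = (\<lambda>x. J a (J a x)) ^^ (2 ^ n)"
  proof -
    have "(J a ^^ 2) ^^ (2 ^ n) = J a ^^ (2 * 2 ^ n)" by (simp only: funpow_mult)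
    then show ?thesis by (simp add: T_def a_def numeral_2_eq_2 o_def)
  qed
  have "norm (T n t f - T (Suc n) t f) \<le> real (2 ^ n) * (a * a * norm k)"
    unfolding T2 unfolding T_def a(2)[symmetric]
  proof (rule funpow_contraction_diff)
    show "linear (J (a + a))" "\<And>x. norm (J (a + a) x) \<le> norm x" using a by (auto intro: J_linear J_norm)
    show "linear (\<lambda>x. J a (J a x))" using linear_compose[OF J_linear J_linear, of a a] a by (simp add: o_def)
    show "\<And>x. norm (J a (J a x)) \<le> norm x" using a by (meson J_norm order_trans)
    show "\<And>x. J (a + a) (J a (J a x)) = J a (J a (J (a + a) x))" by (simp only: J_commute[OF a(1) a(3) add_nonneg_nonneg[OF a(1) a(1)] a(4)])
    show "norm (J (a + a) f - J a (J a f)) \<le> a * a * norm k" by (rule J_add_compare[OF fg gk a(1,1,4)])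
  qed
  also have "\<dots> = t\<^sup>2 * norm k * (1 / (4 * 2 ^ n))" by (simp add: a_def field_simps power2_eq_square)
  also have "\<dots> \<le> t\<^sup>2 * norm k * (1 / 2 ^ n - 1 / 2 ^ Suc n)"
    by (intro mult_left_mono) (auto simp: field_simps)
  finally show ?thesis .
qed

lemma T_Cauchy:
  assumes fg: "(f, g) \<in> A" and gk: "(g, k) \<in> A" and t: "0 \<le> t" and n: "t / 2 ^ n < h0" and "n \<le> m"
  shows "norm (T n t f - T m t f) \<le> t\<^sup>2 * norm k * (1 / 2 ^ n - 1 / 2 ^ m)"
  using \<open>n \<le> m\<close>
proof (induction m rule: dec_induct)
  case (step m)
  have "t / 2 ^ m \<le> t / 2 ^ n" using step t by (intro divide_left_mono) auto
  then have m: "t / 2 ^ m < h0" using n by simp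
  have "norm (T n t f - T (Suc m) t f) \<le> norm (T n t f - T m t f) + norm (T m t f - T (Suc m) t f)"
    by norm
  also have "\<dots> \<le> t\<^sup>2 * norm k * (1 / 2 ^ n - 1 / 2 ^ m) + t\<^sup>2 * norm k * (1 / 2 ^ m - 1 / 2 ^ Suc m)"
    by (rule add_mono[OF step.IH T_step[OF fg gk t m]])
  finally show ?case by (simp add: algebra_simps)
qed simp

lemma T_conv_D2:
  assumes "f \<in> D2" "0 \<le> t" shows "Cauchy (\<lambda>n. T n t f)"
proof -
  obtain g k where fg: "(f, g) \<in> A" and gk: "(g, k) \<in> A" using assms by (auto simp: D2_def)
  show ?thesis
  proof (rule metric_CauchyI)
    fix e :: real assume e: "0 < e"
    have "(\<lambda>n. t\<^sup>2 * norm k * (1 / 2) ^ n) \<longlonglongrightarrow> t\<^sup>2 * norm k * 0"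
      by (intro tendsto_intros) auto
    then have "\<forall>\<^sub>F n in sequentially. t\<^sup>2 * norm k * (1 / 2) ^ n < e / 2"
      using e by (intro order_tendstoD) auto
    with small[of t] have "\<forall>\<^sub>F n in sequentially. t / 2 ^ n < h0 \<and> t\<^sup>2 * norm k * (1 / 2) ^ n < e / 2"
      by (rule eventually_conj)
    then obtain n where n: "t / 2 ^ n < h0" "t\<^sup>2 * norm k * (1 / 2) ^ n < e / 2"
      by (auto simp: eventually_sequentially)
    have "norm (T n t f - T m t f) < e / 2" if "n \<le> m" for m
    proof -
      have "norm (T n t f - T m t f) \<le> t\<^sup>2 * norm k * (1 / 2 ^ n - 1 / 2 ^ m)"
        by (rule T_Cauchy[OF fg gk assms(2) n(1) that])
      also have "\<dots> \<le> t\<^sup>2 * norm k * (1 / 2) ^ n"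
        by (intro mult_left_mono) (auto simp: power_divide)
      finally show ?thesis using n(2) by simp
    qed
    then show "\<exists>M. \<forall>m\<ge>M. \<forall>n\<ge>M. dist (T m t f) (T n t f) < e"
      by (metis dist_norm dist_triangle_half_r)
  qed
qed

lemma T_conv: 
  assumes t: "0 \<le> t" shows "convergent (\<lambda>n. T n t f)"
proof -
  have "Cauchy (\<lambda>n. T n t f)"
  proof (rule metric_CauchyI)
    fix e :: real assume e: "0 < e"
    then obtain u where u: "u \<in> D2" "dist u f < e / 3"
      using D2_dense closure_approachable[of f D2] by (metis UNIV_I divide_pos_pos zero_less_numeral)
    obtain M where M: "\<And>m n. m \<ge> M \<Longrightarrow> n \<ge> M \<Longrightarrow> dist (T m t u) (T n t u) < e / 3"
      using metric_CauchyD[OF T_conv_D2[OF u(1) t], of "e / 3"] e by auto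
    obtain N where N: "\<And>n x. n \<ge> N \<Longrightarrow> linear (T n t) \<and> norm (T n t x) \<le> norm x"
      using T_good[OF t] by (auto simp: eventually_sequentially)
    have 1: "dist (T n t f) (T n t u) \<le> dist f u" if "n \<ge> N" for n
      using N[OF that] by (metis dist_norm linear_diff)
    have "dist (T m t f) (T n t f) < e" if "m \<ge> max M N" "n \<ge> max M N" for m n
    proof -
      have "dist (T m t f) (T n t f) \<le> dist (T m t f) (T m t u) + dist (T m t u) (T n t u) + dist (T n t f) (T n t u)"
        by (smt (verit) dist_commute dist_triangle)
      then show ?thesis using 1[of m] 1[of n] M[of m n] that u(2) by (simp add: dist_commute)
    qed
    then show "\<exists>M. \<forall>m\<ge>M. \<forall>n\<ge>M. dist (T m t f) (T n t f) < e" by blast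
  qed
  then show ?thesis by (rule Cauchy_convergent_space)
qed

section \<open>The limit semigroup\<close>

definition S :: "real \<Rightarrow> 'a \<Rightarrow> 'a" where
  "S t f = lim (\<lambda>n. T n t f)"

lemma T_tendsto: "0 \<le> t \<Longrightarrow> (\<lambda>n. T n t f) \<longlonglongrightarrow> S t f"
  unfolding S_def using T_conv convergent_LIMSEQ_iff by blast

lemma S_0 [simp]: "S 0 f = f"
proof -
  have "T n 0 f = f" for n unfolding T_def by (induction "(2::nat) ^ n") (auto simp: id_funpow[unfolded id_def] J_def[abs_def])
  then show ?thesis using T_tendsto[of 0 f] by (simp add: LIMSEQ_const_iff)
qed

lemma S_norm: assumes "0 \<le> t" shows "norm (S t f) \<le> norm f"
proof (rule tendsto_upperbound[OF tendsto_norm[OF T_tendsto[OF assms]]])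
  show "\<forall>\<^sub>F n in sequentially. norm (T n t f) \<le> norm f"
    using T_good[OF assms] by eventually_elim simp
qed simp

lemma S_linear: assumes "0 \<le> t" shows "linear (S t)"
proof (rule linearI)
  fix f g
  have "(\<lambda>n. T n t (f + g)) \<longlonglongrightarrow> S t f + S t g"
  proof (rule Lim_transform_eventually[OF tendsto_add[OF T_tendsto T_tendsto]])
    show "\<forall>\<^sub>F n in sequentially. T n t f + T n t g = T n t (f + g)"
      using T_good[OF assms] by eventually_elim (simp add: linear_add)
  qed (use assms in auto)
  then show "S t (f + g) = S t f + S t g"
    using T_tendsto[OF assms] LIMSEQ_unique by blast
next
  fix c f
  have "(\<lambda>n. T n t (c *\<^sub>R f)) \<longlonglongrightarrow> c *\<^sub>R S t f"
  proof (rule Lim_transform_eventually[OF tendsto_scaleR[OF tendsto_const T_tendsto]])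
    show "\<forall>\<^sub>F n in sequentially. c *\<^sub>R T n t f = T n t (c *\<^sub>R f)"
      using T_good[OF assms] by eventually_elim (simp add: linear_scale)
  qed (use assms in auto)
  then show "S t (c *\<^sub>R f) = c *\<^sub>R S t f"
    using T_tendsto[OF assms] LIMSEQ_unique by blast
qed

lemma closed_eq_by_density:
  assumes "continuous_on UNIV F" "continuous_on UNIV G" "\<And>x. x \<in> D2 \<Longrightarrow> F x = (G x :: 'a)"
  shows "F x = G x"
proof -
  have "closed {x. F x = G x}" using assms by (intro closed_Collect_eq) 
  then have "closure D2 \<subseteq> {x. F x = G x}" using assms(3) by (intro closure_minimal) auto
  then show ?thesis using D2_dense by auto
qed

lemma S_bounded_linear: "0 \<le> t \<Longrightarrow> bounded_linear (S t)"
  using S_linear S_norm by (intro bounded_linear.intro bounded_linear_axioms.intro exI[of _ 1]) auto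

lemma S_cont: "0 \<le> t \<Longrightarrow> continuous_on X (S t)"
  using S_bounded_linear by (rule linear_continuous_on)

lemma S_add:
  assumes t: "0 \<le> t" and s: "0 \<le> s" shows "S (t + s) f = S t (S s f)"
proof (rule closed_eq_by_density[where F = "S (t + s)" and G = "\<lambda>f. S t (S s f)"])
  show "continuous_on UNIV (S (t + s))" using t s by (intro S_cont) auto
  show "continuous_on UNIV (\<lambda>f. S t (S s f))"
    using continuous_on_compose[OF S_cont S_cont, of s t UNIV] t s by (simp add: o_def)
next
  fix f assume "f \<in> D2"
  then obtain g k where fg: "(f, g) \<in> A" and gk: "(g, k) \<in> A" by (auto simp: D2_def)
  have "(\<lambda>n. T n (t + s) f - T n t (T n s f)) \<longlonglongrightarrow> 0"
  proof (rule Lim_null_comparison)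
    show "\<forall>\<^sub>F n in sequentially. norm (T n (t + s) f - T n t (T n s f)) \<le> t * s * norm k * (1 / 2) ^ n"
      using small[of "t + s"]
    proof eventually_elim
      case (elim n)
      \<comment> \<open>At level \<open>n\<close> both sides are \<open>2^n\<close>-fold powers, of
        \<open>J (a + b)\<close> and of \<open>J a J b\<close>; the one-step error
        \<open>a b\<close> times \<open>2^n\<close> is \<open>t s / 2^n\<close>.\<close>
      let ?a = "t / 2 ^ n" and ?b = "s / 2 ^ n"
      have ab: "0 \<le> ?a" "0 \<le> ?b" "?a + ?b < h0" "?a < h0" "?b < h0"
        using t s elim by (auto simp: add_divide_distrib) (smt (verit) divide_nonneg_nonneg zero_le_power)+
      have comm: "(J ?a ^^ m) (J ?b x) = J ?b ((J ?a ^^ m) x)" for m x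
        by (induction m) (auto simp: J_commute[of ?a ?b] ab)
      have pw: "((\<lambda>x. J ?a (J ?b x)) ^^ m) x = (J ?a ^^ m) ((J ?b ^^ m) x)" for m x
        by (induction m) (auto simp: comm)
      have "norm ((J (?a + ?b) ^^ (2 ^ n)) f - ((\<lambda>x. J ?a (J ?b x)) ^^ (2 ^ n)) f) \<le> real (2 ^ n) * (?a * ?b * norm k)"
      proof (rule funpow_contraction_diff)
        show "linear (J (?a + ?b))" "\<And>x. norm (J (?a + ?b) x) \<le> norm x" using ab by (auto intro: J_linear J_norm)
        show "linear (\<lambda>x. J ?a (J ?b x))" using linear_compose[OF J_linear J_linear, of ?b ?a] ab by (simp add: o_def)
        show "\<And>x. norm (J ?a (J ?b x)) \<le> norm x" using ab by (meson J_norm order_trans)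
        show "\<And>x. J (?a + ?b) (J ?a (J ?b x)) = J ?a (J ?b (J (?a + ?b) x))"
          by (simp only: J_commute[OF add_nonneg_nonneg[OF ab(1,2)] ab(3)] ab)
        show "norm (J (?a + ?b) f - J ?a (J ?b f)) \<le> ?a * ?b * norm k"
          by (rule J_add_compare[OF fg gk ab(1-3)])
      qed
      moreover have "real (2 ^ n) * (?a * ?b * norm k) = t * s * norm k * (1 / 2) ^ n"
        by (simp add: power_divide)
      ultimately show ?case
        unfolding pw by (simp add: T_def add_divide_distrib)
    qed
    have "(\<lambda>n. t * s * norm k * (1 / 2) ^ n) \<longlonglongrightarrow> t * s * norm k * 0"
      by (intro tendsto_intros) auto
    then show "(\<lambda>n. t * s * norm k * (1 / 2) ^ n) \<longlonglongrightarrow> 0" by simp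
  qed
  moreover have "(\<lambda>n. T n t (T n s f)) \<longlonglongrightarrow> S t (S s f)"
    by (rule tendsto_linear_contractions[OF T_good[OF t] T_tendsto[OF s] T_tendsto[OF t]])
  ultimately have "(\<lambda>n. T n (t + s) f) \<longlonglongrightarrow> S t (S s f)"
    using tendsto_add[of "\<lambda>n. T n (t + s) f - T n t (T n s f)" 0 _ "\<lambda>n. T n t (T n s f)"] by simp
  then show "S (t + s) f = S t (S s f)"
    using T_tendsto[OF add_nonneg_nonneg[OF t s], of f] LIMSEQ_unique by blast
qed

lemma S_norm_diff:
  assumes "(f, g) \<in> A" "0 \<le> t" shows "norm (S t f - f) \<le> t * norm g"
proof (rule tendsto_upperbound[OF tendsto_norm[OF tendsto_diff[OF T_tendsto[OF assms(2)] tendsto_const]]])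
  show "\<forall>\<^sub>F n in sequentially. norm (T n t f - f) \<le> t * norm g"
    using small[of t]
  proof eventually_elim
    case (elim n)
    show ?case using funpow_J(4)[of "t / 2 ^ n" f g "2 ^ n"] assms elim by (simp add: T_def)
  qed
qed simp

lemma S_tendsto_0: "((\<lambda>t. S t f) \<longlongrightarrow> f) (at_right 0)"
proof (rule tendstoI)
  fix e :: real assume e: "0 < e"
  have "f \<in> closure (fst ` A)" using dense_A by simp
  then obtain u v where uv: "(u, v) \<in> A" "dist u f < e / 3"
    using e closure_approachable[of f "fst ` A"] by (metis divide_pos_pos fst_conv imageE prod.collapse zero_less_numeral)
  have "((\<lambda>h. h * norm v) \<longlongrightarrow> 0 * norm v) (at_right 0)"
    by (intro tendsto_intros)
  then have "\<forall>\<^sub>F h in at_right 0. h * norm v < e / 3"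
    using e by (intro order_tendstoD) auto
  moreover have "\<forall>\<^sub>F h in at_right 0. h \<in> {0<..<h0}"
    using h0 by (rule eventually_at_right_real)
  ultimately show "\<forall>\<^sub>F h in at_right 0. dist (S h f) f < e"
  proof eventually_elim
    case (elim h)
    have "S h f - f = S h (f - u) + (S h u - u) + (u - f)"
      using S_linear[of h] elim by (simp add: linear_diff)
    also have "norm \<dots> \<le> norm (S h (f - u)) + norm (S h u - u) + norm (u - f)"
      by norm
    also have "norm (S h (f - u)) \<le> norm (f - u)" using elim by (intro S_norm) auto
    also have "norm (S h u - u) \<le> h * norm v" using elim uv by (intro S_norm_diff) auto
    finally show ?case using uv elim by (simp add: dist_norm norm_minus_commute)
  qed
qed

lemma S_diff_norm:
  assumes "0 \<le> s" "0 \<le> t" shows "norm (S s f - S t f) \<le> norm (S \<bar>s - t\<bar> f - f)"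
proof -
  have *: "norm (S a f - S b f) \<le> norm (S (a - b) f - f)" if "0 \<le> b" "b \<le> a" for a b
  proof -
    have "S a f - S b f = S b (S (a - b) f - f)"
      using S_add[of b "a - b" f] S_linear[of b] that by (simp add: linear_diff)
    then show ?thesis using S_norm that by metis
  qed
  show ?thesis
  proof (cases "t \<le> s")
    case True then show ?thesis using *[of t s] assms by simp
  next
    case False then show ?thesis using *[of s t] assms by (simp add: norm_minus_commute)
  qed
qed

lemma S_continuous_time: "continuous_on {0..} (\<lambda>t. S t f)"
  unfolding continuous_on_iff
proof (intro ballI allI impI)
  fix t e :: real assume t: "t \<in> {0..}" and e: "0 < e"
  have "\<forall>\<^sub>F h in at_right 0. dist (S h f) f < e" using S_tendsto_0 e by (rule tendstoD)
  then obtain d where d: "0 < d" "\<And>h. 0 < h \<Longrightarrow> h < d \<Longrightarrow> dist (S h f) f < e"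
    unfolding eventually_at_right_field by auto
  have "dist (S s f) (S t f) < e" if "s \<in> {0..}" "dist s t < d" for s
  proof (cases "s = t")
    case False
    have "dist (S s f) (S t f) \<le> norm (S \<bar>s - t\<bar> f - f)"
      using S_diff_norm[of s t f] that t by (simp add: dist_norm)
    also have "\<dots> < e" using d(2)[of "\<bar>s - t\<bar>"] that False by (simp add: dist_norm)
    finally show ?thesis .
  qed (use e in simp)
  then show "\<exists>d>0. \<forall>s\<in>{0..}. dist s t < d \<longrightarrow> dist (S s f) (S t f) < e" using d(1) by blast
qed

section \<open>Time derivatives and the generator of the semigroup\<close>

lemma S_step_D2:
  assumes fg: "(f, g) \<in> A" and gk: "(g, k) \<in> A" and t: "0 \<le> t" "t < h0"
  shows "norm (S t f - f - t *\<^sub>R g) \<le> 2 * t\<^sup>2 * norm k"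
proof -
  \<comment> \<open>\<open>J t\<close> is the crudest approximation \<open>T 0 t\<close>, so the
    Cauchy estimate from level 0 applies.\<close>
  have "norm (J t f - S t f) \<le> t\<^sup>2 * norm k"
  proof (rule tendsto_upperbound[OF tendsto_norm[OF tendsto_diff[OF tendsto_const T_tendsto[OF t(1)]]]])
    show "\<forall>\<^sub>F n in sequentially. norm (J t f - T n t f) \<le> t\<^sup>2 * norm k"
    proof (rule always_eventually, rule allI)
      fix n
      have "norm (J t f - T n t f) \<le> t\<^sup>2 * norm k * (1 - 1 / 2 ^ n)"
        using T_Cauchy[OF fg gk t(1), of 0 n] t by (simp add: T_def)
      also have "\<dots> \<le> t\<^sup>2 * norm k * 1" by (intro mult_left_mono) auto
      finally show "norm (J t f - T n t f) \<le> t\<^sup>2 * norm k" by simp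
    qed
  qed simp
  moreover have "norm (J t f - f - t *\<^sub>R g) \<le> t\<^sup>2 * norm k"
  proof -
    have "J t f - f - t *\<^sub>R g = t *\<^sub>R (J t g - g)" using J_snd[OF fg t] by (simp add: algebra_simps)
    then have "norm (J t f - f - t *\<^sub>R g) = t * norm (J t g - g)" using t by simp
    also have "\<dots> \<le> t * (t * norm k)" by (intro mult_left_mono J_norm_diff gk t)
    finally show ?thesis by (simp add: power2_eq_square)
  qed
  moreover have "norm (S t f - f - t *\<^sub>R g) \<le> norm (J t f - f - t *\<^sub>R g) + norm (J t f - S t f)"
    using norm_triangle_ineq4[of "J t f - f - t *\<^sub>R g" "J t f - S t f"] by (simp add: algebra_simps)
  ultimately show ?thesis by linarith
qed

text \<open>This is what writing \<open>S t f - f\<close> as the integral of \<open>S s g\<close>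
  would give. It comes from sums over equal time steps on \<open>D2\<close> and is then extended by
  resolvent smoothing.\<close>

lemma S_step:
  assumes fg: "(f, g) \<in> A" and t: "0 \<le> t" and c: "\<And>s. 0 \<le> s \<Longrightarrow> s \<le> t \<Longrightarrow> norm (S s g - g) \<le> c"
  shows "norm (S t f - f - t *\<^sub>R g) \<le> t * c"
proof -
  have D2: "norm (S t f - f - t *\<^sub>R g) \<le> t * c"
    if fg: "(f, g) \<in> A" and gk: "(g, k) \<in> A" and c: "\<And>s. 0 \<le> s \<Longrightarrow> s \<le> t \<Longrightarrow> norm (S s g - g) \<le> c" for f g k c
  proof -
    have *: "norm (S (real m * h) f - f - (real m * h) *\<^sub>R g) \<le> real m * (2 * h\<^sup>2 * norm k + h * c)"
      if h: "0 < h" "h < h0" "real m * h \<le> t" for m h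
      using h(3)
    proof (induction m)
      case (Suc m)
      have mh: "0 \<le> real m * h" "real m * h \<le> t" using h Suc.prems by (auto simp: algebra_simps)
      have "S (real (Suc m) * h) f = S (real m * h) (S h f)"
        using S_add[of "real m * h" h f] mh h by (simp add: algebra_simps)
      then have "S (real (Suc m) * h) f - f - (real (Suc m) * h) *\<^sub>R g
          = (S (real m * h) f - f - (real m * h) *\<^sub>R g) + S (real m * h) (S h f - f - h *\<^sub>R g)
            + h *\<^sub>R (S (real m * h) g - g)"
        using S_linear[OF mh(1)] by (simp add: linear_diff linear_scale linear_add algebra_simps)
      also have "norm \<dots> \<le> norm (S (real m * h) f - f - (real m * h) *\<^sub>R g)
           + norm (S (real m * h) (S h f - f - h *\<^sub>R g)) + norm (h *\<^sub>R (S (real m * h) g - g))"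
        by (intro order_trans[OF norm_triangle_ineq] add_mono norm_triangle_ineq order_refl)
      also have "norm (S (real m * h) (S h f - f - h *\<^sub>R g)) \<le> 2 * h\<^sup>2 * norm k"
        using S_norm[OF mh(1)] S_step_D2[OF fg gk, of h] h by (meson less_imp_le order_trans)
      also have "norm (h *\<^sub>R (S (real m * h) g - g)) \<le> h * c"
        using c[OF mh] h by (simp add: mult_left_mono)
      finally show ?case using Suc.IH[OF mh(2)] by (simp add: algebra_simps)
    qed simp
    have "(\<lambda>n. 2 * t\<^sup>2 * norm k / real (Suc n) + t * c) \<longlonglongrightarrow> 0 + t * c"
      by (intro tendsto_add tendsto_const LIMSEQ_Suc lim_const_over_n)
    moreover have "\<forall>\<^sub>F n in sequentially. norm (S t f - f - t *\<^sub>R g) \<le> 2 * t\<^sup>2 * norm k / real (Suc n) + t * c"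
    proof -
      have "(\<lambda>n. t / real (Suc n)) \<longlonglongrightarrow> 0" by (intro LIMSEQ_Suc lim_const_over_n)
      then have "\<forall>\<^sub>F n in sequentially. t / real (Suc n) < h0" using h0 by (rule order_tendstoD)
      then show ?thesis
      proof eventually_elim
        case (elim n)
        show ?case
        proof (cases "t = 0")
          case False
          let ?h = "t / real (Suc n)"
          have eq: "real (Suc n) * ?h = t" by (metis nonzero_mult_div_cancel_left of_nat_0_eq_iff old.nat.distinct(2) times_divide_eq_right)
          have "norm (S t f - f - t *\<^sub>R g) \<le> real (Suc n) * (2 * ?h\<^sup>2 * norm k + ?h * c)"
            using *[of ?h "Suc n"] elim t False unfolding eq by simp
          also have "\<dots> = 2 * (real (Suc n) * ?h) * ?h * norm k + (real (Suc n) * ?h) * c"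
            by (simp only: power2_eq_square ring_distribs mult_ac)
          also have "\<dots> = 2 * t\<^sup>2 * norm k / real (Suc n) + t * c"
            unfolding eq by (simp add: power2_eq_square)
          finally show ?thesis .
        qed simp
      qed
    qed
    ultimately show ?thesis by (simp add: tendsto_lowerbound)
  qed
  \<comment> \<open>\<open>J h f\<close> lies in \<open>D2\<close>, and \<open>J h f\<close>,
    \<open>J h g\<close> converge to \<open>f\<close>, \<open>g\<close>. This removes the extra
    regularity; the additional error \<open>2 norm (J h g - g)\<close> vanishes in the
    limit.\<close>
  have "((\<lambda>h. norm (S t (J h f) - J h f - t *\<^sub>R J h g)) \<longlongrightarrow> norm (S t f - f - t *\<^sub>R g)) (at_right 0)"
    by (intro tendsto_intros J_tendsto bounded_linear.tendsto[OF S_bounded_linear[OF t]])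
  moreover have "((\<lambda>h. t * (c + 2 * norm (J h g - g))) \<longlongrightarrow> t * (c + 2 * norm (g - g))) (at_right 0)"
    by (intro tendsto_intros J_tendsto)
  moreover have "\<forall>\<^sub>F h in at_right 0. norm (S t (J h f) - J h f - t *\<^sub>R J h g) \<le> t * (c + 2 * norm (J h g - g))"
    using eventually_at_right_real[OF h0]
  proof eventually_elim
    case (elim h)
    then have h: "0 < h" "h < h0" by auto
    show ?case
    proof (rule D2[OF J_A[OF fg less_imp_le[OF h(1)] h(2)] J_D2(1)[OF fg h]])
      fix s assume s: "0 \<le> s" "s \<le> t"
      have "S s (J h g) - J h g = S s (J h g - g) + (S s g - g) - (J h g - g)"
        using S_linear[OF s(1)] by (simp add: linear_diff)
      also have "norm \<dots> \<le> norm (S s (J h g - g)) + norm (S s g - g) + norm (J h g - g)" by norm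
      finally show "norm (S s (J h g) - J h g) \<le> c + 2 * norm (J h g - g)"
        using c[OF s] S_norm[OF s(1), of "J h g - g"] by simp
    qed
  qed
  ultimately have "norm (S t f - f - t *\<^sub>R g) \<le> t * (c + 2 * norm (g - g))"
    by (intro tendsto_le[OF trivial_limit_at_right_real])
  then show ?thesis by simp
qed

text \<open>A product rule for the semigroup applied to a moving vector. It serves the uniqueness
  argument and, with \<open>F\<close> itself containing the semigroup, the derivative of
  correlations in the earlier time.\<close>

lemma S_has_vector_derivative_compose:
  assumes F: "(F has_vector_derivative F') (at s within {0..b})" and G: "(F s, G) \<in> A" and s: "0 \<le> s"
  shows "((\<lambda>s. S s (F s)) has_vector_derivative S s (G + F')) (at s within {0..b})"
proof -
  have SD: "((\<lambda>y. norm (S y f - S s f)) \<longlongrightarrow> 0) (at s within {0..b})" for f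
  proof -
    have "((\<lambda>y. S y f) \<longlongrightarrow> S s f) (at s within {0..b})"
      using S_continuous_time[of f] s
      by (meson atLeastAtMost_iff atLeast_iff continuous_on_def subsetI tendsto_within_subset)
    then show ?thesis by (simp add: tendsto_norm_zero LIM_zero)
  qed
  have step: "\<exists>\<delta>>0. \<forall>y. 0 \<le> y \<longrightarrow> \<bar>y - s\<bar> < \<delta> \<longrightarrow>
      norm (S y (F s) - S s (F s) - (y - s) *\<^sub>R S s G) \<le> \<bar>y - s\<bar> * e" if e: "0 < e" for e
  proof -
    have "\<forall>\<^sub>F h in at_right 0. dist (S h G) G < e / 2" using S_tendsto_0 e by (intro tendstoD) auto
    then obtain d where d: "0 < d" "\<And>h. 0 < h \<Longrightarrow> h < d \<Longrightarrow> dist (S h G) G < e / 2"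
      unfolding eventually_at_right_field by auto
    then have d': "norm (S h G - G) \<le> e / 2" if "0 \<le> h" "h < d" for h
      using that e by (cases "h = 0") (auto simp: dist_norm less_imp_le)
    have "norm (S y (F s) - S s (F s) - (y - s) *\<^sub>R S s G) \<le> \<bar>y - s\<bar> * e" if y: "0 \<le> y" "\<bar>y - s\<bar> < d" for y
    proof (cases "s \<le> y")
      case True
      have "S y (F s) = S s (S (y - s) (F s))" using S_add[of s "y - s" "F s"] s True by simp
      then have "S y (F s) - S s (F s) - (y - s) *\<^sub>R S s G = S s (S (y - s) (F s) - F s - (y - s) *\<^sub>R G)"
        using S_linear[OF s] by (simp add: linear_diff linear_scale)
      also have "norm \<dots> \<le> norm (S (y - s) (F s) - F s - (y - s) *\<^sub>R G)" by (rule S_norm[OF s])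
      also have "\<dots> \<le> (y - s) * (e / 2)" using True y d' by (intro S_step[OF G]) auto
      also have "\<dots> \<le> \<bar>y - s\<bar> * e" using True e by (intro mult_mono) auto
      finally show ?thesis .
    next
      case False
      \<comment> \<open>The semigroup cannot be run backwards from \<open>s\<close>; instead the
        vectors at time \<open>s\<close> are rewritten as images under \<open>S y\<close> after a
        lag \<open>h\<close>.\<close>
      define h where "h = s - y"
      have h: "0 < h" "h < d" using False y by (auto simp: h_def)
      have eq: "S s x = S y (S h x)" for x using S_add[of y h x] y h by (simp add: h_def)
      have "S y (F s) - S s (F s) - (y - s) *\<^sub>R S s G = S y (h *\<^sub>R (S h G - G) - (S h (F s) - F s - h *\<^sub>R G))"
        unfolding eq[of "F s"] eq[of G] using S_linear[OF y(1)] by (simp add: linear_diff linear_scale linear_add h_def algebra_simps)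
      also have "norm \<dots> \<le> norm (h *\<^sub>R (S h G - G) - (S h (F s) - F s - h *\<^sub>R G))" by (rule S_norm[OF y(1)])
      also have "\<dots> \<le> norm (h *\<^sub>R (S h G - G)) + norm (S h (F s) - F s - h *\<^sub>R G)" by (rule norm_triangle_ineq4)
      also have "norm (h *\<^sub>R (S h G - G)) \<le> h * (e / 2)" using d'[of h] h by (simp add: mult_left_mono)
      also have "norm (S h (F s) - F s - h *\<^sub>R G) \<le> h * (e / 2)" using h d' by (intro S_step[OF G]) auto
      finally show ?thesis using h by (simp add: h_def mult.commute)
    qed
    then show ?thesis using d(1) by blast
  qed
  have F2: "\<exists>\<delta>>0. \<forall>y\<in>{0..b}. \<bar>y - s\<bar> < \<delta> \<longrightarrow>
      norm (F y - F s - (y - s) *\<^sub>R F') \<le> \<bar>y - s\<bar> * e" if "0 < e" for e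
    using F that unfolding has_vector_derivative_def has_derivative_within_alt
    by (auto simp: mult.commute)
  have SD2: "\<exists>\<delta>>0. \<forall>y. 0 \<le> y \<longrightarrow> \<bar>y - s\<bar> < \<delta> \<longrightarrow> norm (S y f - S s f) \<le> e" if "0 < e" for e f
    using S_continuous_time[of f] s that unfolding continuous_on_iff
    by (fastforce simp: dist_norm intro: less_imp_le)
  show ?thesis
    unfolding has_vector_derivative_def has_derivative_within_alt
  proof (intro conjI allI impI)
    show "bounded_linear (\<lambda>x. x *\<^sub>R S s (G + F'))" by (rule bounded_linear_scaleR_left)
    fix e :: real assume e: "0 < e"
    then have e3: "0 < e / 3" by simp
    obtain d1 where d1: "0 < d1" "\<And>y. 0 \<le> y \<Longrightarrow> \<bar>y - s\<bar> < d1 \<Longrightarrow>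
      norm (S y (F s) - S s (F s) - (y - s) *\<^sub>R S s G) \<le> \<bar>y - s\<bar> * (e / 3)" using step[OF e3] by auto
    obtain d2 where d2: "0 < d2" "\<And>y. y \<in> {0..b} \<Longrightarrow> \<bar>y - s\<bar> < d2 \<Longrightarrow>
      norm (F y - F s - (y - s) *\<^sub>R F') \<le> \<bar>y - s\<bar> * (e / 3)" using F2[OF e3] by auto
    obtain d3 where d3: "0 < d3" "\<And>y. 0 \<le> y \<Longrightarrow> \<bar>y - s\<bar> < d3 \<Longrightarrow> norm (S y F' - S s F') \<le> e / 3"
      using SD2[OF e3] by auto
    show "\<exists>d>0. \<forall>y\<in>{0..b}. norm (y - s) < d \<longrightarrow>
        norm (S y (F y) - S s (F s) - (y - s) *\<^sub>R S s (G + F')) \<le> e * norm (y - s)"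
    proof (intro exI[of _ "min d1 (min d2 d3)"] conjI ballI impI)
      fix y assume y: "y \<in> {0..b}" "norm (y - s) < min d1 (min d2 d3)"
      then have y0: "0 \<le> y" by simp
      have "S y (F y) - S s (F s) - (y - s) *\<^sub>R S s (G + F')
        = S y (F y - F s - (y - s) *\<^sub>R F') + (y - s) *\<^sub>R (S y F' - S s F') + (S y (F s) - S s (F s) - (y - s) *\<^sub>R S s G)"
        using S_linear[OF y0] S_linear[OF s] by (simp add: linear_diff linear_add linear_scale algebra_simps)
      also have "norm \<dots> \<le> norm (S y (F y - F s - (y - s) *\<^sub>R F')) + norm ((y - s) *\<^sub>R (S y F' - S s F'))
           + norm (S y (F s) - S s (F s) - (y - s) *\<^sub>R S s G)"
        by (intro order_trans[OF norm_triangle_ineq] add_mono norm_triangle_ineq order_refl)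
      also have "norm (S y (F y - F s - (y - s) *\<^sub>R F')) \<le> \<bar>y - s\<bar> * (e / 3)"
        using d2(2)[of y] y by (intro order_trans[OF S_norm[OF y0]]) auto
      also have "norm ((y - s) *\<^sub>R (S y F' - S s F')) \<le> \<bar>y - s\<bar> * (e / 3)"
        using d3(2)[of y] y unfolding norm_scaleR by (intro mult_left_mono) auto
      also have "norm (S y (F s) - S s (F s) - (y - s) *\<^sub>R S s G) \<le> \<bar>y - s\<bar> * (e / 3)"
        using d1(2)[of y] y by simp
      finally show "norm (S y (F y) - S s (F s) - (y - s) *\<^sub>R S s (G + F')) \<le> e * norm (y - s)"
        by (simp add: algebra_simps)
    qed (use d1 d2 d3 in auto)
  qed
qed

lemma S_has_vector_derivative:
  assumes "(f, g) \<in> A" "0 \<le> s"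
  shows "((\<lambda>s. S s f) has_vector_derivative S s g) (at s within {0..b})"
  using S_has_vector_derivative_compose[of "\<lambda>_. f" 0 s b g] assms by simp

text \<open>\<open>S s (F (t - s))\<close> has derivative zero, because running the semigroup
  forward cancels running \<open>F\<close> backward. Its values at the two ends are the two
  sides.\<close>

lemma S_unique_time:
  assumes F: "\<And>s. s \<in> {0..t} \<Longrightarrow> (F has_vector_derivative F' s) (at s within {0..t})"
    and A: "\<And>s. s \<in> {0..t} \<Longrightarrow> (F s, F' s) \<in> A" and t: "0 \<le> t"
  shows "F t = S t (F 0)"
proof -
  have "((\<lambda>s. S s (F (t - s))) has_vector_derivative S s (F' (t - s) + - F' (t - s))) (at s within {0..t})" if s: "s \<in> {0..t}" for s
  proof (rule S_has_vector_derivative_compose)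
    have "((F \<circ> (\<lambda>s. t - s)) has_vector_derivative (-1) *\<^sub>R F' (t - s)) (at s within {0..t})"
    proof (rule vector_diff_chain_within)
      show "((-) t has_vector_derivative -1) (at s within {0..t})"
        by (auto intro!: derivative_eq_intros)
      have "(-) t ` {0..t} = {0..t}" by (auto simp: image_iff intro!: bexI[of _ "t - _"])
      then show "(F has_vector_derivative F' (t - s)) (at (t - s) within (-) t ` {0..t})"
        using F[of "t - s"] s by simp
    qed
    then show "((\<lambda>s. F (t - s)) has_vector_derivative - F' (t - s)) (at s within {0..t})" by (simp add: o_def)
    show "(F (t - s), F' (t - s)) \<in> A" using A s by simp
  qed (use s in simp)
  moreover have "S s 0 = 0" if "0 \<le> s" for s using S_linear[OF that] linear_0 by blast
  ultimately have "((\<lambda>s. S s (F (t - s))) has_derivative (\<lambda>h. 0)) (at s within {0..t})" if "s \<in> {0..t}" for s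
    using that by (fastforce simp: has_vector_derivative_def)
  from has_derivative_zero_unique[OF convex_real_interval(5) this, of t 0]
  show ?thesis using t by simp
qed

lemma generator_S: "{(f, g). ((\<lambda>t. (S t f - f) /\<^sub>R t) \<longlongrightarrow> g) (at_right 0)} = A"
proof -
  have sub: "((\<lambda>t. (S t f - f) /\<^sub>R t) \<longlongrightarrow> g) (at_right 0)" if "(f, g) \<in> A" for f g
  proof (rule tendstoI)
    fix e :: real assume e: "0 < e"
    have "\<forall>\<^sub>F h in at_right 0. dist (S h g) g < e / 2" using S_tendsto_0 e by (intro tendstoD) auto
    then obtain d where d: "0 < d" "\<And>h. 0 < h \<Longrightarrow> h < d \<Longrightarrow> dist (S h g) g < e / 2"
      unfolding eventually_at_right_field by auto
    then have d': "norm (S h g - g) \<le> e / 2" if "0 \<le> h" "h < d" for h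
      using that e by (cases "h = 0") (auto simp: dist_norm less_imp_le)
    show "\<forall>\<^sub>F t in at_right 0. dist ((S t f - f) /\<^sub>R t) g < e"
      using eventually_at_right_real[OF d(1)]
    proof eventually_elim
      case (elim t)
      have "norm (S t f - f - t *\<^sub>R g) \<le> t * (e / 2)" using elim d' by (intro S_step[OF that]) auto
      moreover have "(S t f - f) /\<^sub>R t - g = (S t f - f - t *\<^sub>R g) /\<^sub>R t" using elim by (simp add: scaleR_diff_right)
      moreover have "norm ((S t f - f - t *\<^sub>R g) /\<^sub>R t) = norm (S t f - f - t *\<^sub>R g) / t"
        using elim by (simp add: divide_inverse mult.commute)
      ultimately have "norm ((S t f - f) /\<^sub>R t - g) \<le> e / 2"
        using elim by (simp only: pos_divide_le_eq greaterThanLessThan_iff mult.commute)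
      then show ?case using e by (simp add: dist_norm)
    qed
  qed
  have "(f, g) \<in> A" if lim: "((\<lambda>t. (S t f - f) /\<^sub>R t) \<longlongrightarrow> g) (at_right 0)" for f g
  proof -
    define h where "h = h0 / 2"
    have h: "0 < h" "h < h0" using h0 by (auto simp: h_def)
    obtain u v where uv: "(u, v) \<in> A" "u - h *\<^sub>R v = f - h *\<^sub>R g" using range_A[OF h] by blast
    \<comment> \<open>\<open>w\<close> would satisfy \<open>d/dt S t w = w / h\<close> at time 0, a
      growth that a contraction semigroup forbids; so the pair found by the range condition is
      \<open>(f, g)\<close> itself.\<close>
    define w where "w = u - f"
    have wh: "v - g = (1 / h) *\<^sub>R w"
    proof -
      have "w = h *\<^sub>R (v - g)" using uv(2) by (simp add: w_def algebra_simps)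
      then show ?thesis using h by simp
    qed
    have "((\<lambda>t. (S t u - u) /\<^sub>R t - (S t f - f) /\<^sub>R t) \<longlongrightarrow> v - g) (at_right 0)"
      by (intro tendsto_diff sub uv lim)
    moreover have "\<forall>\<^sub>F t in at_right 0. (S t u - u) /\<^sub>R t - (S t f - f) /\<^sub>R t = (S t w - w) /\<^sub>R t"
      using eventually_at_right_less[of "0::real"]
      by eventually_elim (use S_linear in \<open>simp add: w_def linear_diff algebra_simps\<close>)
    ultimately have "((\<lambda>t. (S t w - w) /\<^sub>R t) \<longlongrightarrow> (1 / h) *\<^sub>R w) (at_right 0)"
      unfolding wh by (simp add: Lim_transform_eventually)
    then have "((\<lambda>t. norm ((S t w - w) /\<^sub>R t - (1 / h) *\<^sub>R w)) \<longlongrightarrow> 0) (at_right 0)"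
      by (simp add: tendsto_norm_zero LIM_zero)
    moreover have "\<forall>\<^sub>F t in at_right 0. norm w / h \<le> norm ((S t w - w) /\<^sub>R t - (1 / h) *\<^sub>R w)"
      using eventually_at_right_less[of "0::real"]
    proof eventually_elim
      case (elim t)
      have "(1 + t / h) *\<^sub>R w = S t w - t *\<^sub>R ((S t w - w) /\<^sub>R t - (1 / h) *\<^sub>R w)"
        using elim h by (simp add: algebra_simps)
      then have "norm ((1 + t / h) *\<^sub>R w) \<le> norm (S t w) + norm (t *\<^sub>R ((S t w - w) /\<^sub>R t - (1 / h) *\<^sub>R w))"
        by (metis norm_triangle_ineq4)
      then have "(1 + t / h) * norm w \<le> norm w + t * norm ((S t w - w) /\<^sub>R t - (1 / h) *\<^sub>R w)"
        using S_norm[of t w] elim h by simp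
      then have "t * (norm w / h) \<le> t * norm ((S t w - w) /\<^sub>R t - (1 / h) *\<^sub>R w)"
        by (simp add: algebra_simps)
      then show ?case using elim by (simp del: times_divide_eq_right)
    qed
    ultimately have "norm w / h \<le> 0"
      by (intro tendsto_lowerbound[OF _ _ trivial_limit_at_right_real])
    then have "w = 0" using h by (simp add: divide_le_0_iff)
    then have "u = f" "v = g" using wh by (auto simp: w_def)
    then show ?thesis using uv(1) by simp
  qed
  with sub show ?thesis by auto
qed

text \<open>The semigroup is a limit of resolvent powers, so closed conditions preserved by every
  resolvent are preserved by it. With \<open>Y\<close> the observables of a region and
  \<open>A'\<close> the generator of that region, this gives autonomous evolution there.\<close>

lemma S_invariant:
  assumes A': "A' \<subseteq> A" "closed A'" and Y: "closed Y"
    and J: "\<And>f h. f \<in> Y \<Longrightarrow> 0 < h \<Longrightarrow> h < h0 \<Longrightarrow> \<exists>(u, v) \<in> A'. u \<in> Y \<and> u - h *\<^sub>R v = f"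
    and t: "0 \<le> t"
  shows "f \<in> Y \<Longrightarrow> S t f \<in> Y"
    and "(f, g) \<in> A' \<Longrightarrow> f \<in> Y \<Longrightarrow> g \<in> Y \<Longrightarrow> (S t f, S t g) \<in> A'"
proof -
  have JY: "J h f \<in> Y \<and> (h \<noteq> 0 \<longrightarrow> (J h f, (1 / h) *\<^sub>R (J h f - f)) \<in> A')" if f: "f \<in> Y" and h: "0 \<le> h" "h < h0" for f h
  proof (cases "h = 0")
    case False
    then obtain u v where uv: "(u, v) \<in> A'" "u \<in> Y" "u - h *\<^sub>R v = f" using J[OF f, of h] h by auto
    then have "J h f = u" using J_unique[of u v h] A' h by auto
    moreover have "v = (1 / h) *\<^sub>R (u - f)" using uv(3) False by auto
    ultimately show ?thesis using uv by simp
  qed (use f in simp)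
  have pow: "(J h ^^ n) f \<in> Y" if "f \<in> Y" "0 \<le> h" "h < h0" for f h n
    using that by (induction n) (auto simp: JY)
  have ev: "\<forall>\<^sub>F n in sequentially. T n t f \<in> Y" if "f \<in> Y" for f
    using small[of t] by eventually_elim (use that pow t in \<open>simp add: T_def\<close>)
  show SY: "S t f \<in> Y" if "f \<in> Y" for f
    by (rule Lim_in_closed_set[OF Y ev[OF that] _ T_tendsto[OF t]]) simp
  show "(S t f, S t g) \<in> A'" if fg: "(f, g) \<in> A'" and Y: "f \<in> Y" "g \<in> Y"
  proof (cases "t = 0")
    case False
    have "\<forall>\<^sub>F n in sequentially. (T n t f, T n t g) \<in> A'"
      using small[of t]
    proof eventually_elim
      case (elim n)
      let ?h = "t / 2 ^ n"
      have h: "0 < ?h" "0 \<le> ?h" "?h < h0" using elim t False by auto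
      \<comment> \<open>The last resolvent is split off, because membership in \<open>A'\<close> is
        known only for the outcome of a resolvent step started in \<open>Y\<close>.\<close>
      obtain m where m: "(2::nat) ^ n = Suc m" by (metis nat_zero_less_power_iff not0_implies_Suc pos2 less_numeral_extra(3))
      let ?u = "(J ?h ^^ m) f"
      have u: "?u \<in> Y" using pow[OF Y(1)] h by simp
      have "(?u, (J ?h ^^ m) g) \<in> A" using funpow_J(3)[of ?h f g m] fg A' h by auto
      then have "J ?h ?u - ?u = ?h *\<^sub>R J ?h ((J ?h ^^ m) g)" using h by (intro J_snd) auto
      moreover have "?h \<noteq> 0" using False by simp
      ultimately have "(1 / ?h) *\<^sub>R (J ?h ?u - ?u) = J ?h ((J ?h ^^ m) g)" by (simp only: scaleR_scaleR nonzero_divide_eq_eq) simp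
      then have "(J ?h ?u, J ?h ((J ?h ^^ m) g)) \<in> A'" using JY[OF u, of ?h] h by auto
      then show ?case by (simp add: T_def m)
    qed
    from Lim_in_closed_set[OF A'(2) this _ tendsto_Pair[OF T_tendsto[OF t] T_tendsto[OF t]]]
    show ?thesis by simp
  qed (use fg in simp)
qed

text \<open>An operator respecting \<open>A\<close> sends solutions of the resolvent equation to
  solutions; uniqueness makes it commute with \<open>J h\<close>, and the limit makes it commute
  with \<open>S t\<close>.\<close>

lemma S_commute:
  assumes R: "bounded_linear R" and RA: "\<And>f g. (f, g) \<in> A \<Longrightarrow> (R f, R g) \<in> A" and t: "0 \<le> t"
  shows "S t (R f) = R (S t f)"
proof -
  interpret R: bounded_linear R by fact
  have J: "J h (R f) = R (J h f)" if "0 \<le> h" "h < h0" for h f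
  proof (cases "h = 0")
    case False
    then have h: "0 < h" using that by simp
    show ?thesis
      using J_unique[OF RA[OF J_in[OF h that(2)]] that, of f] h by (simp add: R.diff R.scaleR)
  qed simp
  have pow: "(J h ^^ n) (R f) = R ((J h ^^ n) f)" if "0 \<le> h" "h < h0" for h n
    by (induction n) (auto simp: J that)
  have "(\<lambda>n. T n t (R f)) \<longlonglongrightarrow> R (S t f)"
  proof (rule Lim_transform_eventually[OF R.tendsto[OF T_tendsto[OF t]]])
    show "\<forall>\<^sub>F n in sequentially. R (T n t f) = T n t (R f)"
      using small[of t] by eventually_elim (use t pow in \<open>simp add: T_def\<close>)
  qed
  then show ?thesis using T_tendsto[OF t] LIMSEQ_unique by blast
qed

end

section \<open>Continuous functions of configurations\<close>

lemma compact_UNIV_config: "compact (UNIV :: ('v \<Rightarrow> bool) set)"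
  using compact_space_product_topology[of "\<lambda>_::'v. euclidean :: bool topology" UNIV]
  by (simp add: euclidean_product_topology compact_space_def finite_imp_compact)

lemma complete_bcontfun: "Topological_Spaces.complete (UNIV :: ('s::topological_space \<Rightarrow>\<^sub>C 'b::complete_space) set)"
proof (rule completeI)
  fix f :: "nat \<Rightarrow> 's \<Rightarrow>\<^sub>C 'b"
  assume "Cauchy f"
  then obtain g where "uniform_limit UNIV f g sequentially"
    using uniformly_convergent_eq_cauchy[of "\<lambda>_. True" f]
    unfolding Cauchy_def uniform_limit_sequentially_iff
    by (metis dist_fun_lt_imp_dist_val_lt)
  from uniform_limit_bcontfunE[OF this sequentially_bot]
  obtain l where "f \<longlonglongrightarrow> l" by metis
  then show "\<exists>l\<in>UNIV. f \<longlonglongrightarrow> l" by blast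
qed

lemma bcontfun_norm_le:
  assumes "\<And>x. \<bar>apply_bcontfun f x\<bar> \<le> b" shows "norm (f :: 's::topological_space \<Rightarrow>\<^sub>C real) \<le> b"
  using dist_bound[of f 0 b] assms by (simp add: dist_norm)

lemma abs_le_norm: "\<bar>apply_bcontfun f x\<bar> \<le> norm (f :: 's::topological_space \<Rightarrow>\<^sub>C real)"
  using norm_bounded[of f x] by simp

lemma norm_const_bcontfun_1 [simp]: "norm (const_bcontfun 1 :: 's::topological_space \<Rightarrow>\<^sub>C real) = 1"
  using abs_le_norm[of "const_bcontfun 1 :: 's \<Rightarrow>\<^sub>C real"]
  by (intro antisym bcontfun_norm_le) (auto simp: const_bcontfun.rep_eq)

definition bmul :: "('s::topological_space \<Rightarrow>\<^sub>C real) \<Rightarrow> ('s \<Rightarrow>\<^sub>C real) \<Rightarrow> ('s \<Rightarrow>\<^sub>C real)" where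
  "bmul f g = Bcontfun (\<lambda>x. apply_bcontfun f x * apply_bcontfun g x)"

lemma apply_bmul: "apply_bcontfun (bmul f g) x = apply_bcontfun f x * apply_bcontfun g x"
proof -
  have "norm (apply_bcontfun f x * apply_bcontfun g x) \<le> norm f * norm g" for x
    unfolding real_norm_def abs_mult by (intro mult_mono abs_le_norm) auto
  then have "(\<lambda>x. apply_bcontfun f x * apply_bcontfun g x) \<in> bcontfun"
    by (intro bcontfun_normI[of _ "norm f * norm g"] continuous_intros continuous_on_apply_bcontfun)
  then show ?thesis by (simp add: bmul_def Bcontfun_inverse)
qed

lemma norm_bmul: "norm (bmul f g) \<le> norm f * norm g"
  by (rule bcontfun_norm_le) (simp add: apply_bmul abs_mult mult_mono abs_le_norm)

lemma bounded_bilinear_bmul: "bounded_bilinear (bmul :: ('s::topological_space \<Rightarrow>\<^sub>C real) \<Rightarrow> _)"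
proof
  show "\<exists>K. \<forall>a b. norm (bmul a b :: 's \<Rightarrow>\<^sub>C real) \<le> norm a * norm b * K"
    by (intro exI[of _ 1]) (simp add: norm_bmul)
qed (auto intro!: bcontfun_eqI simp: apply_bmul algebra_simps)

lemmas tendsto_bmul = bounded_bilinear.tendsto[OF bounded_bilinear_bmul]

definition dep :: "'v set \<Rightarrow> (('v \<Rightarrow> 'c) \<Rightarrow> 'b) \<Rightarrow> bool" where
  "dep A f \<longleftrightarrow> (\<forall>\<omega> \<omega>'. (\<forall>x\<in>A. \<omega> x = \<omega>' x) \<longrightarrow> f \<omega> = f \<omega>')"

lemma depD: "dep A f \<Longrightarrow> (\<And>x. x \<in> A \<Longrightarrow> \<omega> x = \<omega>' x) \<Longrightarrow> f \<omega> = f \<omega>'"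
  by (auto simp: dep_def)

lemma dep_mono: "dep A f \<Longrightarrow> A \<subseteq> B \<Longrightarrow> dep B f"
  unfolding dep_def by (meson subsetD)

lemma open_cylinder:
  assumes "finite A" shows "open {\<omega>' :: 'v \<Rightarrow> bool. \<forall>x\<in>A. \<omega>' x = \<omega> x}"
proof -
  have "open ((\<lambda>f. f x) -` {\<omega> x} :: ('v \<Rightarrow> bool) set)" for x
    by (intro open_vimage Topological_Spaces.open_discrete continuous_on_product_coordinates)
  then have "open (\<Inter>x\<in>A. (\<lambda>f. f x) -` {\<omega> x} :: ('v \<Rightarrow> bool) set)" using assms by auto
  moreover have "(\<Inter>x\<in>A. (\<lambda>f. f x) -` {\<omega> x}) = {\<omega>' :: 'v \<Rightarrow> bool. \<forall>x\<in>A. \<omega>' x = \<omega> x}" by auto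
  ultimately show ?thesis by simp
qed

lemma cylinder_nhd:
  assumes "open S" "(\<omega> :: 'v \<Rightarrow> bool) \<in> S"
  obtains A where "finite A" "{\<omega>'. \<forall>x\<in>A. \<omega>' x = \<omega> x} \<subseteq> S"
proof -
  have "openin (product_topology (\<lambda>i. euclidean) UNIV) S"
    using assms(1) by (simp add: euclidean_product_topology)
  from product_topology_open_contains_basis[OF this assms(2)]
  obtain X where X: "\<omega> \<in> Pi\<^sub>E UNIV X" "finite {i. X i \<noteq> topspace euclidean}" "Pi\<^sub>E UNIV X \<subseteq> S" by auto
  show ?thesis
  proof (rule that[OF X(2)], rule subsetI)
    fix \<omega>' assume "\<omega>' \<in> {\<omega>'. \<forall>x\<in>{i. X i \<noteq> topspace euclidean}. \<omega>' x = \<omega> x}"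
    then have "\<omega>' i \<in> X i" for i using X(1) by (cases "X i = UNIV") (auto simp: PiE_iff)
    then show "\<omega>' \<in> S" using X(3) by auto
  qed
qed

lemma dep_continuous:
  assumes "finite A" "dep A f" shows "continuous_on UNIV (f :: ('v \<Rightarrow> bool) \<Rightarrow> 'b::topological_space)"
  unfolding continuous_on_open_vimage[OF open_UNIV]
proof (intro allI impI)
  fix B :: "'b set"
  have "f -` B = (\<Union>\<omega>\<in>f -` B. {\<omega>'. \<forall>x\<in>A. \<omega>' x = \<omega> x})"
  proof (intro equalityI subsetI)
    fix \<omega> assume "\<omega> \<in> (\<Union>\<omega>\<in>f -` B. {\<omega>'. \<forall>x\<in>A. \<omega>' x = \<omega> x})"
    then obtain \<omega>' where "f \<omega>' \<in> B" "\<forall>x\<in>A. \<omega> x = \<omega>' x" by auto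
    then show "\<omega> \<in> f -` B" using depD[OF assms(2), of \<omega> \<omega>'] by simp
  qed auto
  moreover have "open (\<Union>\<omega>\<in>f -` B. {\<omega>'. \<forall>x\<in>A. \<omega>' x = \<omega> x})"
    by (intro open_UN ballI open_cylinder assms)
  ultimately show "open (f -` B \<inter> UNIV)" by simp
qed

lemma continuous_bcontfun: 
  assumes "continuous_on UNIV (f :: ('v \<Rightarrow> bool) \<Rightarrow> real)" shows "apply_bcontfun (Bcontfun f) = f"
proof (rule Bcontfun_inverse)
  have "bounded (range f)" using compact_continuous_image[OF assms compact_UNIV_config] by (rule compact_imp_bounded)
  then show "f \<in> bcontfun" using assms by (simp add: bcontfun_def)
qed

lemma apply_dep: "finite A \<Longrightarrow> dep A f \<Longrightarrow> apply_bcontfun (Bcontfun f :: ('v \<Rightarrow> bool) \<Rightarrow>\<^sub>C real) = f"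
  by (intro continuous_bcontfun dep_continuous)

section \<open>Observables that depend on a given set of sites\<close>

type_synonym 'v obs = "('v \<Rightarrow> bool) \<Rightarrow>\<^sub>C real"

definition obs_on :: "'v set \<Rightarrow> 'v obs set" where
  "obs_on D = {f. dep D (apply_bcontfun f)}"

lemma obs_on_mono: "D \<subseteq> D' \<Longrightarrow> obs_on D \<subseteq> obs_on D'"
  by (auto simp: obs_on_def dep_mono)

lemma obs_on_apply_eq: "f \<in> obs_on D \<Longrightarrow> (\<And>x. x \<in> D \<Longrightarrow> \<omega> x = \<omega>' x) \<Longrightarrow> apply_bcontfun f \<omega> = apply_bcontfun f \<omega>'"
  unfolding obs_on_def by (auto intro: depD)

lemma obs_on_I: "(\<And>\<omega> \<omega>'. (\<And>x. x \<in> D \<Longrightarrow> \<omega> x = \<omega>' x) \<Longrightarrow> apply_bcontfun f \<omega> = apply_bcontfun f \<omega>') \<Longrightarrow> f \<in> obs_on D"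
  unfolding obs_on_def dep_def mem_Collect_eq by blast

lemma obs_on_UNIV [simp]: "f \<in> obs_on UNIV"
proof (rule obs_on_I)
  fix \<omega> \<omega>' :: "'a \<Rightarrow> bool" assume "\<And>x. x \<in> UNIV \<Longrightarrow> \<omega> x = \<omega>' x"
  then have "\<omega> = \<omega>'" by (intro ext) auto
  then show "apply_bcontfun f \<omega> = apply_bcontfun f \<omega>'" by simp
qed

lemma obs_on_add:
  assumes "f \<in> obs_on D" "g \<in> obs_on D" shows "f + g \<in> obs_on D"
  by (rule obs_on_I, unfold plus_bcontfun.rep_eq, rule arg_cong2[where f = "(+)"]; rule obs_on_apply_eq[of _ D]; use assms in simp)

lemma obs_on_diff:
  assumes "f \<in> obs_on D" "g \<in> obs_on D" shows "f - g \<in> obs_on D"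
  by (rule obs_on_I, unfold minus_bcontfun.rep_eq, rule arg_cong2[where f = "(-)"]; rule obs_on_apply_eq[of _ D]; use assms in simp)

lemma obs_on_bmul:
  assumes "f \<in> obs_on D" "g \<in> obs_on D" shows "bmul f g \<in> obs_on D"
  by (rule obs_on_I, unfold apply_bmul, rule arg_cong2[where f = "(*)"]; rule obs_on_apply_eq[of _ D]; use assms in simp)

lemma obs_on_scale:
  assumes "f \<in> obs_on D" shows "c *\<^sub>R f \<in> obs_on D"
  by (rule obs_on_I, unfold scaleR_bcontfun.rep_eq, rule arg_cong[where f = "(*\<^sub>R) c"], rule obs_on_apply_eq[of _ D]) (use assms in simp_all)

lemma obs_on_const: "const_bcontfun c \<in> obs_on D"
  by (rule obs_on_I) (simp add: const_bcontfun.rep_eq)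

lemma obs_on_zero [simp]: "0 \<in> obs_on D"
  by (auto simp: obs_on_def dep_def)

lemma obs_on_sum: "(\<And>i. i \<in> I \<Longrightarrow> f i \<in> obs_on D) \<Longrightarrow> sum f I \<in> obs_on D"
  by (induction I rule: infinite_finite_induct) (auto simp: obs_on_add)

lemma tendsto_apply_bcontfun:
  "(f \<longlongrightarrow> g) F \<Longrightarrow> ((\<lambda>n. apply_bcontfun (f n) x) \<longlongrightarrow> apply_bcontfun g x) F"
  by (rule tendsto_uniform_limitI[OF tendsto_bcontfun_uniform_limit]) auto

lemma closed_obs_on: "closed (obs_on D)"
  unfolding closed_sequential_limits
proof (intro allI impI, elim conjE)
  fix f l assume f: "\<forall>n. f n \<in> obs_on D" and l: "f \<longlonglongrightarrow> l"
  have "apply_bcontfun l \<omega> = apply_bcontfun l \<omega>'" if "\<forall>x\<in>D. \<omega> x = \<omega>' x" for \<omega> \<omega>'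
  proof -
    have "apply_bcontfun (f n) \<omega> = apply_bcontfun (f n) \<omega>'" for n
      using f that by (intro obs_on_apply_eq[of "f n" D]) auto
    then have "(\<lambda>n. apply_bcontfun (f n) \<omega>) \<longlonglongrightarrow> apply_bcontfun l \<omega>'"
      using tendsto_apply_bcontfun[OF l, of \<omega>'] by simp
    with tendsto_apply_bcontfun[OF l, of \<omega>] show ?thesis by (rule LIMSEQ_unique)
  qed
  then show "l \<in> obs_on D" by (auto simp: obs_on_def dep_def)
qed

text \<open>Compactness yields finitely many cylinders on which \<open>f\<close> varies little.
  Setting all opinions to \<open>False\<close>, except at the base sites in \<open>D\<close>, then
  changes \<open>f\<close> by at most \<open>e\<close>.\<close>

lemma local_dense:
  assumes f: "f \<in> obs_on D" and e: "0 < e"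
  obtains A g where "finite A" "A \<subseteq> D" "g \<in> obs_on A" "norm (f - g) \<le> e"
proof -
  define F where "F = apply_bcontfun f"
  have F: "continuous_on UNIV F" by (simp add: F_def)
  have op: "open {\<omega>'. \<bar>F \<omega>' - F \<omega>\<bar> < e / 2}" for \<omega>
    by (intro open_Collect_less continuous_intros F)
  define P where "P \<omega> A \<longleftrightarrow> finite A \<and> {\<omega>'. \<forall>x\<in>A. \<omega>' x = \<omega> x} \<subseteq> {\<omega>'. \<bar>F \<omega>' - F \<omega>\<bar> < e / 2}" for \<omega> A
  have "\<exists>A. P \<omega> A" for \<omega>
  proof -
    have "\<omega> \<in> {\<omega>'. \<bar>F \<omega>' - F \<omega>\<bar> < e / 2}" using e by simp
    with op[of \<omega>] obtain A where "finite A" "{\<omega>'. \<forall>x\<in>A. \<omega>' x = \<omega> x} \<subseteq> {\<omega>'. \<bar>F \<omega>' - F \<omega>\<bar> < e / 2}"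
      by (rule cylinder_nhd)
    then show ?thesis unfolding P_def by (intro exI conjI)
  qed
  then have "\<exists>N. \<forall>\<omega>. P \<omega> (N \<omega>)" by (intro choice allI)
  then obtain N where "\<forall>\<omega>. P \<omega> (N \<omega>)" by (elim exE)
  then have N: "finite (N \<omega>)" "{\<omega>'. \<forall>x\<in>N \<omega>. \<omega>' x = \<omega> x} \<subseteq> {\<omega>'. \<bar>F \<omega>' - F \<omega>\<bar> < e / 2}" for \<omega>
    unfolding P_def by simp_all
  have "open {\<omega>'. \<forall>x\<in>N \<omega>. \<omega>' x = \<omega> x}" if "\<omega> \<in> UNIV" for \<omega> by (rule open_cylinder[OF N(1)])
  moreover have "UNIV \<subseteq> (\<Union>\<omega>\<in>UNIV. {\<omega>'. \<forall>x\<in>N \<omega>. \<omega>' x = \<omega> x})" by blast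
  ultimately obtain W where W: "W \<subseteq> UNIV" "finite W" "UNIV \<subseteq> (\<Union>\<omega>\<in>W. {\<omega>'. \<forall>x\<in>N \<omega>. \<omega>' x = \<omega> x})"
    by (rule compactE_image[OF compact_UNIV_config])
  define A where "A = (\<Union>\<omega>\<in>W. N \<omega>) \<inter> D"
  have finA: "finite A" using W N by (auto simp: A_def)
  define r where "r \<omega> = (\<lambda>x. if x \<in> A then \<omega> x else False)" for \<omega> :: "'a \<Rightarrow> bool"
  \<comment> \<open>The base sites need not lie in \<open>D\<close>. Truncation to \<open>D\<close>
    leaves \<open>f\<close> unchanged, and on the base sites it agrees with truncation to
    \<open>A\<close>.\<close>
  define r' where "r' \<omega> = (\<lambda>x. if x \<in> D then \<omega> x else False)" for \<omega> :: "'a \<Rightarrow> bool"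
  have Fr': "F (r' \<omega>) = F \<omega>" for \<omega>
    unfolding F_def by (rule obs_on_apply_eq[OF f]) (simp add: r'_def)
  define g where "g = Bcontfun (\<lambda>\<omega>. F (r \<omega>))"
  have dg: "dep A (\<lambda>\<omega>. F (r \<omega>))"
  proof -
    have "r \<omega> = r \<omega>'" if "\<forall>x\<in>A. \<omega> x = \<omega>' x" for \<omega> \<omega>' using that by (auto simp: r_def)
    then show ?thesis unfolding dep_def by (intro allI impI arg_cong[where f = F])
  qed
  have g: "apply_bcontfun g = (\<lambda>\<omega>. F (r \<omega>))" unfolding g_def by (rule apply_dep[OF finA dg])
  have "\<bar>F \<omega> - F (r \<omega>)\<bar> \<le> e" for \<omega>
  proof -
    obtain \<omega>0 where w: "\<omega>0 \<in> W" "\<forall>x\<in>N \<omega>0. r' \<omega> x = \<omega>0 x" using W(3) by blast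
    have r: "r \<omega> x = r' \<omega> x" if "x \<in> N \<omega>0" for x
    proof -
      have "x \<in> A \<longleftrightarrow> x \<in> D" using that w(1) by (auto simp: A_def)
      then show ?thesis by (simp add: r_def r'_def)
    qed
    have "r' \<omega> \<in> {\<omega>'. \<forall>x\<in>N \<omega>0. \<omega>' x = \<omega>0 x}" using w(2) by blast
    moreover have "r \<omega> \<in> {\<omega>'. \<forall>x\<in>N \<omega>0. \<omega>' x = \<omega>0 x}" using w(2) r by blast
    ultimately have "r \<omega> \<in> {\<omega>'. \<bar>F \<omega>' - F \<omega>0\<bar> < e / 2}" "r' \<omega> \<in> {\<omega>'. \<bar>F \<omega>' - F \<omega>0\<bar> < e / 2}"
      using N(2)[of \<omega>0] by blast+
    then show ?thesis using Fr'[of \<omega>] by (simp add: abs_if split: if_splits)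
  qed
  then have "norm (f - g) \<le> e" by (intro bcontfun_norm_le) (simp add: minus_bcontfun.rep_eq g F_def)
  moreover have "g \<in> obs_on A" using dg by (simp add: obs_on_def g)
  ultimately show ?thesis using that[of A g] finA by (auto simp: A_def)
qed

section \<open>The pregenerator\<close>

definition parent :: "('v \<times> 'v) set \<Rightarrow> 'v \<Rightarrow> 'v" where
  "parent E x = (THE y. (y, x) \<in> E)"

locale layered_tree =
  fixes E :: "('v \<times> 'v) set" and r :: "int \<Rightarrow> 'v" and V :: "int \<Rightarrow> 'v set"
  assumes tree: "regular_directed_tree 3 E"
    and spine: "\<And>k. (r k, r (k - 1)) \<in> E"
    and layers: "layering E r V"
begin

abbreviation par :: "'v \<Rightarrow> 'v" where "par \<equiv> parent E"
abbreviation kids :: "'v \<Rightarrow> 'v set" where "kids \<equiv> children E"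

lemma E_iff: "(y, x) \<in> E \<longleftrightarrow> y = par x"
proof -
  have ex1: "\<exists>!y. (y, x) \<in> E" using tree by (simp add: regular_directed_tree_def)
  show ?thesis unfolding parent_def using theI'[OF ex1] ex1 by blast
qed

lemma kids_iff: "z \<in> kids x \<longleftrightarrow> par z = x"
  by (auto simp: children_def E_iff)

lemma card_kids: "card (kids x) = 3"
  using tree by (simp add: regular_directed_tree_def)

lemma finite_kids [simp]: "finite (kids x)"
  using card_kids[of x] by (metis card.infinite zero_neq_numeral)

lemma layer_ex1: "\<exists>!k. x \<in> V k"
proof -
  have "x \<in> (\<Union>k. V k)" and "disjoint_family V" using layers by (auto simp: layering_def)
  then show ?thesis by (auto simp: disjoint_family_on_def)
qed

definition ht :: "'v \<Rightarrow> int" where "ht x = (THE k. x \<in> V k)"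

lemma ht_iff: "x \<in> V k \<longleftrightarrow> ht x = k"
  unfolding ht_def using theI'[OF layer_ex1[of x]] layer_ex1[of x] by blast

lemma ht_par: "ht (par x) = ht x + 1"
proof -
  have "x \<in> V (ht x)" by (simp add: ht_iff)
  moreover have "(par x, x) \<in> E" by (simp add: E_iff)
  ultimately have "par x \<in> V (ht x + 1)" using layers unfolding layering_def by blast
  then show ?thesis by (simp add: ht_iff)
qed

lemma ht_funpow_par: "ht ((par ^^ n) x) = ht x + int n"
  by (induction n) (auto simp: ht_par)

lemma par_neq [simp]: "par x \<noteq> x" "x \<noteq> par x"
  using ht_par[of x] by auto

lemma notin_kids [simp]: "x \<notin> kids x"
  by (simp add: kids_iff)

text \<open>Opinions pass only from children to parents, so the process on such a set evolves
  without outside influence.\<close>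

definition closed_under_kids :: "'v set \<Rightarrow> bool" where
  "closed_under_kids D \<longleftrightarrow> (\<forall>x. par x \<in> D \<longrightarrow> x \<in> D)"

lemma majority_cong:
  assumes "\<And>z. z \<in> kids x \<Longrightarrow> \<omega> z = \<omega>' z" shows "majority E \<omega> x = majority E \<omega>' x"
proof -
  have "{z \<in> kids x. \<omega> z} = {z \<in> kids x. \<omega>' z}" "{z \<in> kids x. \<not> \<omega> z} = {z \<in> kids x. \<not> \<omega>' z}"
    using assms by auto
  then show ?thesis by (simp add: majority_def)
qed

lemma update_cong:
  assumes "\<And>z. z \<in> kids x \<Longrightarrow> \<omega> z = \<omega>' z" "y \<noteq> x \<Longrightarrow> \<omega> y = \<omega>' y"
  shows "update E \<omega> x y = update E \<omega>' x y"
  using majority_cong[OF assms(1)] assms(2) by (auto simp: update_def)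

lemma continuous_update: "continuous_on UNIV (\<lambda>\<omega>. update E \<omega> x)"
proof (rule continuous_on_coordinatewise_then_product)
  fix y
  have "dep (insert y (kids x)) (\<lambda>\<omega>. update E \<omega> x y)"
    unfolding dep_def by (intro allI impI update_cong) auto
  then show "continuous_on UNIV (\<lambda>\<omega>. update E \<omega> x y)"
    by (rule dep_continuous[rotated]) simp
qed

section \<open>Resampling of sites and the closed pregenerator\<close>

definition U :: "'v \<Rightarrow> 'v obs \<Rightarrow> 'v obs" where
  "U x f = Bcontfun (\<lambda>\<omega>. apply_bcontfun f (update E \<omega> x))"

lemma apply_U: "apply_bcontfun (U x f) \<omega> = apply_bcontfun f (update E \<omega> x)"
proof -
  have "continuous_on UNIV (\<lambda>\<omega>. apply_bcontfun f (update E \<omega> x))"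
    using continuous_on_compose[OF continuous_update continuous_on_apply_bcontfun] by (simp add: o_def)
  from continuous_bcontfun[OF this] show ?thesis by (simp add: U_def)
qed

lemma U_bounded_linear: "bounded_linear (U x)"
proof (rule bounded_linear_intro)
  show "norm (U x f) \<le> norm f * 1" for f
    by (intro bcontfun_norm_le) (simp add: apply_U abs_le_norm)
qed (auto intro!: bcontfun_eqI simp: apply_U plus_bcontfun.rep_eq scaleR_bcontfun.rep_eq)

lemma norm_U: "norm (U x f) \<le> norm f"
  by (intro bcontfun_norm_le) (simp add: apply_U abs_le_norm)

lemma U_fix:
  assumes "f \<in> obs_on A" "x \<notin> A" shows "U x f = f"
  by (rule bcontfun_eqI, unfold apply_U, rule obs_on_apply_eq[OF assms(1)]) (use assms(2) in \<open>auto simp: update_def\<close>)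

lemma obs_on_U:
  assumes "f \<in> obs_on A" shows "U x f \<in> obs_on (A \<union> kids x)"
proof (cases "x \<in> A")
  case True
  show ?thesis
    by (rule obs_on_I, unfold apply_U, rule obs_on_apply_eq[OF assms(1)], rule update_cong) auto
next
  case False
  then show ?thesis using U_fix[OF assms] obs_on_mono[of A "A \<union> kids x"] assms by auto
qed

definition site_generation :: "'v set \<Rightarrow> 'v obs \<Rightarrow> 'v obs" where
  "site_generation B f = (\<Sum>x\<in>B. U x f - f)"

lemma site_generation_superset:
  assumes "f \<in> obs_on A" "A \<subseteq> B" "finite B" shows "site_generation B f = site_generation A f"
  unfolding site_generation_def by (rule sum.mono_neutral_right) (use assms U_fix in auto)

lemma site_generation_linear: "site_generation B (f + g) = site_generation B f + site_generation B g" "site_generation B (c *\<^sub>R f) = c *\<^sub>R site_generation B f"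
  using U_bounded_linear
  by (simp_all add: site_generation_def linear_simps sum.distrib[symmetric] scaleR_right.sum scaleR_diff_right algebra_simps cong: sum.cong)

text \<open>Recording the region \<open>D\<close> allows disjoint regions to be combined by a
  Leibniz rule; \<open>D = UNIV\<close> is the whole pregenerator.\<close>

definition pre :: "'v set \<Rightarrow> ('v obs \<times> 'v obs) set" where
  "pre D = {(f, site_generation A f) |f A. finite A \<and> A \<subseteq> D \<and> f \<in> obs_on A}"

lemma preI: "finite A \<Longrightarrow> A \<subseteq> D \<Longrightarrow> f \<in> obs_on A \<Longrightarrow> (f, site_generation A f) \<in> pre D"
  by (auto simp: pre_def)

lemma pre_UNIV: "pre UNIV = majority_pregenerator E"
proof -
  have site_generation: "apply_bcontfun (site_generation A f) \<omega> = (\<Sum>\<^sub>\<infinity>x. apply_bcontfun f (update E \<omega> x) - apply_bcontfun f \<omega>)"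
    if "finite A" "f \<in> obs_on A" for A f \<omega>
  proof -
    have 1: "apply_bcontfun (site_generation A f) \<omega> = (\<Sum>x\<in>A. apply_bcontfun f (update E \<omega> x) - apply_bcontfun f \<omega>)"
      unfolding site_generation_def
      by (induction A rule: infinite_finite_induct) (auto simp: plus_bcontfun.rep_eq minus_bcontfun.rep_eq apply_U)
    have 2: "apply_bcontfun f (update E \<omega> x) - apply_bcontfun f \<omega> = 0" if "x \<notin> A" for x
      using U_fix[OF \<open>f \<in> obs_on A\<close> that] apply_U[of x f \<omega>] by simp
    have "(\<Sum>\<^sub>\<infinity>x. apply_bcontfun f (update E \<omega> x) - apply_bcontfun f \<omega>)
        = (\<Sum>\<^sub>\<infinity>x\<in>A. apply_bcontfun f (update E \<omega> x) - apply_bcontfun f \<omega>)"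
      by (rule infsum_cong_neutral) (use 2 in auto)
    then show ?thesis using 1 \<open>finite A\<close> by simp
  qed
  show ?thesis
  proof (intro equalityI subsetI)
    fix p assume "p \<in> pre UNIV"
    then obtain f A where p: "p = (f, site_generation A f)" "finite A" "f \<in> obs_on A" by (auto simp: pre_def)
    then have "local_function (apply_bcontfun f)" by (auto simp: local_function_def obs_on_def dep_def)
    then show "p \<in> majority_pregenerator E" using p site_generation by (simp add: majority_pregenerator_def)
  next
    fix p assume "p \<in> majority_pregenerator E"
    then obtain f g where p: "p = (f, g)" "local_function (apply_bcontfun f)"
      "\<And>\<omega>. apply_bcontfun g \<omega> = (\<Sum>\<^sub>\<infinity>x. apply_bcontfun f (update E \<omega> x) - apply_bcontfun f \<omega>)"
      by (auto simp: majority_pregenerator_def)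
    then obtain A where A: "finite A" "f \<in> obs_on A" by (auto simp: local_function_def obs_on_def dep_def)
    have "g = site_generation A f" by (rule bcontfun_eqI) (simp add: site_generation[OF A] p)
    then show "p \<in> pre UNIV" using p A by (auto simp: pre_def)
  qed
qed

lemma subspace_pre: "subspace (pre D)"
proof (rule subspaceI)
  have "(0, site_generation {} 0) \<in> pre D" by (intro preI) auto
  then show "0 \<in> pre D" by (simp add: site_generation_def zero_prod_def)
next
  fix p q assume "p \<in> pre D" "q \<in> pre D"
  then obtain f A g B where *: "p = (f, site_generation A f)" "finite A" "A \<subseteq> D" "f \<in> obs_on A"
    "q = (g, site_generation B g)" "finite B" "B \<subseteq> D" "g \<in> obs_on B" by (auto simp: pre_def)
  have "f + g \<in> obs_on (A \<union> B)" using * obs_on_mono[of A "A \<union> B"] obs_on_mono[of B "A \<union> B"] by (intro obs_on_add) auto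
  then have "(f + g, site_generation (A \<union> B) (f + g)) \<in> pre D" using * by (intro preI) auto
  moreover have "site_generation (A \<union> B) (f + g) = site_generation A f + site_generation B g"
    using * site_generation_superset[of f A "A \<union> B"] site_generation_superset[of g B "A \<union> B"] by (simp add: site_generation_linear)
  ultimately show "p + q \<in> pre D" using * by simp
next
  fix c p assume "p \<in> pre D"
  then obtain f A where *: "p = (f, site_generation A f)" "finite A" "A \<subseteq> D" "f \<in> obs_on A" by (auto simp: pre_def)
  then have "(c *\<^sub>R f, site_generation A (c *\<^sub>R f)) \<in> pre D" by (intro preI obs_on_scale)
  then show "c *\<^sub>R p \<in> pre D" using * by (simp add: site_generation_linear)
qed

lemma pre_dissipative:
  assumes "(u, v) \<in> pre D" "0 < h" shows "norm u \<le> norm (u - h *\<^sub>R v)"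
proof -
  obtain A where A: "finite A" "u \<in> obs_on A" "v = site_generation A u" using assms by (auto simp: pre_def)
  have v: "apply_bcontfun v \<omega> = (\<Sum>x\<in>A. apply_bcontfun u (update E \<omega> x) - apply_bcontfun u \<omega>)" for \<omega>
    unfolding A(3) site_generation_def
    by (induction A rule: infinite_finite_induct) (auto simp: plus_bcontfun.rep_eq minus_bcontfun.rep_eq apply_U)
  \<comment> \<open>The sign \<open>s\<close> treats the maximum and the minimum of \<open>u\<close>
    at once; at the extremal configuration no resampling can increase \<open>s u\<close>.\<close>
  have key: "s * apply_bcontfun u \<omega> \<le> norm (u - h *\<^sub>R v)" if s: "s = 1 \<or> s = -1" for s \<omega>
  proof -
    have "continuous_on UNIV (\<lambda>\<omega>. s * apply_bcontfun u \<omega>)" by (intro continuous_intros continuous_on_apply_bcontfun)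
    from continuous_attains_sup[OF compact_UNIV_config _ this]
    obtain \<omega>0 where w: "\<And>\<omega>. s * apply_bcontfun u \<omega> \<le> s * apply_bcontfun u \<omega>0" by auto
    have "s * apply_bcontfun v \<omega>0 = (\<Sum>x\<in>A. s * apply_bcontfun u (update E \<omega>0 x) - s * apply_bcontfun u \<omega>0)"
      unfolding v by (simp add: sum_distrib_left algebra_simps)
    also have "\<dots> \<le> 0" by (intro sum_nonpos) (simp add: w)
    finally have "h * (s * apply_bcontfun v \<omega>0) \<le> 0" using assms(2) by (simp add: mult_nonneg_nonpos)
    then have "s * apply_bcontfun u \<omega>0 \<le> s * (apply_bcontfun (u - h *\<^sub>R v) \<omega>0)"
      by (simp add: minus_bcontfun.rep_eq scaleR_bcontfun.rep_eq algebra_simps)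
    also have "\<dots> \<le> \<bar>apply_bcontfun (u - h *\<^sub>R v) \<omega>0\<bar>" using s by auto
    also have "\<dots> \<le> norm (u - h *\<^sub>R v)" by (rule abs_le_norm)
    finally show ?thesis using w[of \<omega>] by linarith
  qed
  show ?thesis
    by (rule bcontfun_norm_le) (use key[of 1] key[of "-1"] in \<open>auto simp: abs_le_iff\<close>)
qed

definition closed_generation :: "'v set \<Rightarrow> ('v obs \<times> 'v obs) set" where
  "closed_generation D = closure (pre D)"

lemma closed_closed_generation: "closed (closed_generation D)" by (simp add: closed_generation_def)

lemma closed_generation_UNIV: "closed_generation UNIV = majority_generator E"
  by (simp add: closed_generation_def majority_generator_def pre_UNIV)

lemma closed_generation_mono: "D \<subseteq> D' \<Longrightarrow> closed_generation D \<subseteq> closed_generation D'"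
  unfolding closed_generation_def by (intro closure_mono) (auto simp: pre_def)

lemma pre_closed_generation: "p \<in> pre D \<Longrightarrow> p \<in> closed_generation D"
  unfolding closed_generation_def using closure_subset by blast

lemma closed_generation_E:
  assumes "(u, v) \<in> closed_generation D"
  obtains u' v' where "\<And>n. (u' n, v' n) \<in> pre D" "u' \<longlonglongrightarrow> u" "v' \<longlonglongrightarrow> v"
proof -
  obtain p where p: "\<And>n. p n \<in> pre D" "p \<longlonglongrightarrow> (u, v)"
    using assms unfolding closed_generation_def closure_sequential by auto
  show ?thesis
    using that[of "fst \<circ> p" "snd \<circ> p"] p tendsto_fst[OF p(2)] tendsto_snd[OF p(2)] by (simp add: o_def)
qed

lemma closed_generation_dissipative:
  assumes "(u, v) \<in> closed_generation D" "0 < h" shows "norm u \<le> norm (u - h *\<^sub>R v)"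
proof -
  obtain u' v' where *: "\<And>n. (u' n, v' n) \<in> pre D" "u' \<longlonglongrightarrow> u" "v' \<longlonglongrightarrow> v" using closed_generation_E[OF assms(1)] by blast
  show ?thesis
    by (rule LIMSEQ_le[of "\<lambda>n. norm (u' n)" _ "\<lambda>n. norm (u' n - h *\<^sub>R v' n)"])
       (auto intro!: tendsto_intros * exI[of _ 0] pre_dissipative assms)
qed

lemma subspace_closed_generation: "subspace (closed_generation D)"
proof (rule subspaceI)
  have "0 \<in> pre D" using subspace_pre by (rule subspace_0)
  then show "0 \<in> closed_generation D" by (rule pre_closed_generation)
next
  fix p q assume pq: "p \<in> closed_generation D" "q \<in> closed_generation D"
  obtain p' q' where *: "\<And>n. p' n \<in> pre D" "p' \<longlonglongrightarrow> p" "\<And>n. q' n \<in> pre D" "q' \<longlonglongrightarrow> q"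
    using pq unfolding closed_generation_def closure_sequential by metis
  show "p + q \<in> closed_generation D"
    unfolding closed_generation_def closure_sequential
    by (intro exI[of _ "\<lambda>n. p' n + q' n"]) (auto intro!: tendsto_add * subspace_add subspace_pre)
next
  fix c p assume p: "p \<in> closed_generation D"
  obtain p' where *: "\<And>n. p' n \<in> pre D" "p' \<longlonglongrightarrow> p"
    using p unfolding closed_generation_def closure_sequential by metis
  show "c *\<^sub>R p \<in> closed_generation D"
    unfolding closed_generation_def closure_sequential
    by (intro exI[of _ "\<lambda>n. c *\<^sub>R p' n"]) (auto intro!: tendsto_intros * subspace_scale subspace_pre)
qed

lemma pre_obs_on:
  assumes "(u, v) \<in> pre D" "closed_under_kids D" shows "u \<in> obs_on D" "v \<in> obs_on D"
proof -
  obtain A where A: "finite A" "A \<subseteq> D" "u \<in> obs_on A" "v = site_generation A u" using assms by (auto simp: pre_def)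
  show u: "u \<in> obs_on D" using A obs_on_mono by blast
  have "kids x \<subseteq> D" if "x \<in> A" for x using assms(2) that A(2) by (auto simp: closed_under_kids_def kids_iff)
  then have "U x u \<in> obs_on D" if "x \<in> A" for x
    using obs_on_U[OF u, of x] that by (metis sup.absorb1)
  then show "v \<in> obs_on D" unfolding A(4) site_generation_def using u by (intro obs_on_sum obs_on_diff) auto
qed

text \<open>Resampling a site of one support leaves the other factor unchanged, even if the children
  whose majority is taken belong to the other support; \<open>corr_maj_derivative\<close> relies on
  that case.\<close>

lemma closed_generation_product:
  assumes f: "(f, f') \<in> closed_generation D" and g: "(g, g') \<in> closed_generation D'" and D: "D \<inter> D' = {}"
  shows "(bmul f g, bmul f' g + bmul f g') \<in> closed_generation UNIV"
proof -
  have pre: "(bmul f g, bmul f' g + bmul f g') \<in> pre UNIV" if f: "(f, f') \<in> pre D" and g: "(g, g') \<in> pre D'" for f f' g g'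
  proof -
    obtain A where A: "finite A" "A \<subseteq> D" "f \<in> obs_on A" "f' = site_generation A f" using f by (auto simp: pre_def)
    obtain B where B: "finite B" "B \<subseteq> D'" "g \<in> obs_on B" "g' = site_generation B g" using g by (auto simp: pre_def)
    have fg: "bmul f g \<in> obs_on (A \<union> B)"
      using A B obs_on_mono[of A "A \<union> B"] obs_on_mono[of B "A \<union> B"] by (intro obs_on_bmul) auto
    have Um: "U x (bmul f g) = bmul (U x f) (U x g)" for x
      by (rule bcontfun_eqI) (simp add: apply_U apply_bmul)
    have dis: "A \<inter> B = {}" using A B D by blast
    interpret b: bounded_bilinear "bmul :: 'v obs \<Rightarrow> _" by (rule bounded_bilinear_bmul)
    have "site_generation (A \<union> B) (bmul f g) = (\<Sum>x\<in>A. U x (bmul f g) - bmul f g) + (\<Sum>x\<in>B. U x (bmul f g) - bmul f g)"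
      unfolding site_generation_def using A B dis by (intro sum.union_disjoint) auto
    also have "(\<Sum>x\<in>A. U x (bmul f g) - bmul f g) = (\<Sum>x\<in>A. bmul (U x f - f) g)"
    proof (rule sum.cong[OF refl])
      fix x assume "x \<in> A"
      then have "U x g = g" using dis B by (intro U_fix[of g B]) auto
      then show "U x (bmul f g) - bmul f g = bmul (U x f - f) g" by (simp add: Um b.diff_left)
    qed
    also have "(\<Sum>x\<in>B. U x (bmul f g) - bmul f g) = (\<Sum>x\<in>B. bmul f (U x g - g))"
    proof (rule sum.cong[OF refl])
      fix x assume "x \<in> B"
      then have "U x f = f" using dis A by (intro U_fix[of f A]) auto
      then show "U x (bmul f g) - bmul f g = bmul f (U x g - g)" by (simp add: Um b.diff_right)
    qed
    finally have "site_generation (A \<union> B) (bmul f g) = bmul f' g + bmul f g'"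
      by (simp add: A(4) B(4) site_generation_def b.sum_left b.sum_right)
    moreover have "(bmul f g, site_generation (A \<union> B) (bmul f g)) \<in> pre UNIV" using A B fg by (intro preI) auto
    ultimately show ?thesis by simp
  qed
  obtain u v where uv: "\<And>n. (u n, v n) \<in> pre D" "u \<longlonglongrightarrow> f" "v \<longlonglongrightarrow> f'" using closed_generation_E[OF f] by blast
  obtain u' v' where uv': "\<And>n. (u' n, v' n) \<in> pre D'" "u' \<longlonglongrightarrow> g" "v' \<longlonglongrightarrow> g'" using closed_generation_E[OF g] by blast
  show ?thesis
    unfolding closed_generation_def closure_sequential
    by (intro exI[of _ "\<lambda>n. (bmul (u n) (u' n), bmul (v n) (u' n) + bmul (u n) (v' n))"] conjI allI pre uv uv'
          tendsto_Pair tendsto_add tendsto_bmul)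
qed

end

section \<open>The semigroup of the majority dynamics\<close>

lemma continuous_on_apply_fixed: "continuous_on X (\<lambda>u :: 's::topological_space \<Rightarrow>\<^sub>C real. apply_bcontfun u \<omega>)"
  unfolding continuous_on_def by (intro ballI tendsto_apply_bcontfun tendsto_ident_at)

context layered_tree
begin

section \<open>Generations of descendants and the range condition\<close>

definition generation :: "'v set \<Rightarrow> nat \<Rightarrow> 'v set" where
  "generation A n = {x. (par ^^ n) x \<in> A}"

definition generations :: "'v set \<Rightarrow> nat \<Rightarrow> 'v set" where
  "generations A n = (\<Union>k\<le>n. generation A k)"

lemma generation_Suc: "generation A (Suc n) = (\<Union>y\<in>generation A n. kids y)"
  by (auto simp: generation_def kids_iff funpow_swap1)

lemma finite_card_generation:
  assumes "finite A" shows "finite (generation A n) \<and> card (generation A n) \<le> 3 ^ n * card A"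
proof (induction n)
  case (Suc n)
  have "card (generation A (Suc n)) \<le> (\<Sum>y\<in>generation A n. card (kids y))"
    unfolding generation_Suc using Suc by (intro card_UN_le) auto
  also have "\<dots> \<le> 3 * (3 ^ n * card A)" using Suc by (simp add: card_kids)
  finally show ?case using Suc by (simp add: generation_Suc)
qed (use assms in \<open>simp add: generation_def\<close>)

lemma finite_generations: "finite A \<Longrightarrow> finite (generations A n)"
  using finite_card_generation by (simp add: generations_def)

lemma generations_Suc: "generations A (Suc n) = generations A n \<union> generation A (Suc n)"
  by (auto simp: generations_def le_Suc_eq)

lemma kids_generations: "y \<in> generations A n \<Longrightarrow> kids y \<subseteq> generations A (Suc n)"
proof -
  assume "y \<in> generations A n"
  then obtain k where k: "k \<le> n" "y \<in> generation A k" by (auto simp: generations_def)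
  then have "kids y \<subseteq> generation A (Suc k)" by (auto simp: generation_Suc)
  then show ?thesis using k by (fastforce simp: generations_def)
qed

lemma generation_subset: 
  assumes "A \<subseteq> D" "closed_under_kids D" shows "generation A n \<subseteq> D"
proof (induction n)
  case (Suc n)
  then show ?case using assms(2) by (auto simp: generation_Suc kids_iff closed_under_kids_def)
qed (use assms in \<open>simp add: generation_def\<close>)

lemma generations_subset: "A \<subseteq> D \<Longrightarrow> closed_under_kids D \<Longrightarrow> generations A n \<subseteq> D"
  using generation_subset unfolding generations_def by blast

text \<open>The equation is solved exactly with resampling confined to finitely many generations.
  Only the next generation is missing: at most \<open>3^(n+1) card A\<close> sites, each with
  influence of order \<open>h^(n+1)\<close> on the solution. Their total effect tends to zero for
  \<open>h < 1/3\<close>.\<close>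

lemma range_local:
  assumes A: "finite A" "A \<subseteq> D" and D: "closed_under_kids D" and f: "f \<in> obs_on A"
    and h: "0 < h" "h < 1 / 3" and e: "0 < e"
  shows "\<exists>(u, v) \<in> pre D. norm (u - h *\<^sub>R v - f) \<le> e"
proof -
  define c where "c = 2 * norm f"
  \<comment> \<open>A prescribed bound for the influence of site \<open>x\<close>. It dominates
    \<open>h G (par x)\<close> plus the influence of \<open>x\<close> on \<open>f\<close>, which is
    at most \<open>c\<close> on \<open>A\<close> and zero elsewhere; \<open>c / (1 - h)\<close> sums
    the geometric series. The least index is taken because \<open>A\<close> may meet several layers,
    so that \<open>x\<close> can belong to several generations.\<close>
  define G where "G x = (if \<exists>k. x \<in> generation A k then c / (1 - h) * h ^ (LEAST k. x \<in> generation A k) else 0)" for x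
  have c: "0 \<le> c" by (simp add: c_def)
  have G0: "0 \<le> G x" for x using c h by (auto simp: G_def)
  have genpar: "par x \<in> generation A k \<longleftrightarrow> x \<in> generation A (Suc k)" for x k by (simp add: generation_def funpow_swap1)
  have Gpar: "h * G (par x) \<le> G x" for x
  proof (cases "\<exists>k. par x \<in> generation A k")
    case True
    define d where "d = (LEAST k. par x \<in> generation A k)"
    have d: "par x \<in> generation A d" unfolding d_def using True by (rule LeastI_ex)
    then have x: "x \<in> generation A (Suc d)" by (simp add: genpar)
    then have "(LEAST k. x \<in> generation A k) \<le> Suc d" by (rule Least_le)
    then have "h ^ Suc d \<le> h ^ (LEAST k. x \<in> generation A k)" using h by (intro power_decreasing) auto
    then have "c / (1 - h) * h ^ Suc d \<le> c / (1 - h) * h ^ (LEAST k. x \<in> generation A k)"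
      using c h by (intro mult_left_mono) auto
    moreover have "G (par x) = c / (1 - h) * h ^ d" using True by (simp add: G_def d_def)
    moreover have "G x = c / (1 - h) * h ^ (LEAST k. x \<in> generation A k)" using x by (auto simp: G_def)
    ultimately show ?thesis by (simp add: mult_ac)
  next
    case False
    then have "G (par x) = 0" unfolding G_def by simp
    then show ?thesis using G0 by simp
  qed
  have GA: "c + h * G (par x) \<le> G x" if "x \<in> A" for x
  proof -
    have x0: "x \<in> generation A 0" using that by (simp add: generation_def)
    then have "(LEAST k. x \<in> generation A k) = 0" by (rule Least_eq_0)
    then have Gx: "G x = c / (1 - h)" using x0 by (auto simp: G_def)
    have "G (par x) \<le> c / (1 - h)"
    proof (cases "\<exists>k. par x \<in> generation A k")
      case True
      have "h ^ (LEAST k. par x \<in> generation A k) \<le> 1" using h by (intro power_le_one) auto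
      then have "c / (1 - h) * h ^ (LEAST k. par x \<in> generation A k) \<le> c / (1 - h) * 1"
        using c h by (intro mult_left_mono) auto
      then show ?thesis using True by (simp add: G_def)
    qed (use c h in \<open>auto simp: G_def\<close>)
    then have "c + h * G (par x) \<le> c + h * (c / (1 - h))" using h by (intro add_left_mono mult_left_mono) auto
    also have "\<dots> = G x" using h by (simp add: Gx field_simps)
    finally show ?thesis .
  qed
  have Gn: "G x \<le> c / (1 - h) * h ^ Suc n" if "x \<in> generation A (Suc n)" "x \<notin> generations A n" for x n
  proof -
    have "\<not> (LEAST k. x \<in> generation A k) \<le> n"
    proof
      assume "(LEAST k. x \<in> generation A k) \<le> n"
      moreover have "x \<in> generation A (LEAST k. x \<in> generation A k)" using that(1) by (rule LeastI)
      ultimately show False using that(2) by (auto simp: generations_def)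
    qed
    then have "h ^ (LEAST k. x \<in> generation A k) \<le> h ^ Suc n" using h by (intro power_decreasing) auto
    then have "c / (1 - h) * h ^ (LEAST k. x \<in> generation A k) \<le> c / (1 - h) * h ^ Suc n"
      using c h by (intro mult_left_mono) auto
    moreover have "G x = c / (1 - h) * h ^ (LEAST k. x \<in> generation A k)" using that(1) by (auto simp: G_def)
    ultimately show ?thesis by simp
  qed
  have "(\<lambda>n. h * (real (card A) * (c / (1 - h)) * (3 * h) ^ Suc n)) \<longlonglongrightarrow> h * (real (card A) * (c / (1 - h)) * 0)"
    using h by (intro tendsto_intros LIMSEQ_Suc LIMSEQ_power_zero) auto
  then have "\<forall>\<^sub>F n in sequentially. h * (real (card A) * (c / (1 - h)) * (3 * h) ^ Suc n) < e"
    using e by (intro order_tendstoD) auto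
  then obtain n where n: "h * (real (card A) * (c / (1 - h)) * (3 * h) ^ Suc n) < e"
    by (auto simp: eventually_sequentially)
  define B where "B = generations A n"
  define A' where "A' = generations A (Suc n)"
  have finB: "finite B" "finite A'" using A by (auto simp: B_def A'_def finite_generations)
  have sub: "A \<subseteq> A'" "B \<subseteq> A'" "A' \<subseteq> D"
  proof -
    have "A = generation A 0" by (simp add: generation_def)
    then show "A \<subseteq> A'" by (auto simp: A'_def generations_def)
    show "B \<subseteq> A'" by (simp add: A'_def B_def generations_Suc)
    show "A' \<subseteq> D" unfolding A'_def by (rule generations_subset[OF A(2) D])
  qed
  have kidsB: "kids y \<subseteq> A'" if "y \<in> B" for y using kids_generations that by (simp add: A'_def B_def)
  \<comment> \<open>Searching for the fixed point inside the closed set of observables with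
    influences at most \<open>G\<close> delivers the decay along with existence.\<close>
  define K where "K = {u :: 'v obs. u \<in> obs_on A' \<and> (\<forall>x \<omega>. \<bar>apply_bcontfun u (fun_upd \<omega> x True) - apply_bcontfun u (fun_upd \<omega> x False)\<bar> \<le> G x)}"
  have KD: "\<bar>apply_bcontfun u (fun_upd \<omega> x b) - apply_bcontfun u (fun_upd \<omega> x b')\<bar> \<le> G x" if "u \<in> K" for u x \<omega> b b'
    using that G0[of x] unfolding K_def by (cases b; cases b') (auto simp: abs_minus_commute)
  define N where "N = real (card B)"
  \<comment> \<open>The equation for resampling in \<open>B\<close>, with the diagonal part
    \<open>h N u\<close> moved to the left. This makes the iteration a contraction with factor
    \<open>h N / (1 + h N)\<close>, however large \<open>N\<close> is.\<close>
  define \<Phi> where "\<Phi> u = (1 / (1 + h * N)) *\<^sub>R (f + h *\<^sub>R (\<Sum>y\<in>B. U y u))" for u :: "'v obs"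
  have N: "0 \<le> N" "0 < 1 + h * N" using h by (auto simp: N_def intro: add_pos_nonneg)
  have "closed K"
  proof -
    have "K = obs_on A' \<inter> (\<Inter>x. \<Inter>\<omega>. {u. \<bar>apply_bcontfun u (fun_upd \<omega> x True) - apply_bcontfun u (fun_upd \<omega> x False)\<bar> \<le> G x})"
      by (auto simp: K_def)
    also have "closed \<dots>"
      by (intro closed_Int closed_obs_on closed_INT ballI closed_Collect_le continuous_intros continuous_on_apply_fixed)
    finally show ?thesis .
  qed
  then have compK: "Topological_Spaces.complete K"
    using complete_bcontfun complete_closed_subset[of K UNIV] by auto
  have "0 \<in> K" by (auto simp: K_def G0)
  have PhiK: "\<Phi> u \<in> K" if u: "u \<in> K" for u
  proof -
    have uCD: "u \<in> obs_on A'" using u by (simp add: K_def)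
    have "U y u \<in> obs_on A'" if "y \<in> B" for y using obs_on_U[OF uCD, of y] kidsB[OF that] by (simp add: sup.absorb1)
    then have 1: "\<Phi> u \<in> obs_on A'" unfolding \<Phi>_def
      using f sub obs_on_mono[of A A'] by (intro obs_on_scale obs_on_add obs_on_sum) auto
    have "\<bar>apply_bcontfun (\<Phi> u) (fun_upd \<omega> x True) - apply_bcontfun (\<Phi> u) (fun_upd \<omega> x False)\<bar> \<le> G x" for x \<omega>
    proof -
      let ?a = "fun_upd \<omega> x True" and ?b = "fun_upd \<omega> x False"
      have ap: "apply_bcontfun (\<Phi> u) \<eta> = (1 / (1 + h * N)) * (apply_bcontfun f \<eta> + h * (\<Sum>y\<in>B. apply_bcontfun u (update E \<eta> y)))" for \<eta>
      proof -
        have "apply_bcontfun (\<Sum>y\<in>B. U y u) \<eta> = (\<Sum>y\<in>B. apply_bcontfun u (update E \<eta> y))"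
          by (induction B rule: infinite_finite_induct) (auto simp: plus_bcontfun.rep_eq apply_U)
        then show ?thesis by (simp add: \<Phi>_def plus_bcontfun.rep_eq scaleR_bcontfun.rep_eq)
      qed
      have fb: "\<bar>apply_bcontfun f ?a - apply_bcontfun f ?b\<bar> + h * G (par x) \<le> G x"
      proof (cases "x \<in> A")
        case True
        have "\<bar>apply_bcontfun f ?a - apply_bcontfun f ?b\<bar> \<le> c"
          using abs_le_norm[of f ?a] abs_le_norm[of f ?b] unfolding c_def by linarith
        then show ?thesis using GA[OF True] by linarith
      next
        case False
        then have "apply_bcontfun f ?a = apply_bcontfun f ?b" by (intro obs_on_apply_eq[OF f]) auto
        then show ?thesis using Gpar[of x] by simp
      qed
      \<comment> \<open>A flip at \<open>x\<close> is felt after an update at \<open>y\<close>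
        through \<open>x\<close> itself, and through the majority only if \<open>y\<close> is its
        parent; an update at \<open>x\<close> erases the flip.\<close>
      have ub: "\<bar>apply_bcontfun u (update E ?a y) - apply_bcontfun u (update E ?b y)\<bar> \<le> G x + (if y = par x then G y else 0)" for y
      proof -
        consider "y = x" | "y = par x" "y \<noteq> x" | "y \<noteq> x" "y \<noteq> par x" by blast
        then show ?thesis
        proof cases
          case 1
          have "majority E ?a x = majority E ?b x" by (rule majority_cong) auto
          then show ?thesis using 1 G0 by (simp add: update_def)
        next
          case 2
          let ?m = "majority E ?a y" and ?m' = "majority E ?b y"
          have eq: "update E ?a y = fun_upd (fun_upd \<omega> y ?m) x True" "update E ?b y = fun_upd (fun_upd \<omega> x False) y ?m'"
            "fun_upd (fun_upd \<omega> y ?m) x False = fun_upd (fun_upd \<omega> x False) y ?m"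
            using 2 by (auto simp: update_def fun_eq_iff)
          have "\<bar>apply_bcontfun u (update E ?a y) - apply_bcontfun u (fun_upd (fun_upd \<omega> y ?m) x False)\<bar> \<le> G x"
            unfolding eq(1) by (rule KD[OF u])
          moreover have "\<bar>apply_bcontfun u (fun_upd (fun_upd \<omega> y ?m) x False) - apply_bcontfun u (update E ?b y)\<bar> \<le> G y"
            unfolding eq(2,3) by (rule KD[OF u])
          ultimately show ?thesis using 2 by simp
        next
          case 3
          have "majority E ?a y = majority E ?b y" by (rule majority_cong) (use 3 in \<open>auto simp: kids_iff\<close>)
          then have "update E ?a y = fun_upd (fun_upd \<omega> y (majority E ?a y)) x True" "update E ?b y = fun_upd (fun_upd \<omega> y (majority E ?a y)) x False"
            using 3 by (auto simp: update_def fun_eq_iff)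
          then show ?thesis using KD[OF u, of "fun_upd \<omega> y (majority E ?a y)" x True False] 3 by simp
        qed
      qed
      have "\<bar>\<Sum>y\<in>B. apply_bcontfun u (update E ?a y) - apply_bcontfun u (update E ?b y)\<bar>
          \<le> (\<Sum>y\<in>B. G x + (if y = par x then G y else 0))"
        by (rule order_trans[OF sum_abs sum_mono[OF ub]])
      also have "\<dots> \<le> N * G x + G (par x)"
        using G0 finB by (auto simp: sum.distrib N_def sum.delta)
      finally have sb: "\<bar>\<Sum>y\<in>B. apply_bcontfun u (update E ?a y) - apply_bcontfun u (update E ?b y)\<bar> \<le> N * G x + G (par x)" .
      let ?F = "apply_bcontfun f ?a - apply_bcontfun f ?b"
      let ?S = "\<Sum>y\<in>B. apply_bcontfun u (update E ?a y) - apply_bcontfun u (update E ?b y)"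
      have "apply_bcontfun (\<Phi> u) ?a - apply_bcontfun (\<Phi> u) ?b = (1 / (1 + h * N)) * (?F + h * ?S)"
        unfolding ap by (simp add: sum_subtractf algebra_simps)
      then have eq: "\<bar>apply_bcontfun (\<Phi> u) ?a - apply_bcontfun (\<Phi> u) ?b\<bar> = \<bar>?F + h * ?S\<bar> / (1 + h * N)"
        using N by (simp add: abs_mult)
      have "\<bar>h * ?S\<bar> \<le> h * (N * G x + G (par x))"
        unfolding abs_mult using mult_left_mono[OF sb, of h] h by simp
      moreover have "h * (N * G x + G (par x)) = h * N * G x + h * G (par x)" by (simp only: distrib_left mult.assoc)
      moreover have "(1 + h * N) * G x = G x + h * N * G x" by (simp only: distrib_right mult_1_left)
      ultimately have "\<bar>?F + h * ?S\<bar> \<le> (1 + h * N) * G x"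
        using fb abs_triangle_ineq[of ?F "h * ?S"] by linarith
      then show ?thesis unfolding eq using N by (simp only: pos_divide_le_eq mult.commute)
    qed
    then show ?thesis using 1 by (simp add: K_def)
  qed
  have "\<exists>!u\<in>K. \<Phi> u = u"
  proof (rule Banach_fix[OF compK])
    show "K \<noteq> {}" using \<open>0 \<in> K\<close> by auto
    show "0 \<le> h * N / (1 + h * N)" "h * N / (1 + h * N) < 1" using N h by auto
    show "\<Phi> ` K \<subseteq> K" using PhiK by auto
    fix u w :: "'v obs"
    have "\<Phi> u - \<Phi> w = (h / (1 + h * N)) *\<^sub>R (\<Sum>y\<in>B. U y (u - w))"
      using U_bounded_linear by (simp add: \<Phi>_def linear_simps sum_subtractf algebra_simps flip: scaleR_diff_right)
    also have "norm \<dots> \<le> (h / (1 + h * N)) * (\<Sum>y\<in>B. norm (u - w))"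
    proof -
      have "norm (\<Sum>y\<in>B. U y (u - w)) \<le> (\<Sum>y\<in>B. norm (u - w))"
        by (rule order_trans[OF norm_sum sum_mono[OF norm_U]])
      then show ?thesis unfolding norm_scaleR using N h by (simp only: abs_of_nonneg divide_nonneg_nonneg less_imp_le mult_left_mono)
    qed
    finally show "dist (\<Phi> u) (\<Phi> w) \<le> h * N / (1 + h * N) * dist u w"
      by (simp add: dist_norm N_def)
  qed
  then obtain u where u: "u \<in> K" "\<Phi> u = u" by blast
  have uCD: "u \<in> obs_on A'" using u by (simp add: K_def)
  have "(1 + h * N) *\<^sub>R u = (1 + h * N) *\<^sub>R \<Phi> u" using u by simp
  also have "\<dots> = f + h *\<^sub>R (\<Sum>y\<in>B. U y u)" using N by (simp add: \<Phi>_def)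
  finally have uf: "u - h *\<^sub>R site_generation B u = f"
    by (simp add: site_generation_def sum_subtractf N_def sum_constant_scaleR algebra_simps)
  \<comment> \<open>\<open>u\<close> may depend on the fringe \<open>A' - B\<close>, whose
    resampling the fixed point equation omits; this is the whole error.\<close>
  have "site_generation A' u = site_generation B u + site_generation (A' - B) u"
    unfolding site_generation_def using sum.subset_diff[OF sub(2) finB(2), of "\<lambda>x. U x u - u"] by (simp only: add.commute)
  then have "u - h *\<^sub>R site_generation A' u - f = - (h *\<^sub>R site_generation (A' - B) u)" using uf by (simp add: algebra_simps)
  then have "norm (u - h *\<^sub>R site_generation A' u - f) = h * norm (site_generation (A' - B) u)" using h by simp
  also have "norm (site_generation (A' - B) u) \<le> (\<Sum>x\<in>A' - B. c / (1 - h) * h ^ Suc n)"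
    unfolding site_generation_def
  proof (rule order_trans[OF norm_sum sum_mono])
    fix x assume x: "x \<in> A' - B"
    have "norm (U x u - u) \<le> G x"
    proof (rule bcontfun_norm_le)
      fix \<omega>
      show "\<bar>apply_bcontfun (U x u - u) \<omega>\<bar> \<le> G x"
        using KD[OF u(1), of \<omega> x "majority E \<omega> x" "\<omega> x"] by (simp add: minus_bcontfun.rep_eq apply_U update_def)
    qed
    also have "G x \<le> c / (1 - h) * h ^ Suc n" by (rule Gn) (use x in \<open>auto simp: A'_def B_def generations_Suc\<close>)
    finally show "norm (U x u - u) \<le> c / (1 - h) * h ^ Suc n" .
  qed
  also have "\<dots> \<le> (3 ^ Suc n * real (card A)) * (c / (1 - h) * h ^ Suc n)"
  proof -
    have "card (A' - B) \<le> card (generation A (Suc n))"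
      using finite_card_generation[OF A(1)] by (intro card_mono) (auto simp: A'_def B_def generations_Suc)
    also have "\<dots> \<le> 3 ^ Suc n * card A" using finite_card_generation[OF A(1)] by blast
    finally have "real (card (A' - B)) \<le> real (3 ^ Suc n * card A)" by (rule of_nat_mono)
    then have "real (card (A' - B)) \<le> 3 ^ Suc n * real (card A)" by simp
    then show ?thesis unfolding sum_constant using c h by (intro mult_right_mono) auto
  qed
  also have "h * ((3 ^ Suc n * real (card A)) * (c / (1 - h) * h ^ Suc n)) = h * (real (card A) * (c / (1 - h)) * (3 * h) ^ Suc n)"
    by (simp only: power_mult_distrib mult_ac)
  also have "\<dots> \<le> e" using n by simp
  finally have "norm (u - h *\<^sub>R site_generation A' u - f) \<le> e" using h by (simp add: mult_left_mono)
  moreover have "(u, site_generation A' u) \<in> pre D" using finB sub uCD by (intro preI) auto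
  ultimately show ?thesis by blast
qed

lemma range_obs_on:
  assumes D: "closed_under_kids D" and f: "f \<in> obs_on D" and h: "0 < h" "h < 1 / 3"
  shows "\<exists>(u, v) \<in> closed_generation D. u \<in> obs_on D \<and> u - h *\<^sub>R v = f"
proof -
  have ex: "\<exists>p. p \<in> pre D \<and> norm (fst p - h *\<^sub>R snd p - f) \<le> e" if e: "0 < e" for e
  proof -
    obtain A g where A: "finite A" "A \<subseteq> D" "g \<in> obs_on A" "norm (f - g) \<le> e / 2"
      using local_dense[OF f, of "e / 2"] e by auto
    obtain u v where uv: "(u, v) \<in> pre D" "norm (u - h *\<^sub>R v - g) \<le> e / 2"
      using range_local[OF A(1,2) D A(3) h, of "e / 2"] e by auto
    have "norm (u - h *\<^sub>R v - f) \<le> norm (u - h *\<^sub>R v - g) + norm (f - g)"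
      by (metis diff_diff_eq2 diff_add_cancel norm_triangle_ineq4 add_diff_add)
    then show ?thesis using uv A(4) by (intro exI[of _ "(u, v)"]) auto
  qed
  define P where "P n p \<longleftrightarrow> p \<in> pre D \<and> norm (fst p - h *\<^sub>R snd p - f) \<le> 1 / real (Suc n)" for n and p :: "'v obs \<times> 'v obs"
  have "\<forall>n. \<exists>p. P n p" unfolding P_def by (intro allI ex) simp
  then obtain p where p: "\<forall>n. P n (p n)" using choice by blast
  define u v where "u n = fst (p n)" and "v n = snd (p n)" for n
  define w where "w n = u n - h *\<^sub>R v n" for n
  have uv: "(u n, v n) \<in> pre D" for n using p by (simp add: P_def u_def v_def)
  have wf: "w \<longlonglongrightarrow> f"
  proof -
    have "(\<lambda>n. w n - f) \<longlonglongrightarrow> 0"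
    proof (rule Lim_null_comparison)
      show "\<forall>\<^sub>F n in sequentially. norm (w n - f) \<le> 1 / real (Suc n)"
        using p by (simp add: P_def w_def u_def v_def)
      show "(\<lambda>n. 1 / real (Suc n)) \<longlonglongrightarrow> 0" by (intro LIMSEQ_Suc lim_const_over_n)
    qed
    then show ?thesis by (simp add: LIM_zero_iff)
  qed
  \<comment> \<open>Dissipativity controls \<open>u\<close> by \<open>u - h v\<close>, so
    approximate solutions form a Cauchy sequence, and the limit of \<open>v\<close> follows from the
    equation.\<close>
  have uw: "dist (u m) (u n) \<le> dist (w m) (w n)" for m n
  proof -
    have "(u m - u n, v m - v n) \<in> pre D" using subspace_diff[OF subspace_pre uv[of m] uv[of n]] by simp
    from pre_dissipative[OF this h(1)] show ?thesis by (simp add: dist_norm w_def algebra_simps)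
  qed
  have "Cauchy u"
    using LIMSEQ_imp_Cauchy[OF wf] uw unfolding Cauchy_def by (meson le_less_trans)
  then obtain u0 where u0: "u \<longlonglongrightarrow> u0" using complete_bcontfun unfolding complete_def by blast
  have v_eq: "v n = (1 / h) *\<^sub>R (u n - w n)" for n using h by (simp add: w_def)
  have v0: "v \<longlonglongrightarrow> (1 / h) *\<^sub>R (u0 - f)"
    unfolding v_eq[abs_def] by (intro tendsto_intros u0 wf)
  have "(u0, (1 / h) *\<^sub>R (u0 - f)) \<in> closed_generation D"
    unfolding closed_generation_def closure_sequential by (intro exI[of _ "\<lambda>n. (u n, v n)"] conjI allI uv tendsto_Pair u0 v0)
  moreover have "u0 \<in> obs_on D"
  proof (rule Lim_in_closed_set[OF closed_obs_on _ sequentially_bot u0])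
    show "\<forall>\<^sub>F n in sequentially. u n \<in> obs_on D" using pre_obs_on(1)[OF uv D] by simp
  qed
  ultimately show ?thesis using h by (intro bexI[of _ "(u0, (1 / h) *\<^sub>R (u0 - f))"]) auto
qed

lemma site_generation_exists: "finite A \<Longrightarrow> A \<subseteq> D \<Longrightarrow> f \<in> obs_on A \<Longrightarrow> (f, site_generation A f) \<in> closed_generation D"
  by (intro pre_closed_generation preI)

lemma closed_under_UNIV [simp]: "closed_under_kids UNIV"
  by (simp add: closed_under_kids_def)

sublocale HY: hille_yosida "closed_generation UNIV" "1 / 3"
proof
  show "convergent X" if "Cauchy X" for X :: "nat \<Rightarrow> 'v obs"
    using complete_bcontfun that unfolding complete_def convergent_def by blast
  show "subspace (closed_generation UNIV)" "closed (closed_generation UNIV)" by (rule subspace_closed_generation closed_closed_generation)+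
  show "norm u \<le> norm (u - h *\<^sub>R v)" if "(u, v) \<in> closed_generation UNIV" "0 < h" for u v h
    using that by (rule closed_generation_dissipative)
  show "\<exists>(u, v)\<in>closed_generation UNIV. u - h *\<^sub>R v = f" if "0 < h" "h < 1 / 3" for f h
    using range_obs_on[OF closed_under_UNIV obs_on_UNIV that, of f] by blast
  show "closure (fst ` closed_generation UNIV) = UNIV"
  proof -
    have "f \<in> closure (fst ` closed_generation UNIV)" for f
      unfolding closure_approachable
    proof (intro allI impI)
      fix e :: real assume "0 < e"
      then obtain A g where A: "finite A" "g \<in> obs_on A" "norm (f - g) \<le> e / 2"
        using local_dense[OF obs_on_UNIV[of f], of "e / 2"] by auto
      have "(g, site_generation A g) \<in> closed_generation UNIV" using A by (intro site_generation_exists) auto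
      then show "\<exists>y\<in>fst ` closed_generation UNIV. dist y f < e"
        using A(3) \<open>0 < e\<close> by (intro bexI[of _ g]) (force simp: dist_norm norm_minus_commute)+
    qed
    then show ?thesis by auto
  qed
qed simp

abbreviation S :: "real \<Rightarrow> 'v obs \<Rightarrow> 'v obs" where "S \<equiv> HY.S"

section \<open>Positivity, locality and symmetry of the semigroup\<close>

lemma S_one: "0 \<le> t \<Longrightarrow> S t (const_bcontfun 1) = const_bcontfun 1"
proof -
  assume t: "0 \<le> t"
  have "(const_bcontfun 1, site_generation {} (const_bcontfun 1)) \<in> closed_generation UNIV" by (intro site_generation_exists obs_on_const) auto
  from HY.S_norm_diff[OF this t] show ?thesis by (simp add: site_generation_def)
qed

text \<open>A contraction that fixes constants is positive: for \<open>0 \<le> f\<close> the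
  observable \<open>norm f - f\<close> has norm at most \<open>norm f\<close>, and its image keeps
  this bound.\<close>

lemma S_pos:
  assumes t: "0 \<le> t" and f: "\<And>\<omega>. 0 \<le> apply_bcontfun f \<omega>"
  shows "0 \<le> apply_bcontfun (S t f) \<omega>"
proof -
  let ?c = "norm f *\<^sub>R const_bcontfun 1 :: 'v obs"
  have "norm (?c - f) \<le> norm f"
  proof (rule bcontfun_norm_le)
    show "\<bar>apply_bcontfun (?c - f) \<omega>\<bar> \<le> norm f" for \<omega>
      using f[of \<omega>] abs_le_norm[of f \<omega>] by (simp add: minus_bcontfun.rep_eq scaleR_bcontfun.rep_eq const_bcontfun.rep_eq)
  qed
  moreover have "S t (?c - f) = ?c - S t f"
    using HY.S_linear[OF t] by (simp add: linear_diff linear_scale S_one t)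
  ultimately have "norm (?c - S t f) \<le> norm f" using HY.S_norm[OF t, of "?c - f"] by simp
  then have "\<bar>apply_bcontfun (?c - S t f) \<omega>\<bar> \<le> norm f" using abs_le_norm order_trans by blast
  then show ?thesis by (simp add: minus_bcontfun.rep_eq scaleR_bcontfun.rep_eq const_bcontfun.rep_eq)
qed

lemma markov_semigroup_S: "markov_semigroup S"
  unfolding markov_semigroup_def
  by (intro conjI allI impI HY.S_linear S_one S_pos HY.S_0 HY.S_add HY.S_tendsto_0) auto

lemma semigroup_generator_S: "semigroup_generator S = majority_generator E"
  using HY.generator_S by (simp add: semigroup_generator_def closed_generation_UNIV)

lemma S_obs_on:
  assumes "closed_under_kids D" "0 \<le> t" "f \<in> obs_on D" shows "S t f \<in> obs_on D"
  by (rule HY.S_invariant(1)[OF closed_generation_mono closed_closed_generation closed_obs_on range_obs_on]) (use assms in auto)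

lemma S_closed_generation:
  assumes "closed_under_kids D" "0 \<le> t" "f \<in> obs_on D" "g \<in> obs_on D" "(f, g) \<in> closed_generation D" shows "(S t f, S t g) \<in> closed_generation D"
  by (rule HY.S_invariant(2)[OF closed_generation_mono closed_closed_generation closed_obs_on range_obs_on]) (use assms in auto)

text \<open>By the Leibniz rule the product of two separate evolutions solves the evolution equation
  of the product. Uniqueness identifies the two for local observables, and density does the
  rest.\<close>

lemma S_product:
  assumes D: "closed_under_kids D" "closed_under_kids D'" "D \<inter> D' = {}"
    and f: "f \<in> obs_on D" and g: "g \<in> obs_on D'" and t: "0 \<le> t"
  shows "S t (bmul f g) = bmul (S t f) (S t g)"
proof -
  have local: "S t (bmul f g) = bmul (S t f) (S t g)" if f: "(f, f') \<in> pre D" and g: "(g, g') \<in> pre D'" for f f' g g'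
  proof -
    note f' = pre_obs_on[OF f D(1)] and g' = pre_obs_on[OF g D(2)]
    let ?F = "\<lambda>s. bmul (S s f) (S s g)"
    let ?F' = "\<lambda>s. bmul (S s f) (S s g') + bmul (S s f') (S s g)"
    have "?F t = S t (?F 0)"
    proof (rule HY.S_unique_time[OF _ _ t])
      fix s assume s: "s \<in> {0..t}"
      show "(?F has_vector_derivative ?F' s) (at s within {0..t})"
        using pre_closed_generation[OF f] pre_closed_generation[OF g] closed_generation_mono[of D UNIV] closed_generation_mono[of D' UNIV] s
        by (intro bounded_bilinear.has_vector_derivative[OF bounded_bilinear_bmul] HY.S_has_vector_derivative) auto
      have "(bmul (S s f) (S s g), bmul (S s f') (S s g) + bmul (S s f) (S s g')) \<in> closed_generation UNIV"
        using s D f' g' pre_closed_generation[OF f] pre_closed_generation[OF g] by (intro closed_generation_product[of _ _ D _ _ D'] S_closed_generation) auto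
      then show "(?F s, ?F' s) \<in> closed_generation UNIV" by (simp add: add.commute)
    qed
    then show ?thesis by simp
  qed
  have ex: "\<exists>u. u \<in> fst ` pre D \<and> norm (u - f) \<le> e" if f: "f \<in> obs_on D" "0 < e" for f D e
  proof -
    obtain A u where "finite A" "A \<subseteq> D" "u \<in> obs_on A" "norm (f - u) \<le> e" using local_dense[OF f] by auto
    then show ?thesis using preI[of A D u] by (intro exI[of _ u]) (force simp: norm_minus_commute)
  qed
  have seq: "\<exists>u. (\<forall>n. u n \<in> fst ` pre D) \<and> u \<longlonglongrightarrow> f" if f: "f \<in> obs_on D" for f D
  proof -
    have "\<forall>n. \<exists>u. u \<in> fst ` pre D \<and> norm (u - f) \<le> 1 / real (Suc n)" using ex[OF f] by simp
    then obtain u where u: "\<And>n. u n \<in> fst ` pre D" "\<And>n. norm (u n - f) \<le> 1 / real (Suc n)" by metis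
    have "(\<lambda>n. u n - f) \<longlonglongrightarrow> 0"
      by (rule Lim_null_comparison[OF always_eventually[OF allI[OF u(2)]]]) (intro LIMSEQ_Suc lim_const_over_n)
    then show ?thesis using u(1) by (auto simp: LIM_zero_iff)
  qed
  obtain u where u: "\<And>n. u n \<in> fst ` pre D" "u \<longlonglongrightarrow> f" using seq[OF f] by auto
  obtain w where w: "\<And>n. w n \<in> fst ` pre D'" "w \<longlonglongrightarrow> g" using seq[OF g] by auto
  note tS = bounded_linear.tendsto[OF HY.S_bounded_linear[OF t]]
  have "(\<lambda>n. S t (bmul (u n) (w n))) \<longlonglongrightarrow> S t (bmul f g)"
    by (intro tS tendsto_bmul u w)
  moreover have "S t (bmul (u n) (w n)) = bmul (S t (u n)) (S t (w n))" for n
    using local u(1)[of n] w(1)[of n] by auto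
  moreover have "(\<lambda>n. bmul (S t (u n)) (S t (w n))) \<longlonglongrightarrow> bmul (S t f) (S t g)"
    by (intro tS tendsto_bmul u w)
  ultimately show ?thesis using LIMSEQ_unique by simp
qed

text \<open>The pair \<open>\<theta>\<close>, \<open>\<phi>\<close> covers changes of opinion and
  relabellings of sites together: the global flip has \<open>\<phi> = id\<close>, and an
  automorphism acts by composition.\<close>

lemma S_symmetry:
  fixes \<theta> :: "('v \<Rightarrow> bool) \<Rightarrow> ('v \<Rightarrow> bool)" and \<phi> :: "'v \<Rightarrow> 'v"
  assumes cont: "continuous_on UNIV \<theta>"
    and inj: "inj \<phi>"
    and upd: "\<And>\<omega> x. \<theta> (update E \<omega> (\<phi> x)) = update E (\<theta> \<omega>) x"
    and loc: "\<And>\<omega> \<omega>' x. \<omega> (\<phi> x) = \<omega>' (\<phi> x) \<Longrightarrow> \<theta> \<omega> x = \<theta> \<omega>' x"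
    and t: "0 \<le> t" and g: "\<And>\<omega>. apply_bcontfun g \<omega> = apply_bcontfun f (\<theta> \<omega>)"
  shows "apply_bcontfun (S t g) \<omega> = apply_bcontfun (S t f) (\<theta> \<omega>)"
proof -
  define R where "R f = Bcontfun (\<lambda>\<omega>. apply_bcontfun f (\<theta> \<omega>))" for f :: "'v obs"
  have aR: "apply_bcontfun (R f) \<omega> = apply_bcontfun f (\<theta> \<omega>)" for f \<omega>
  proof -
    have "continuous_on UNIV (\<lambda>\<omega>. apply_bcontfun f (\<theta> \<omega>))"
      using continuous_on_compose[OF cont continuous_on_apply_bcontfun] by (simp add: o_def)
    from continuous_bcontfun[OF this] show ?thesis by (simp add: R_def)
  qed
  have bl: "bounded_linear R"
  proof (rule bounded_linear_intro)
    show "norm (R f) \<le> norm f * 1" for f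
      by (intro bcontfun_norm_le) (simp add: aR abs_le_norm)
  qed (auto intro!: bcontfun_eqI simp: aR plus_bcontfun.rep_eq scaleR_bcontfun.rep_eq)
  have pre: "(R f, R g) \<in> pre UNIV" if fg: "(f, g) \<in> pre UNIV" for f g
  proof -
    obtain A where A: "finite A" "f \<in> obs_on A" "g = site_generation A f" using fg by (auto simp: pre_def)
    have "R f \<in> obs_on (\<phi> ` A)"
    proof (rule obs_on_I)
      fix \<omega> \<omega>' :: "'v \<Rightarrow> bool" assume "\<And>x. x \<in> \<phi> ` A \<Longrightarrow> \<omega> x = \<omega>' x"
      then show "apply_bcontfun (R f) \<omega> = apply_bcontfun (R f) \<omega>'"
        unfolding aR by (intro obs_on_apply_eq[OF A(2)] loc) auto
    qed
    moreover have "site_generation (\<phi> ` A) (R f) = R g"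
    proof -
      have "U (\<phi> x) (R f) = R (U x f)" for x by (rule bcontfun_eqI) (simp add: aR apply_U upd)
      then have "site_generation (\<phi> ` A) (R f) = (\<Sum>x\<in>A. R (U x f) - R f)"
        unfolding site_generation_def using inj by (subst sum.reindex) (auto intro: inj_on_subset)
      then show ?thesis using bl by (simp add: A(3) site_generation_def linear_simps bounded_linear.linear linear_sum)
    qed
    ultimately show ?thesis using preI[of "\<phi> ` A" UNIV "R f"] A by simp
  qed
  have "(R f, R g) \<in> closed_generation UNIV" if fg: "(f, g) \<in> closed_generation UNIV" for f g
  proof -
    obtain u v where uv: "\<And>n. (u n, v n) \<in> pre UNIV" "u \<longlonglongrightarrow> f" "v \<longlonglongrightarrow> g" using closed_generation_E[OF fg] by blast
    show ?thesis
      unfolding closed_generation_def closure_sequential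
      by (intro exI[of _ "\<lambda>n. (R (u n), R (v n))"] conjI allI pre uv tendsto_Pair bounded_linear.tendsto[OF bl])
  qed
  then have "S t (R f) = R (S t f)" by (intro HY.S_commute bl t)
  moreover have "R f = g" by (rule bcontfun_eqI) (simp add: aR g)
  ultimately show ?thesis by (metis aR)
qed

end

section \<open>Layerwise independent opinions\<close>

definition coins :: "('v \<Rightarrow> bool) measure" where
  "coins = PiM UNIV (\<lambda>_. measure_pmf (bernoulli_pmf (1 / 2)))"

interpretation coins: product_prob_space "\<lambda>_::'v. measure_pmf (bernoulli_pmf (1 / 2))" UNIV
  by unfold_locales

lemma prob_space_coins: "prob_space coins"
  unfolding coins_def by unfold_locales

lemma sets_coins: "sets (coins :: ('v \<Rightarrow> bool) measure) = sets (PiM UNIV (\<lambda>_. count_space UNIV))"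
  unfolding coins_def by (intro sets_PiM_cong) auto

text \<open>Observables are uniform limits of functions of finitely many opinions, and those are
  measurable for the product sigma-algebra whatever the number of vertices.\<close>

lemma measurable_PiM_bcontfun:
  "apply_bcontfun (f :: 'v obs) \<in> borel_measurable (PiM UNIV (\<lambda>_. count_space UNIV))"
proof -
  let ?C = "\<lambda>_::'v. count_space (UNIV :: bool set)"
  have loc: "apply_bcontfun g \<in> borel_measurable (PiM UNIV ?C)" if g: "finite A" "g \<in> obs_on A" for g :: "'v obs" and A
  proof -
    let ?g = "\<lambda>\<omega>. apply_bcontfun g (\<lambda>x. if x \<in> A then \<omega> x else False)"
    have "(\<lambda>\<omega>. restrict \<omega> A) \<in> measurable (PiM UNIV ?C) (PiM A ?C)"
      by (rule measurable_restrict_subset) simp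
    moreover have "?g \<in> borel_measurable (PiM A ?C)"
      by (subst count_space_PiM_finite) (use g in auto)
    ultimately have "(\<lambda>\<omega>. ?g (restrict \<omega> A)) \<in> borel_measurable (PiM UNIV ?C)"
      by (rule measurable_compose)
    moreover have "(\<lambda>\<omega>. ?g (restrict \<omega> A)) = apply_bcontfun g"
      by (intro ext obs_on_apply_eq[OF g(2)]) auto
    ultimately show ?thesis by simp
  qed
  have "\<forall>n. \<exists>g. norm (f - g) \<le> 1 / real (Suc n) \<and> apply_bcontfun g \<in> borel_measurable (PiM UNIV ?C)"
  proof
    fix n
    obtain A g where "finite A" "g \<in> obs_on A" "norm (f - g) \<le> 1 / real (Suc n)"
      using local_dense[OF obs_on_UNIV[of f], of "1 / real (Suc n)"] by auto
    then show "\<exists>g. norm (f - g) \<le> 1 / real (Suc n) \<and> apply_bcontfun g \<in> borel_measurable (PiM UNIV ?C)"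
      using loc by blast
  qed
  then obtain g where g: "\<And>n. norm (f - g n) \<le> 1 / real (Suc n)" "\<And>n. apply_bcontfun (g n) \<in> borel_measurable (PiM UNIV ?C)"
    by metis
  have "(\<lambda>n. g n - f) \<longlonglongrightarrow> 0"
  proof (rule Lim_null_comparison)
    show "\<forall>\<^sub>F n in sequentially. norm (g n - f) \<le> 1 / real (Suc n)" using g(1) by (simp add: norm_minus_commute)
  qed (intro LIMSEQ_Suc lim_const_over_n)
  then have "g \<longlonglongrightarrow> f" by (simp add: LIM_zero_iff)
  from tendsto_apply_bcontfun[OF this] g(2) show ?thesis
    by (rule borel_measurable_LIMSEQ_real)
qed

lemma measurable_coins_bcontfun [measurable]: "apply_bcontfun (f :: 'v obs) \<in> borel_measurable coins"
  using measurable_PiM_bcontfun[of f] measurable_cong_sets[OF sets_coins refl] by blast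

lemma integrable_coins_bcontfun [simp]: "integrable coins (apply_bcontfun (f :: 'v obs))"
proof -
  interpret prob_space coins by (rule prob_space_coins)
  show ?thesis by (rule integrable_const_bound[of _ "norm f"]) (auto simp: abs_le_norm)
qed

definition m0 :: "'v obs \<Rightarrow> real" where
  "m0 f = integral\<^sup>L coins (apply_bcontfun f)"

lemma m0_linear: "m0 (f + g) = m0 f + m0 g" "m0 (c *\<^sub>R f) = c * m0 f"
  by (simp_all add: m0_def plus_bcontfun.rep_eq scaleR_bcontfun.rep_eq)

lemma m0_norm: "\<bar>m0 f\<bar> \<le> norm f"
proof -
  interpret prob_space coins by (rule prob_space_coins)
  have "\<bar>m0 f\<bar> \<le> (\<integral>\<omega>. \<bar>apply_bcontfun f \<omega>\<bar> \<partial>coins)" unfolding m0_def by (rule integral_abs_bound)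
  also have "\<dots> \<le> norm f" by (rule integral_le_const) (auto simp: abs_le_norm)
  finally show ?thesis .
qed

lemma m0_one: "m0 (const_bcontfun 1) = 1"
proof -
  interpret prob_space coins by (rule prob_space_coins)
  show ?thesis by (simp add: m0_def const_bcontfun.rep_eq prob_space)
qed

lemma m0_bounded_linear: "bounded_linear m0"
  by (rule bounded_linear_intro[of _ 1]) (auto simp: m0_linear m0_norm)

lemma m0_pos: "(\<And>\<omega>. 0 \<le> apply_bcontfun f \<omega>) \<Longrightarrow> 0 \<le> m0 f"
  unfolding m0_def by (intro integral_nonneg_AE) auto

lemma m0_product:
  assumes F: "F \<in> obs_on D" and G: "G \<in> obs_on D'" and D: "D \<inter> D' = {}"
  shows "m0 (bmul F G) = m0 F * m0 (G :: 'v obs)"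
proof -
  interpret prob_space "coins :: ('v \<Rightarrow> bool) measure" by (rule prob_space_coins)
  let ?N = "\<lambda>_::'v. measure_pmf (bernoulli_pmf (1 / 2))"
  have ind: "indep_vars ?N (\<lambda>i \<omega>. \<omega> i) (UNIV :: 'v set)"
  proof (subst indep_vars_iff_distr_eq_PiM)
    show "random_variable (?N i) (\<lambda>\<omega>. \<omega> i)" for i :: 'v by (simp add: coins_def)
    have "distr coins (?N i) (\<lambda>\<omega>. \<omega> i) = ?N i" for i :: 'v
      unfolding coins_def using coins.PiM_component[of i] by simp
    then show "distr coins (Pi\<^sub>M UNIV ?N) (\<lambda>x. \<lambda>i\<in>UNIV. x i) = Pi\<^sub>M UNIV (\<lambda>i. distr coins (?N i) (\<lambda>\<omega>. \<omega> i))"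
      by (simp add: coins_def restrict_def distr_id[unfolded id_def])
  qed simp
  \<comment> \<open>Partial configurations on \<open>D\<close> are completed by
    \<open>False\<close>, so that an observable of \<open>D\<close> becomes a function of the
    restriction to \<open>D\<close>, to which the independence of disjoint blocks applies.\<close>
  define ex where "ex D g = (\<lambda>x. if x \<in> D then g x else False)" for D :: "'v set" and g :: "'v \<Rightarrow> bool"
  have ex: "(\<lambda>g. apply_bcontfun F (ex D g)) \<in> borel_measurable (PiM D ?N)" for D and F :: "'v obs"
  proof -
    have "ex D \<in> measurable (PiM D ?N) (PiM UNIV (\<lambda>_. count_space UNIV))"
    proof (rule measurable_PiM_single')
      fix i
      show "(\<lambda>g. ex D g i) \<in> measurable (PiM D ?N) (count_space UNIV)"
      proof (cases "i \<in> D")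
        case True
        then have "(\<lambda>g. g i) \<in> measurable (PiM D ?N) (?N i)" by (rule measurable_component_singleton)
        then have "(\<lambda>g. g i) \<in> measurable (PiM D ?N) (count_space UNIV)" by simp
        then show ?thesis using True by (simp add: ex_def)
      qed (simp add: ex_def)
    qed auto
    from measurable_compose[OF this measurable_PiM_bcontfun] show ?thesis .
  qed
  have eq: "apply_bcontfun F (ex D (restrict \<omega> D)) = apply_bcontfun F \<omega>" if "F \<in> obs_on D" for F :: "'v obs" and D \<omega>
    by (rule obs_on_apply_eq[OF that]) (simp add: ex_def)
  have "indep_var borel ((\<lambda>g. apply_bcontfun F (ex D g)) \<circ> (\<lambda>\<omega>. restrict \<omega> D))
                 borel ((\<lambda>g. apply_bcontfun G (ex D' g)) \<circ> (\<lambda>\<omega>. restrict \<omega> D'))"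
    by (rule indep_var_compose[OF indep_var_restrict[OF ind D] ex ex]) auto
  then have "indep_var borel (apply_bcontfun F) borel (apply_bcontfun G)"
    by (simp add: o_def eq F G)
  from indep_var_lebesgue_integral[OF this]
  have E: "expectation (\<lambda>\<omega>. apply_bcontfun F \<omega> * apply_bcontfun G \<omega>) = expectation (apply_bcontfun F) * expectation (apply_bcontfun G)"
    by simp
  have "apply_bcontfun (bmul F G) = (\<lambda>\<omega>. apply_bcontfun F \<omega> * apply_bcontfun G \<omega>)" by (rule ext) (rule apply_bmul)
  then show ?thesis
    using E by (simp add: m0_def)
qed

text \<open>\<open>s = True\<close> is a pure relabelling and \<open>s = False\<close> adds the
  global flip. Injectivity keeps distinct sites on distinct coins.\<close>

lemma m0_symmetry:
  fixes \<phi> :: "'v \<Rightarrow> 'v" and s :: bool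
  assumes inj: "inj \<phi>" and g: "\<And>\<omega>. apply_bcontfun g \<omega> = apply_bcontfun f (\<lambda>x. \<omega> (\<phi> x) = s)"
  shows "m0 g = m0 f"
proof -
  let ?N = "\<lambda>_::'v. measure_pmf (bernoulli_pmf (1 / 2))"
  let ?T = "\<lambda>\<omega> x. \<omega> (\<phi> x) = s"
  have T: "?T \<in> measurable coins coins"
    unfolding coins_def
  proof (rule measurable_PiM_single')
    fix x
    have "(\<lambda>\<omega>. \<omega> (\<phi> x)) \<in> measurable (PiM UNIV ?N) (?N (\<phi> x))" by simp
    then have "(\<lambda>\<omega>. \<omega> (\<phi> x)) \<in> measurable (PiM UNIV ?N) (count_space UNIV)" by simp
    from measurable_compose[OF this, of "\<lambda>b. b = s" "count_space UNIV"]
    show "(\<lambda>\<omega>. ?T \<omega> x) \<in> measurable (PiM UNIV ?N) (?N x)" by simp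
  qed simp
  have "distr coins coins ?T = (coins :: ('v \<Rightarrow> bool) measure)"
    unfolding coins_def
  proof (rule coins.PiM_eq)
    fix J :: "'v set" and F :: "'v \<Rightarrow> bool set" assume J: "finite J"
    have inv: "the_inv_into J \<phi> (\<phi> j) = j" if "j \<in> J" for j
      using inj that by (intro the_inv_into_f_f) (auto intro: inj_on_subset)
    let ?F = "\<lambda>y. {b. (b = s) \<in> F (the_inv_into J \<phi> y)}"
    have emb: "prod_emb UNIV ?N J (Pi\<^sub>E J F) = {\<omega> :: 'v \<Rightarrow> bool. \<forall>j\<in>J. \<omega> j \<in> F j}" for J :: "'v set" and F :: "'v \<Rightarrow> bool set"
      by (auto simp: prod_emb_def PiE_iff)
    have T': "?T \<in> measurable (PiM UNIV ?N) (PiM UNIV ?N)" using T by (simp add: coins_def)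
    have "emeasure (distr (PiM UNIV ?N) (PiM UNIV ?N) ?T) (prod_emb UNIV ?N J (Pi\<^sub>E J F))
        = emeasure (PiM UNIV ?N) (?T -` prod_emb UNIV ?N J (Pi\<^sub>E J F) \<inter> space (PiM UNIV ?N))"
      by (rule emeasure_distr[OF T']) (intro sets_PiM_I, use J in auto)
    also have "?T -` prod_emb UNIV ?N J (Pi\<^sub>E J F) \<inter> space (PiM UNIV ?N) = prod_emb UNIV ?N (\<phi> ` J) (Pi\<^sub>E (\<phi> ` J) ?F)"
      unfolding emb using inv by (auto simp: space_PiM)
    also have "emeasure (PiM UNIV ?N) \<dots> = (\<Prod>y\<in>\<phi> ` J. emeasure (?N y) (?F y))"
      by (rule coins.emeasure_PiM_emb) (use J in auto)
    also have "\<dots> = (\<Prod>j\<in>J. emeasure (?N j) {b. (b = s) \<in> F j})"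
      using inj inv by (subst prod.reindex) (auto intro: inj_on_subset cong: prod.cong)
    also have "\<dots> = (\<Prod>j\<in>J. emeasure (?N j) (F j))"
    proof (rule prod.cong[OF refl])
      fix j
      have fl: "map_pmf (\<lambda>b. b = s) (bernoulli_pmf (1 / 2)) = bernoulli_pmf (1 / 2)"
      proof (rule pmf_eqI)
        fix b
        have "pmf (map_pmf (\<lambda>b. b = s) (bernoulli_pmf (1 / 2))) b = measure (bernoulli_pmf (1 / 2)) ((\<lambda>b. b = s) -` {b})"
          by (rule pmf_map)
        also have "(\<lambda>b. b = s) -` {b} = {b = s}" by auto
        also have "measure (bernoulli_pmf (1 / 2)) {b = s} = pmf (bernoulli_pmf (1 / 2)) b"
          by (cases b; cases s) (simp_all add: measure_pmf_single)
        finally show "pmf (map_pmf (\<lambda>b. b = s) (bernoulli_pmf (1 / 2))) b = pmf (bernoulli_pmf (1 / 2)) b" .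
      qed
      have "emeasure (map_pmf (\<lambda>b. b = s) (bernoulli_pmf (1 / 2))) (F j) = emeasure (bernoulli_pmf (1 / 2)) {b. (b = s) \<in> F j}"
        by (simp add: vimage_def)
      then show "emeasure (?N j) {b. (b = s) \<in> F j} = emeasure (?N j) (F j)" by (simp add: fl)
    qed
    finally show "emeasure (distr (PiM UNIV ?N) (PiM UNIV ?N) ?T) (prod_emb UNIV ?N J (Pi\<^sub>E J F)) = (\<Prod>j\<in>J. emeasure (?N j) (F j))" .
  qed simp
  then have "m0 f = integral\<^sup>L (distr coins coins ?T) (apply_bcontfun f)" by (simp add: m0_def)
  also have "\<dots> = (\<integral>\<omega>. apply_bcontfun f (?T \<omega>) \<partial>coins)" by (rule integral_distr[OF T]) simp
  also have "(\<lambda>\<omega>. apply_bcontfun f (?T \<omega>)) = apply_bcontfun g" by (rule ext) (simp add: g)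
  also have "integral\<^sup>L coins \<dots> = m0 g" by (simp add: m0_def)
  finally show ?thesis by simp
qed

text \<open>\<open>Y\<close> is a supersolution of \<open>y' = f - y\<close>; with the integrating
  factor \<open>exp\<close>, both \<open>exp t (Y - y)\<close> and \<open>exp t (Y + y)\<close> are
  nondecreasing.\<close>

lemma abs_le_comparison:
  fixes y Y f :: "real \<Rightarrow> real"
  assumes ab: "a \<le> b"
    and y: "\<And>t. t \<in> {a..b} \<Longrightarrow> (y has_vector_derivative f t - y t) (at t within {a..b})"
    and Y: "\<And>t. t \<in> {a..b} \<Longrightarrow> (Y has_real_derivative Y' t) (at t)"
    and F: "\<And>t. t \<in> {a..b} \<Longrightarrow> \<bar>f t\<bar> \<le> Y' t + Y t"
    and init: "\<bar>y a\<bar> \<le> Y a"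
  shows "\<bar>y b\<bar> \<le> Y b"
proof -
  have *: "exp a * (Y a - c * y a) \<le> exp b * (Y b - c * y b)" if c: "c = 1 \<or> c = -1" for c
  proof (rule DERIV_nonneg_imp_increasing_open[OF ab])
    fix t assume t: "a < t" "t < b"
    have sub: "{a<..<b} \<subseteq> {a..b}" by auto
    have "(y has_vector_derivative f t - y t) (at t within {a..b})" using t by (intro y) auto
    then have "(y has_vector_derivative f t - y t) (at t within {a<..<b})"
      using sub by (rule has_vector_derivative_within_subset)
    then have "(y has_vector_derivative f t - y t) (at t)"
      using t has_vector_derivative_within_open[of t "{a<..<b}" y] by simp
    then have y': "(y has_real_derivative f t - y t) (at t)"
      by (simp add: has_real_derivative_iff_has_vector_derivative)
    have "((\<lambda>t. exp t * (Y t - c * y t)) has_real_derivative exp t * (Y t - c * y t) + (Y' t - c * (f t - y t)) * exp t) (at t)"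
      using t by (intro DERIV_mult DERIV_exp DERIV_diff Y DERIV_cmult y') auto
    moreover have "0 \<le> exp t * (Y t - c * y t) + (Y' t - c * (f t - y t)) * exp t"
    proof -
      have "c * f t \<le> Y' t + Y t" using F[of t] t c by (auto simp: abs_le_iff)
      then have "0 \<le> exp t * (Y' t + Y t - c * f t)" by simp
      then show ?thesis by (simp add: algebra_simps)
    qed
    ultimately show "\<exists>z. ((\<lambda>t. exp t * (Y t - c * y t)) has_real_derivative z) (at t) \<and> 0 \<le> z" by blast
  next
    have "continuous_on {a..b} y"
      unfolding continuous_on_eq_continuous_within using y has_vector_derivative_continuous by blast
    moreover have "continuous_on {a..b} Y"
      by (intro continuous_at_imp_continuous_on ballI DERIV_isCont[OF Y])
    ultimately show "continuous_on {a..b} (\<lambda>t. exp t * (Y t - c * y t))" by (intro continuous_intros)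
  qed
  have "0 \<le> exp b * (Y b - c * y b)" if c: "c = 1 \<or> c = -1" for c
  proof -
    have "0 \<le> Y a - c * y a" using init c by (auto simp: abs_le_iff)
    then have "0 \<le> exp a * (Y a - c * y a)" by simp
    then show ?thesis using *[OF c] by linarith
  qed
  from this[of 1] this[of "-1"] show ?thesis by (simp add: zero_le_mult_iff abs_le_iff)
qed

section \<open>Decay of correlations\<close>

text \<open>On \<open>[0, 1]\<close> the slope of \<open>(3 x + x^3) / 4\<close> is at most
  \<open>3/2\<close>, which is the factor in front of \<open>d\<close>.\<close>

lemma cubic_bound:
  fixes \<beta> \<rho> d :: real
  assumes "0 \<le> \<beta>" "\<beta> \<le> 1" "\<beta> \<le> \<rho> + d" "0 \<le> \<rho>" "\<rho> \<le> 1" "0 \<le> d"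
  shows "(3 * \<beta> + \<beta> ^ 3) / 4 \<le> 3 / 4 * \<rho> + \<rho> ^ 3 / 4 + 3 / 2 * d"
proof -
  have "\<beta> ^ 3 - \<rho> ^ 3 = (\<beta> - \<rho>) * (\<beta>\<^sup>2 + \<beta> * \<rho> + \<rho>\<^sup>2)" by (simp add: algebra_simps power3_eq_cube power2_eq_square)
  moreover have "(\<beta> - \<rho>) * (\<beta>\<^sup>2 + \<beta> * \<rho> + \<rho>\<^sup>2) \<le> d * 3"
  proof (cases "\<beta> \<le> \<rho>")
    case True
    then have "(\<beta> - \<rho>) * (\<beta>\<^sup>2 + \<beta> * \<rho> + \<rho>\<^sup>2) \<le> 0" using assms by (intro mult_nonpos_nonneg) auto
    then show ?thesis using assms by linarith
  next
    case False
    have "\<beta>\<^sup>2 \<le> 1" "\<rho>\<^sup>2 \<le> 1" "\<beta> * \<rho> \<le> 1" using assms by (auto intro!: power_le_one mult_le_one)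
    then show ?thesis using assms False by (intro mult_mono) auto
  qed
  ultimately show ?thesis using assms by argo
qed

context layered_tree
begin

section \<open>Opinions, majorities and expectations from fair coins\<close>

abbreviation one :: "'v obs" where "one \<equiv> const_bcontfun 1"

definition sgn_of :: "bool \<Rightarrow> real" where "sgn_of b = (if b then 1 else -1)"

definition chi :: "'v \<Rightarrow> 'v obs" where "chi x = Bcontfun (\<lambda>\<omega>. sgn_of (\<omega> x))"

text \<open>Writing the majority as a resampled opinion makes \<open>Maj x - chi x\<close> the
  generator applied to \<open>chi x\<close>.\<close>

definition Maj :: "'v \<Rightarrow> 'v obs" where "Maj x = U x (chi x)"

lemma apply_chi: "apply_bcontfun (chi x) \<omega> = sgn_of (\<omega> x)"
proof -
  have "dep {x} (\<lambda>\<omega>. sgn_of (\<omega> x))" by (auto simp: dep_def)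
  from apply_dep[OF _ this] show ?thesis by (simp add: chi_def)
qed

lemma apply_Maj: "apply_bcontfun (Maj x) \<omega> = sgn_of (majority E \<omega> x)"
  by (simp add: Maj_def apply_U apply_chi update_def)

lemma obs_on_chi: "chi x \<in> obs_on {x}"
  by (rule obs_on_I) (simp add: apply_chi)

lemma obs_on_Maj: "Maj x \<in> obs_on (kids x)"
  by (rule obs_on_I, unfold apply_Maj, rule arg_cong[where f = sgn_of], rule majority_cong)

lemma chi_closed_generation: "(chi x, Maj x - chi x) \<in> closed_generation {x}"
  using site_generation_exists[of "{x}" "{x}" "chi x"] obs_on_chi by (simp add: site_generation_def Maj_def)

lemma norm_chi: "norm (chi x) \<le> 1"
  by (rule bcontfun_norm_le) (simp add: apply_chi sgn_of_def)

definition desc :: "'v \<Rightarrow> 'v set" where "desc y = {z. \<exists>n. (par ^^ n) z = y}"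

lemma self_desc [simp]: "y \<in> desc y"
  unfolding desc_def by (auto intro: exI[of _ 0])

lemma closed_desc: "closed_under_kids (desc y)"
  unfolding closed_under_kids_def desc_def
proof (intro allI impI CollectI)
  fix x assume "par x \<in> {z. \<exists>n. (par ^^ n) z = y}"
  then obtain n where "(par ^^ n) (par x) = y" by auto
  then have "(par ^^ Suc n) x = y" by (simp add: funpow_swap1)
  then show "\<exists>n. (par ^^ n) x = y" by blast
qed

text \<open>Each parent step raises the height by one, so a common descendant would reach both
  vertices after equally many steps.\<close>

lemma desc_disjoint:
  assumes "ht y = ht y'" "y \<noteq> y'" shows "desc y \<inter> desc y' = {}"
proof (rule ccontr)
  assume "desc y \<inter> desc y' \<noteq> {}"
  then obtain z n m where z: "(par ^^ n) z = y" "(par ^^ m) z = y'" by (auto simp: desc_def)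
  then have "n = m" using assms(1) ht_funpow_par[of n z] ht_funpow_par[of m z] by simp
  then show False using z assms by simp
qed

lemma closed_UN: "(\<And>i. i \<in> I \<Longrightarrow> closed_under_kids (D i)) \<Longrightarrow> closed_under_kids (\<Union>i\<in>I. D i)"
  unfolding closed_under_kids_def by blast

definition strict_desc :: "'v \<Rightarrow> 'v set" where "strict_desc x = (\<Union>y\<in>kids x. desc y)"

lemma closed_strict_desc: "closed_under_kids (strict_desc x)"
  unfolding strict_desc_def by (intro closed_UN closed_desc)

lemma kids_strict_desc: "kids x \<subseteq> strict_desc x"
  by (auto simp: strict_desc_def)

lemma ht_kids: "y \<in> kids x \<Longrightarrow> ht y = ht x - 1"
  using ht_par[of y] by (simp add: kids_iff)

lemma notin_strict_desc: "x \<notin> strict_desc x"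
proof
  assume "x \<in> strict_desc x"
  then obtain y n where y: "y \<in> kids x" "(par ^^ n) x = y" by (auto simp: strict_desc_def desc_def)
  then show False using ht_funpow_par[of n x] ht_kids[of y x] by simp
qed

text \<open>The law at time \<open>s\<close> of the process started from fair i.i.d. opinions, as a
  functional.\<close>

definition mean_at :: "real \<Rightarrow> 'v obs \<Rightarrow> real" where "mean_at s f = m0 (S s f)"

lemma mean_at_bounded_linear: "0 \<le> s \<Longrightarrow> bounded_linear (mean_at s)"
  unfolding mean_at_def using bounded_linear_compose[OF m0_bounded_linear HY.S_bounded_linear] by (simp add: o_def)

lemma mean_at_norm: "0 \<le> s \<Longrightarrow> \<bar>mean_at s f\<bar> \<le> norm f"
  unfolding mean_at_def by (meson HY.S_norm m0_norm order_trans)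

lemma mean_at_one: "0 \<le> s \<Longrightarrow> mean_at s one = 1"
  by (simp add: mean_at_def S_one m0_one)

lemma mean_at_product:
  assumes "closed_under_kids D" "closed_under_kids D'" "D \<inter> D' = {}" "F \<in> obs_on D" "G \<in> obs_on D'" "0 \<le> s"
  shows "mean_at s (bmul F G) = mean_at s F * mean_at s G"
  unfolding mean_at_def S_product[OF assms]
  by (rule m0_product[OF _ _ assms(3)]) (use assms in \<open>auto intro: S_obs_on\<close>)

lemma mean_at_add_time: "0 \<le> s \<Longrightarrow> 0 \<le> t \<Longrightarrow> mean_at s (S t f) = mean_at (s + t) f"
  by (simp add: mean_at_def HY.S_add)

lemma card_kids_split: "card {z \<in> kids x. \<omega> z} + card {z \<in> kids x. \<not> \<omega> z} = 3"
proof -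
  have "card ({z \<in> kids x. \<omega> z} \<union> {z \<in> kids x. \<not> \<omega> z}) = card {z \<in> kids x. \<omega> z} + card {z \<in> kids x. \<not> \<omega> z}"
    by (intro card_Un_disjoint) auto
  moreover have "{z \<in> kids x. \<omega> z} \<union> {z \<in> kids x. \<not> \<omega> z} = kids x" by auto
  ultimately show ?thesis using card_kids[of x] by simp
qed

text \<open>Three is odd, so there are no ties.\<close>

lemma majority_flip: "majority E (\<lambda>y. \<not> \<omega> y) x \<longleftrightarrow> \<not> majority E \<omega> x"
  using card_kids_split[of x \<omega>] unfolding majority_def not_not by presburger

text \<open>The global flip commutes with the dynamics and preserves fair coins, but changes the
  sign of \<open>chi x\<close>.\<close>

lemma mean_at_chi_zero: assumes "0 \<le> s" shows "mean_at s (chi x) = 0"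
proof -
  let ?\<theta> = "\<lambda>\<omega> x. \<omega> (id x) = False"
  have 1: "apply_bcontfun (S s (- chi x)) \<omega> = apply_bcontfun (S s (chi x)) (?\<theta> \<omega>)" for \<omega>
  proof (rule S_symmetry[where \<phi> = id])
    show "continuous_on UNIV ?\<theta>"
    proof (rule continuous_on_coordinatewise_then_product)
      fix i
      show "continuous_on UNIV (\<lambda>\<omega>. \<omega> (id i) = False)"
        by (rule dep_continuous[of "{i}"]) (auto simp: dep_def)
    qed
    show "?\<theta> (update E \<omega> (id x)) = update E (?\<theta> \<omega>) x" for \<omega> x
      by (auto simp: update_def majority_flip fun_eq_iff)
    show "apply_bcontfun (- chi x) \<omega> = apply_bcontfun (chi x) (?\<theta> \<omega>)" for \<omega>
      by (simp add: uminus_bcontfun.rep_eq apply_chi sgn_of_def)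
  qed (use assms in auto)
  have "m0 (S s (- chi x)) = m0 (S s (chi x))"
    by (rule m0_symmetry[of id _ _ False]) (use 1 in auto)
  moreover have "S s (- chi x) = - S s (chi x)" using HY.S_linear[OF assms] by (rule linear_neg)
  moreover have "m0 (- S s (chi x)) = - m0 (S s (chi x))" by (rule linear_neg[OF bounded_linear.linear[OF m0_bounded_linear]])
  ultimately show ?thesis by (simp add: mean_at_def)
qed

text \<open>These are the correlations \<open>p\<close>, \<open>q\<close>, \<open>r\<close> of the introduction for the process started from fair i.i.d. opinions.\<close>

definition corr_self :: "'v \<Rightarrow> real \<Rightarrow> real \<Rightarrow> real" where
  "corr_self x s t = mean_at s (bmul (chi x) (S (t - s) (chi x)))"

definition corr_maj :: "'v \<Rightarrow> real \<Rightarrow> real \<Rightarrow> real" where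
  "corr_maj x s t = mean_at s (bmul (chi x) (S (t - s) (Maj x)))"

definition corr_maj_maj :: "'v \<Rightarrow> real \<Rightarrow> real \<Rightarrow> real" where
  "corr_maj_maj x s t = mean_at s (bmul (Maj x) (S (t - s) (Maj x)))"

section \<open>Equations for the correlations\<close>

lemma corr_self_le_1: "0 \<le> s \<Longrightarrow> s \<le> t \<Longrightarrow> \<bar>corr_self x s t\<bar> \<le> 1"
proof -
  assume st: "0 \<le> s" "s \<le> t"
  have "\<bar>corr_self x s t\<bar> \<le> norm (bmul (chi x) (S (t - s) (chi x)))" unfolding corr_self_def by (rule mean_at_norm[OF st(1)])
  also have "\<dots> \<le> norm (chi x) * norm (S (t - s) (chi x))" by (rule norm_bmul)
  also have "\<dots> \<le> 1 * 1"
    using HY.S_norm[of "t - s" "chi x"] norm_chi[of x] st by (intro mult_mono) auto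
  finally show ?thesis by simp
qed

lemma sgn_sq [simp]: "sgn_of b * sgn_of b = 1" by (simp add: sgn_of_def)

lemma corr_self_refl: "0 \<le> s \<Longrightarrow> corr_self x s s = 1"
proof -
  assume s: "0 \<le> s"
  have "bmul (chi x) (chi x) = one" by (rule bcontfun_eqI) (simp add: apply_bmul apply_chi const_bcontfun.rep_eq)
  then show ?thesis using s by (simp add: corr_self_def mean_at_one)
qed

lemma kids_three:
  obtains a b c where "kids x = {a, b, c}" "a \<noteq> b" "a \<noteq> c" "b \<noteq> c"
  using card_kids[of x] unfolding card_3_iff by blast

definition triple_mul :: "'v obs \<Rightarrow> 'v obs \<Rightarrow> 'v obs \<Rightarrow> 'v obs" where "triple_mul F G H = bmul F (bmul G H)"

lemma apply_triple_mul: "apply_bcontfun (triple_mul F G H) \<omega> = apply_bcontfun F \<omega> * (apply_bcontfun G \<omega> * apply_bcontfun H \<omega>)"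
  by (simp add: triple_mul_def apply_bmul)

text \<open>The Walsh expansion of the majority of three signs.\<close>

lemma Maj_poly:
  assumes k: "kids x = {a, b, c}" "a \<noteq> b" "a \<noteq> c" "b \<noteq> c"
  shows "Maj x = (1 / 2) *\<^sub>R (chi a + chi b + chi c - triple_mul (chi a) (chi b) (chi c))"
proof (rule bcontfun_eqI)
  fix \<omega> :: "'v \<Rightarrow> bool"
  have set: "{z \<in> {a, b, c}. P z} = (if P a then {a} else {}) \<union> (if P b then {b} else {}) \<union> (if P c then {c} else {})" for P
    by auto
  have "sgn_of (majority E \<omega> x) = (1 / 2) * (sgn_of (\<omega> a) + sgn_of (\<omega> b) + sgn_of (\<omega> c) - sgn_of (\<omega> a) * (sgn_of (\<omega> b) * sgn_of (\<omega> c)))"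
    unfolding majority_def k(1) set using k(2-4) by (simp add: sgn_of_def)
  then show "apply_bcontfun (Maj x) \<omega> = apply_bcontfun ((1 / 2) *\<^sub>R (chi a + chi b + chi c - triple_mul (chi a) (chi b) (chi c))) \<omega>"
    by (simp add: apply_Maj apply_chi apply_triple_mul scaleR_bcontfun.rep_eq plus_bcontfun.rep_eq minus_bcontfun.rep_eq)
qed

text \<open>The subtrees below the three children evolve independently, and every opinion has mean
  zero. Only products survive in which the two opinions of a child, at the two times, occur together
  or not at all.\<close>

lemma corr_maj_maj_formula:
  assumes k: "kids x = {a, b, c}" "a \<noteq> b" "a \<noteq> c" "b \<noteq> c" and st: "0 \<le> s" "s \<le> t"
  shows "corr_maj_maj x s t = (corr_self a s t + corr_self b s t + corr_self c s t + corr_self a s t * corr_self b s t * corr_self c s t) / 4"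
proof -
  have hts: "ht a = ht x - 1" "ht b = ht x - 1" "ht c = ht x - 1" using k(1) ht_kids by auto
  have dis: "desc a \<inter> desc b = {}" "desc a \<inter> desc c = {}" "desc b \<inter> desc c = {}" "desc a \<inter> (desc b \<union> desc c) = {}"
    using desc_disjoint hts k by (auto simp: Int_Un_distrib)
  have cl: "closed_under_kids (desc b \<union> desc c)"
    using closed_desc unfolding closed_under_kids_def by blast
  have E3: "mean_at s (triple_mul F G H) = mean_at s F * mean_at s G * mean_at s H" if "F \<in> obs_on (desc a)" "G \<in> obs_on (desc b)" "H \<in> obs_on (desc c)" "0 \<le> s" for F G H s
  proof -
    have "bmul G H \<in> obs_on (desc b \<union> desc c)"
      using that obs_on_mono[of "desc b" "desc b \<union> desc c"] obs_on_mono[of "desc c" "desc b \<union> desc c"] by (intro obs_on_bmul) auto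
    then show ?thesis
      unfolding triple_mul_def using that mean_at_product[OF closed_desc cl dis(4), of F "bmul G H" s]
        mean_at_product[OF closed_desc closed_desc dis(3), of G H s] by simp
  qed
  define \<tau> where "\<tau> = t - s"
  have \<tau>: "0 \<le> \<tau>" "s + \<tau> = t" "0 \<le> t" using st by (auto simp: \<tau>_def)
  have Cc: "chi y \<in> obs_on (desc y)" for y using obs_on_chi[of y] obs_on_mono[of "{y}" "desc y"] by auto
  have CS: "S \<tau> (chi y) \<in> obs_on (desc y)" for y by (rule S_obs_on[OF closed_desc \<tau>(1) Cc])
  have S3: "S \<tau> (triple_mul (chi a) (chi b) (chi c)) = triple_mul (S \<tau> (chi a)) (S \<tau> (chi b)) (S \<tau> (chi c))"
  proof -
    have "bmul (chi b) (chi c) \<in> obs_on (desc b \<union> desc c)"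
      using Cc obs_on_mono[of "desc b" "desc b \<union> desc c"] obs_on_mono[of "desc c" "desc b \<union> desc c"] by (intro obs_on_bmul) auto
    then show ?thesis
      unfolding triple_mul_def using S_product[OF closed_desc cl dis(4) Cc _ \<tau>(1)] S_product[OF closed_desc closed_desc dis(3) Cc Cc \<tau>(1)]
      by simp
  qed
  define A B C where "A = chi a" and "B = chi b" and "C = chi c"
  define A' B' C' where "A' = S \<tau> (chi a)" and "B' = S \<tau> (chi b)" and "C' = S \<tau> (chi c)"
  define a2 b2 c2 where "a2 = bmul A A'" and "b2 = bmul B B'" and "c2 = bmul C C'"
  have SM: "S \<tau> (Maj x) = (1 / 2) *\<^sub>R (A' + B' + C' - triple_mul A' B' C')"
    unfolding Maj_poly[OF k] using HY.S_linear[OF \<tau>(1)]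
    by (simp add: linear_scale linear_diff linear_add S3 A'_def B'_def C'_def)
  \<comment> \<open>The sixteen products are sorted so that the three slots of
    \<open>triple_mul\<close> belong to \<open>a\<close>, \<open>b\<close>, \<open>c\<close> in this
    order. A slot with a single unpaired opinion makes its term vanish, which leaves four
    terms.\<close>
  have exp: "bmul (Maj x) (S \<tau> (Maj x)) = (1 / 4) *\<^sub>R (
      triple_mul a2 one one + triple_mul A B' one + triple_mul A one C' - triple_mul a2 B' C' +
      triple_mul A' B one + triple_mul one b2 one + triple_mul one B C' - triple_mul A' b2 C' +
      triple_mul A' one C + triple_mul one B' C + triple_mul one one c2 - triple_mul A' B' c2 -
      triple_mul a2 B C - triple_mul A b2 C - triple_mul A B c2 + triple_mul a2 b2 c2)"
    unfolding SM unfolding Maj_poly[OF k]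
    by (rule bcontfun_eqI)
       (simp add: apply_bmul apply_triple_mul scaleR_bcontfun.rep_eq plus_bcontfun.rep_eq minus_bcontfun.rep_eq const_bcontfun.rep_eq
          a2_def b2_def c2_def A_def B_def C_def field_simps)
  note Cs = Cc[of a] Cc[of b] Cc[of c] CS[of a] CS[of b] CS[of c]
  have Cs': "A \<in> obs_on (desc a)" "B \<in> obs_on (desc b)" "C \<in> obs_on (desc c)" "A' \<in> obs_on (desc a)" "B' \<in> obs_on (desc b)" "C' \<in> obs_on (desc c)"
    using Cs by (auto simp: A_def B_def C_def A'_def B'_def C'_def)
  have Cs2: "a2 \<in> obs_on (desc a)" "b2 \<in> obs_on (desc b)" "c2 \<in> obs_on (desc c)"
    unfolding a2_def b2_def c2_def using Cs' by (auto intro: obs_on_bmul)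
  have z: "mean_at s A = 0" "mean_at s B = 0" "mean_at s C = 0" "mean_at s A' = 0" "mean_at s B' = 0" "mean_at s C' = 0"
    using st \<tau> by (simp_all add: A_def B_def C_def A'_def B'_def C'_def mean_at_chi_zero mean_at_add_time)
  have e2: "mean_at s a2 = corr_self a s t" "mean_at s b2 = corr_self b s t" "mean_at s c2 = corr_self c s t"
    by (simp_all add: corr_self_def a2_def b2_def c2_def A_def A'_def B_def B'_def C_def C'_def \<tau>_def)
  note lin = mean_at_bounded_linear[OF st(1)]
  have "corr_maj_maj x s t = mean_at s (bmul (Maj x) (S \<tau> (Maj x)))" by (simp add: corr_maj_maj_def \<tau>_def)
  also have "\<dots> = (corr_self a s t + corr_self b s t + corr_self c s t + corr_self a s t * corr_self b s t * corr_self c s t) / 4"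
    unfolding exp using lin
    by (simp add: linear_simps E3 Cs' Cs2 obs_on_const z e2 mean_at_one st)
  finally show ?thesis .
qed

lemma corr_self_derivative:
  assumes "0 \<le> s" "t \<in> {s..b}"
  shows "(corr_self x s has_vector_derivative corr_maj x s t - corr_self x s t) (at t within {s..b})"
proof -
  have closed_generation: "(chi x, Maj x - chi x) \<in> closed_generation UNIV" using chi_closed_generation closed_generation_mono by blast
  have "((\<lambda>u. S u (chi x)) has_vector_derivative S (t - s) (Maj x - chi x)) (at (t - s) within {0..b - s})"
    using assms by (intro HY.S_has_vector_derivative[OF closed_generation]) auto
  moreover have "((\<lambda>t. t - s) has_vector_derivative 1) (at t within {s..b})"
    by (auto intro!: derivative_eq_intros)
  moreover have "(\<lambda>t. t - s) ` {s..b} = {0..b - s}" by (auto simp: image_iff intro!: bexI[of _ "_ + s"])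
  ultimately have "(((\<lambda>u. S u (chi x)) \<circ> (\<lambda>t. t - s)) has_vector_derivative 1 *\<^sub>R S (t - s) (Maj x - chi x)) (at t within {s..b})"
    by (intro vector_diff_chain_within) auto
  then have "((\<lambda>t. S (t - s) (chi x)) has_vector_derivative S (t - s) (Maj x - chi x)) (at t within {s..b})"
    by (simp add: o_def)
  moreover have bl: "bounded_linear (\<lambda>F. mean_at s (bmul (chi x) F))"
    using bounded_linear_compose[OF mean_at_bounded_linear[OF assms(1)] bounded_bilinear.bounded_linear_right[OF bounded_bilinear_bmul]] .
  ultimately have "((\<lambda>t. mean_at s (bmul (chi x) (S (t - s) (chi x)))) has_vector_derivative mean_at s (bmul (chi x) (S (t - s) (Maj x - chi x)))) (at t within {s..b})"
    by (intro bounded_linear.has_vector_derivative[OF bl])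
  moreover have "mean_at s (bmul (chi x) (S (t - s) (Maj x - chi x))) = corr_maj x s t - corr_self x s t"
    using HY.S_linear[of "t - s"] assms
    by (simp add: linear_diff linear_diff[OF bounded_linear.linear[OF bl]] corr_self_def corr_maj_def)
  ultimately show ?thesis by (simp add: corr_self_def[abs_def])
qed

text \<open>Raising \<open>s\<close> evolves the product for longer and the second factor for less
  time. By the Leibniz rule the two changes of the second factor cancel, and only the generator
  applied to \<open>chi x\<close> remains.\<close>

lemma corr_maj_derivative:
  assumes t: "0 \<le> t" and s: "s \<in> {0..t}"
  shows "((\<lambda>s. corr_maj x s t) has_vector_derivative corr_maj_maj x s t - corr_maj x s t) (at s within {0..t})"
proof -
  define L where "L = site_generation (kids x) (Maj x)"
  have pre: "(Maj x, L) \<in> pre (strict_desc x)" unfolding L_def by (intro preI kids_strict_desc obs_on_Maj) simp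
  note majL = pre_closed_generation[OF pre] pre_obs_on[OF pre closed_strict_desc]
  have AD1: "(S u (Maj x), S u L) \<in> closed_generation (strict_desc x)" if "0 \<le> u" for u
    using S_closed_generation[OF closed_strict_desc that majL(2,3,1)] .
  have majLU: "(Maj x, L) \<in> closed_generation UNIV" using majL(1) closed_generation_mono by blast
  interpret b: bounded_bilinear "bmul :: 'v obs \<Rightarrow> _" by (rule bounded_bilinear_bmul)
  let ?F = "\<lambda>s. bmul (chi x) (S (t - s) (Maj x))"
  have F: "(?F has_vector_derivative - bmul (chi x) (S (t - s) L)) (at s within {0..t})"
  proof -
    have "((\<lambda>u. S u (Maj x)) has_vector_derivative S (t - s) L) (at (t - s) within {0..t})"
      using s by (intro HY.S_has_vector_derivative[OF majLU]) auto
    moreover have "((-) t has_vector_derivative -1) (at s within {0..t})"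
      by (auto intro!: derivative_eq_intros)
    moreover have "(-) t ` {0..t} = {0..t}" by (auto simp: image_iff intro!: bexI[of _ "t - _"])
    ultimately have "(((\<lambda>u. S u (Maj x)) \<circ> (-) t) has_vector_derivative (-1) *\<^sub>R S (t - s) L) (at s within {0..t})"
      by (intro vector_diff_chain_within) auto
    then have "((\<lambda>s. S (t - s) (Maj x)) has_vector_derivative - S (t - s) L) (at s within {0..t})"
      by (simp add: o_def)
    from bounded_linear.has_vector_derivative[OF b.bounded_linear_right this, of "chi x"] show ?thesis
      by (simp add: b.minus_right)
  qed
  \<comment> \<open>The evolved majority depends only on strict descendants of \<open>x\<close>, so
    the two factors live on disjoint sets.\<close>
  have G: "(?F s, bmul (Maj x - chi x) (S (t - s) (Maj x)) + bmul (chi x) (S (t - s) L)) \<in> closed_generation UNIV"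
    using notin_strict_desc s by (intro closed_generation_product[OF chi_closed_generation AD1]) auto
  have "((\<lambda>s. S s (?F s)) has_vector_derivative
      S s (bmul (Maj x - chi x) (S (t - s) (Maj x)) + bmul (chi x) (S (t - s) L) + - bmul (chi x) (S (t - s) L))) (at s within {0..t})"
    using s by (intro HY.S_has_vector_derivative_compose[OF F G]) auto
  then have "((\<lambda>s. S s (?F s)) has_vector_derivative S s (bmul (Maj x - chi x) (S (t - s) (Maj x)))) (at s within {0..t})"
    by simp
  from bounded_linear.has_vector_derivative[OF m0_bounded_linear this]
  have "((\<lambda>s. corr_maj x s t) has_vector_derivative mean_at s (bmul (Maj x - chi x) (S (t - s) (Maj x)))) (at s within {0..t})"
    by (simp add: corr_maj_def mean_at_def)
  moreover have "mean_at s (bmul (Maj x - chi x) (S (t - s) (Maj x))) = corr_maj_maj x s t - corr_maj x s t"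
    using mean_at_bounded_linear[of s] s by (simp add: b.diff_left linear_simps corr_maj_maj_def corr_maj_def)
  ultimately show ?thesis by simp
qed

text \<open>Under the initial coins \<open>x\<close> is independent of its strict descendants, on
  which the evolved majority depends.\<close>

lemma corr_maj_0:
  assumes "0 \<le> t" shows "corr_maj x 0 t = 0"
proof -
  have "S t (Maj x) \<in> obs_on (strict_desc x)"
    using obs_on_Maj obs_on_mono[OF kids_strict_desc] by (intro S_obs_on closed_strict_desc assms) auto
  then have "m0 (bmul (chi x) (S t (Maj x))) = m0 (chi x) * m0 (S t (Maj x))"
    using obs_on_chi notin_strict_desc by (intro m0_product[of _ "{x}" _ "strict_desc x"]) auto
  moreover have "m0 (chi x) = 0" using mean_at_chi_zero[of 0 x] by (simp add: mean_at_def)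
  ultimately show ?thesis by (simp add: corr_maj_def mean_at_def)
qed

text \<open>With \<open>a = 1/10\<close> the coefficients are \<open>15/22 = 3/(4(1 + a))\<close> and \<open>5/26 = 1/(4(1 + 3a))\<close>; their sum is below \<open>1 - a\<close>,
  which is what closes the bootstrap.\<close>

definition mixed_bound :: "real \<Rightarrow> real \<Rightarrow> real \<Rightarrow> real" where
  "mixed_bound d s t = 15 / 22 * exp (- (t - s) / 10) + 5 / 26 * exp (- 3 * (t - s) / 10) + 3 / 4 * d * exp (s + t)"

lemma correlation_step:
  assumes d: "0 \<le> d"
    and p: "\<And>x s t. 0 \<le> s \<Longrightarrow> s \<le> t \<Longrightarrow> \<bar>corr_self x s t\<bar> \<le> exp (- (t - s) / 10) + d * exp (s + t)"
    and st: "0 \<le> s" "s \<le> t"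
  shows "\<bar>corr_maj x s t\<bar> \<le> mixed_bound d s t" and "\<bar>corr_self x s t\<bar> \<le> exp (- (t - s) / 10) + 3 / 8 * d * exp (s + t)"
proof -
  have r: "\<bar>corr_maj_maj x s t\<bar> \<le> 3 / 4 * exp (- (t - s) / 10) + exp (- 3 * (t - s) / 10) / 4 + 3 / 2 * d * exp (s + t)"
    if st: "0 \<le> s" "s \<le> t" for s t x
  proof -
    obtain a b c where k: "kids x = {a, b, c}" "a \<noteq> b" "a \<noteq> c" "b \<noteq> c" by (rule kids_three)
    \<comment> \<open>The cap at 1, justified by \<open>corr_self_le_1\<close>, confines the cubic
      to the interval on which its slope is at most \<open>3/2\<close>.\<close>
    define \<beta> where "\<beta> = min 1 (exp (- (t - s) / 10) + d * exp (s + t))"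
    have pb: "\<bar>corr_self y s t\<bar> \<le> \<beta>" for y using p[OF st] corr_self_le_1[OF st] by (simp add: \<beta>_def)
    have b0: "0 \<le> \<beta>" using pb[of a] by linarith
    have "\<bar>corr_self a s t * corr_self b s t * corr_self c s t\<bar> \<le> \<beta> * \<beta> * \<beta>"
      unfolding abs_mult using pb b0 by (intro mult_mono) auto
    then have "\<bar>corr_maj_maj x s t\<bar> \<le> (3 * \<beta> + \<beta> ^ 3) / 4"
      unfolding corr_maj_maj_formula[OF k st] power3_eq_cube using pb[of a] pb[of b] pb[of c] by (simp add: abs_le_iff)
    also have "\<dots> \<le> 3 / 4 * exp (- (t - s) / 10) + exp (- (t - s) / 10) ^ 3 / 4 + 3 / 2 * (d * exp (s + t))"
      by (rule cubic_bound) (use st d b0 in \<open>auto simp: \<beta>_def\<close>)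
    also have "exp (- (t - s) / 10) ^ 3 = exp (- 3 * (t - s) / 10)"
      by (subst exp_of_nat_mult[symmetric]) (simp add: algebra_simps)
    finally show ?thesis by simp
  qed
  have q: "\<bar>corr_maj x s t\<bar> \<le> mixed_bound d s t" if st: "0 \<le> s" "s \<le> t" for s t
  proof (rule abs_le_comparison[where a = 0 and b = s and y = "\<lambda>s. corr_maj x s t" and Y = "\<lambda>s. mixed_bound d s t" and f = "\<lambda>s. corr_maj_maj x s t"
      and Y' = "\<lambda>s. 15 / 22 * (exp (- (t - s) / 10) * (1 / 10)) + 5 / 26 * (exp (- 3 * (t - s) / 10) * (3 / 10)) + 3 / 4 * d * exp (s + t)"])
    fix u assume u: "u \<in> {0..s}"
    have "((\<lambda>s. corr_maj x s t) has_vector_derivative corr_maj_maj x u t - corr_maj x u t) (at u within {0..t})"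
      using u st by (intro corr_maj_derivative) auto
    then show "((\<lambda>s. corr_maj x s t) has_vector_derivative corr_maj_maj x u t - corr_maj x u t) (at u within {0..s})"
      by (rule has_vector_derivative_within_subset) (use st in auto)
    show "((\<lambda>s. mixed_bound d s t) has_real_derivative 15 / 22 * (exp (- (t - u) / 10) * (1 / 10)) + 5 / 26 * (exp (- 3 * (t - u) / 10) * (3 / 10)) + 3 / 4 * d * exp (u + t)) (at u)"
      unfolding mixed_bound_def by (auto intro!: derivative_eq_intros)
    have "\<bar>corr_maj_maj x u t\<bar> \<le> 3 / 4 * exp (- (t - u) / 10) + exp (- 3 * (t - u) / 10) / 4 + 3 / 2 * d * exp (u + t)"
      using u st by (intro r) auto
    \<comment> \<open>The term with \<open>exp (u + t)\<close> is its own derivative in either time,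
      so \<open>Y' + Y\<close> doubles it. Hence \<open>3/2 d\<close> on the left needs only
      \<open>3/4 d\<close> here, and \<open>3/8 d\<close> in the second comparison.\<close>
    also have "\<dots> = 15 / 22 * (exp (- (t - u) / 10) * (1 / 10)) + 5 / 26 * (exp (- 3 * (t - u) / 10) * (3 / 10)) + 3 / 4 * d * exp (u + t) + mixed_bound d u t"
      by (simp add: mixed_bound_def)
    finally show "\<bar>corr_maj_maj x u t\<bar> \<le> \<dots>" .
  next
    show "\<bar>corr_maj x 0 t\<bar> \<le> mixed_bound d 0 t" using d st by (simp add: corr_maj_0 mixed_bound_def)
  qed (use st in auto)
  show "\<bar>corr_maj x s t\<bar> \<le> mixed_bound d s t" by (rule q[OF st])
  show "\<bar>corr_self x s t\<bar> \<le> exp (- (t - s) / 10) + 3 / 8 * d * exp (s + t)"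
  proof (rule abs_le_comparison[where a = s and b = t and y = "corr_self x s" and Y = "\<lambda>t. exp (- (t - s) / 10) + 3 / 8 * d * exp (s + t)" and f = "\<lambda>t. corr_maj x s t"
      and Y' = "\<lambda>t. exp (- (t - s) / 10) * (- 1 / 10) + 3 / 8 * d * exp (s + t)"])
    fix u assume u: "u \<in> {s..t}"
    show "(corr_self x s has_vector_derivative corr_maj x s u - corr_self x s u) (at u within {s..t})"
      using u st by (intro corr_self_derivative) auto
    show "((\<lambda>t. exp (- (t - s) / 10) + 3 / 8 * d * exp (s + t)) has_real_derivative exp (- (u - s) / 10) * (- 1 / 10) + 3 / 8 * d * exp (s + u)) (at u)"
      by (auto intro!: derivative_eq_intros)
    have Q: "15 / 22 * e1 + 5 / 26 * e3 + 3 / 4 * d * e2 \<le> e1 * (- 1 / 10) + 3 / 8 * d * e2 + (e1 + 3 / 8 * d * e2)"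
      if "e3 \<le> e1" "0 \<le> e1" for e1 e2 e3 :: real
      using that by (simp add: field_simps)
    have "mixed_bound d s u \<le> exp (- (u - s) / 10) * (- 1 / 10) + 3 / 8 * d * exp (s + u) + (exp (- (u - s) / 10) + 3 / 8 * d * exp (s + u))"
      unfolding mixed_bound_def by (rule Q) (use u in auto)
    then show "\<bar>corr_maj x s u\<bar> \<le> exp (- (u - s) / 10) * (- 1 / 10) + 3 / 8 * d * exp (s + u) + (exp (- (u - s) / 10) + 3 / 8 * d * exp (s + u))"
      using q[of s u] u st by simp
  next
    show "\<bar>corr_self x s s\<bar> \<le> exp (- (s - s) / 10) + 3 / 8 * d * exp (s + s)" using st d by (simp add: corr_self_refl)
  qed (use st in auto)
qed

text \<open>The start is \<open>d = 1\<close>, since a correlation is at most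
  \<open>1 \<le> exp (s + t)\<close>. For fixed times the exponential stays put while the powers of
  \<open>3/8\<close> vanish.\<close>

lemma correlation_iterate:
  "0 \<le> s \<Longrightarrow> s \<le> t \<Longrightarrow> \<bar>corr_self x s t\<bar> \<le> exp (- (t - s) / 10) + (3 / 8) ^ n * exp (s + t)"
proof (induction n arbitrary: x s t)
  case 0
  have "\<bar>corr_self x s t\<bar> \<le> 1" using 0 by (rule corr_self_le_1)
  also have "1 \<le> exp (s + t)" using 0 by simp
  finally show ?case by (simp add: add_increasing)
next
  case (Suc n)
  show ?case using correlation_step(2)[of "(3 / 8) ^ n" s t x, OF _ Suc.IH Suc.prems] by simp
qed

lemma corr_self_bound:
  assumes "0 \<le> s" "s \<le> t" shows "\<bar>corr_self x s t\<bar> \<le> exp (- (t - s) / 10)"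
proof (rule tendsto_lowerbound)
  show "(\<lambda>n. exp (- (t - s) / 10) + (3 / 8) ^ n * exp (s + t)) \<longlonglongrightarrow> exp (- (t - s) / 10)"
    by (auto intro!: tendsto_eq_intros LIMSEQ_power_zero)
qed (use correlation_iterate[OF assms] in auto)

text \<open>At equal times the limiting bound is \<open>15/22 + 5/26 = 125/143\<close>, just below
  \<open>7/8\<close>.\<close>

lemma corr_maj_diag_bound:
  assumes "0 \<le> s" shows "\<bar>corr_maj x s s\<bar> \<le> 7 / 8"
proof -
  have "\<bar>corr_maj x s s\<bar> \<le> 15 / 22 + 5 / 26"
  proof (rule tendsto_lowerbound)
    show "(\<lambda>n. 15 / 22 + 5 / 26 + 3 / 4 * (3 / 8) ^ n * exp (s + s)) \<longlonglongrightarrow> 15 / 22 + 5 / 26"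
      by (auto intro!: tendsto_eq_intros LIMSEQ_power_zero)
    have "\<bar>corr_maj x s s\<bar> \<le> mixed_bound ((3 / 8) ^ n) s s" for n
      by (rule correlation_step(1)) (use correlation_iterate assms in auto)
    then show "\<forall>\<^sub>F n in sequentially. \<bar>corr_maj x s s\<bar> \<le> 15 / 22 + 5 / 26 + 3 / 4 * (3 / 8) ^ n * exp (s + s)"
      by (simp add: mixed_bound_def)
  qed simp
  then show ?thesis by simp
qed

end

section \<open>The stationary state\<close>

text \<open>Tychonoff's theorem for the box of functionals bounded by \<open>N\<close>. A filter
  takes the place of a subsequence, since a product over all observables need not be sequentially
  compact; \<open>F\<close> inherits whatever holds eventually along the sequence.\<close>

lemma functional_cluster_point:
  fixes \<phi> :: "nat \<Rightarrow> 'a \<Rightarrow> real" and N :: "'a \<Rightarrow> real"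
  assumes "\<And>n f. \<bar>\<phi> n f\<bar> \<le> N f"
  obtains m F where "F \<noteq> bot" "\<And>f. ((\<lambda>\<psi>. \<psi> f) \<longlongrightarrow> m f) F"
    "\<And>P. eventually (\<lambda>n. P (\<phi> n)) sequentially \<Longrightarrow> eventually P F"
proof -
  define K where "K = Pi\<^sub>E UNIV (\<lambda>f. {- N f .. N f})"
  have "compactin (product_topology (\<lambda>_. euclidean) UNIV) K"
    unfolding K_def compactin_PiE by simp
  then have "compact K" by (simp add: euclidean_product_topology)
  have phiK: "\<phi> n \<in> K" for n using assms by (auto simp: K_def abs_le_iff minus_le_iff)
  define G where "G = filtermap \<phi> sequentially"
  have "G \<noteq> bot" "eventually (\<lambda>x. x \<in> K) G" by (auto simp: G_def filtermap_bot_iff eventually_filtermap phiK)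
  then obtain m where m: "inf (nhds m) G \<noteq> bot" using \<open>compact K\<close> unfolding compact_filter by blast
  show ?thesis
  proof (rule that[OF m])
    fix f
    have "continuous_on UNIV (\<lambda>\<psi> :: 'a \<Rightarrow> real. \<psi> f)" by simp
    then have "((\<lambda>\<psi>. \<psi> f) \<longlongrightarrow> m f) (at m)" by (simp add: continuous_on_def)
    then have "((\<lambda>\<psi>. \<psi> f) \<longlongrightarrow> m f) (nhds m)"
      using tendsto_at_iff_tendsto_nhds[of "\<lambda>\<psi> :: 'a \<Rightarrow> real. \<psi> f" m] by blast
    then show "((\<lambda>\<psi>. \<psi> f) \<longlongrightarrow> m f) (inf (nhds m) G)"
      by (rule tendsto_mono[rotated]) simp
  next
    fix P assume "eventually (\<lambda>n. P (\<phi> n)) sequentially"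
    then have "eventually P G" by (simp add: G_def eventually_filtermap)
    then show "eventually P (inf (nhds m) G)" by (rule filter_leD[rotated]) simp
  qed
qed

lemma continuous_integral_bound:
  fixes f :: "real \<Rightarrow> real"
  assumes "a \<le> b" "continuous_on {a..b} f" "\<And>u. u \<in> {a..b} \<Longrightarrow> f u \<le> c"
  shows "integral {a..b} f \<le> c * (b - a)"
proof -
  have "integral {a..b} f \<le> integral {a..b} (\<lambda>_. c)"
    using assms by (intro integral_le integrable_continuous_real) auto
  then show ?thesis using assms(1) by (simp add: mult.commute)
qed

section \<open>Products and indicators as observables\<close>

definition bprod :: "('i \<Rightarrow> 's::topological_space \<Rightarrow>\<^sub>C real) \<Rightarrow> 'i set \<Rightarrow> ('s \<Rightarrow>\<^sub>C real)" where
  "bprod F A = Finite_Set.fold (\<lambda>i. bmul (F i)) (const_bcontfun 1) A"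

lemma bprod_empty [simp]: "bprod F {} = const_bcontfun 1"
  by (simp add: bprod_def)

lemma bprod_insert: "finite A \<Longrightarrow> i \<notin> A \<Longrightarrow> bprod F (insert i A) = bmul (F i) (bprod F A)"
proof -
  interpret comp_fun_commute "\<lambda>i. bmul (F i)"
    by unfold_locales (auto intro!: bcontfun_eqI simp: apply_bmul)
  show "finite A \<Longrightarrow> i \<notin> A \<Longrightarrow> bprod F (insert i A) = bmul (F i) (bprod F A)"
    by (simp add: bprod_def)
qed

lemma apply_bprod: "finite A \<Longrightarrow> apply_bcontfun (bprod F A) \<omega> = (\<Prod>i\<in>A. apply_bcontfun (F i) \<omega>)"
  by (induction A rule: finite_induct) (auto simp: bprod_insert apply_bmul const_bcontfun.rep_eq)

lemma obs_on_bprod: "finite A \<Longrightarrow> (\<And>i. i \<in> A \<Longrightarrow> F i \<in> obs_on D) \<Longrightarrow> bprod F A \<in> obs_on D"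
  by (induction A rule: finite_induct) (auto simp: bprod_insert obs_on_const intro: obs_on_bmul)

definition ind :: "'v \<Rightarrow> bool \<Rightarrow> 'v obs" where
  "ind x b = Bcontfun (\<lambda>\<omega>. if \<omega> x = b then 1 else 0)"

lemma apply_ind: "apply_bcontfun (ind x b) \<omega> = (if \<omega> x = b then 1 else 0)"
proof -
  have "dep {x} (\<lambda>\<omega>. if \<omega> x = b then 1 else 0 :: real)" by (auto simp: dep_def)
  from apply_dep[OF _ this] show ?thesis by (simp add: ind_def)
qed

lemma obs_on_ind: "ind x b \<in> obs_on {x}"
  by (rule obs_on_I) (simp add: apply_ind)

text \<open>The stationary law appears as a positive functional. Apart from invariance under
  \<open>S\<close>, which averaging supplies, each condition concerns expectations that obey it at
  every time. The independence of agreements over a layer is weakened to the bound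
  \<open>m_agree\<close>, which averages retain.\<close>

locale stationary_state = layered_tree +
  fixes m :: "'a obs \<Rightarrow> real"
  assumes m_linear: "linear m"
    and m_norm: "\<And>f. \<bar>m f\<bar> \<le> norm f"
    and m_one: "m one = 1"
    and m_pos: "\<And>f. (\<And>\<omega>. 0 \<le> apply_bcontfun f \<omega>) \<Longrightarrow> 0 \<le> m f"
    and m_S: "\<And>t f. 0 \<le> t \<Longrightarrow> m (S t f) = m f"
    and m_automorphism: "\<And>\<phi> f g. automorphism E \<phi> \<Longrightarrow>
          (\<And>\<omega>. apply_bcontfun g \<omega> = apply_bcontfun f (\<omega> \<circ> \<phi>)) \<Longrightarrow> m g = m f"
    and m_layer: "\<And>A k b. finite A \<Longrightarrow> A \<subseteq> V k \<Longrightarrow> m (bprod (\<lambda>x. ind x (b x)) A) = (1 / 2) ^ card A"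
    and m_agree: "\<And>A k F. finite A \<Longrightarrow> A \<subseteq> V k \<Longrightarrow>
          (\<And>x \<omega>. apply_bcontfun (F x) \<omega> = (if \<omega> x = majority E \<omega> x then 1 else 0)) \<Longrightarrow> m (bprod F A) \<le> (15 / 16) ^ card A"
    and m_correlation: "\<And>x t. 0 \<le> t \<Longrightarrow> \<bar>m (bmul (chi x) (S t (chi x)))\<bar> \<le> exp (- t / 10)"

context layered_tree
begin

section \<open>Automorphisms and layer products at a fixed time\<close>

lemma automorphism_kids:
  assumes "automorphism E \<phi>" shows "kids (\<phi> x) = \<phi> ` kids x"
proof (intro equalityI subsetI)
  fix z assume "z \<in> kids (\<phi> x)"
  moreover obtain y where "z = \<phi> y" using assms by (metis automorphism_def bij_pointE)
  ultimately show "z \<in> \<phi> ` kids x" using assms by (auto simp: automorphism_def children_def)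
qed (use assms in \<open>auto simp: automorphism_def children_def\<close>)

lemma automorphism_majority:
  assumes "automorphism E \<phi>" shows "majority E (\<omega> \<circ> \<phi>) x = majority E \<omega> (\<phi> x)"
proof -
  have inj: "inj \<phi>" using assms by (simp add: automorphism_def bij_is_inj)
  have "card {z \<in> kids (\<phi> x). P z} = card {z \<in> kids x. P (\<phi> z)}" for P
  proof -
    have "{z \<in> kids (\<phi> x). P z} = \<phi> ` {z \<in> kids x. P (\<phi> z)}" by (auto simp: automorphism_kids[OF assms])
    then show ?thesis using inj by (simp add: card_image inj_on_subset)
  qed
  then show ?thesis by (simp add: majority_def)
qed

lemma S_automorphism:
  assumes "automorphism E \<phi>" "0 \<le> t" "\<And>\<omega>. apply_bcontfun g \<omega> = apply_bcontfun f (\<omega> \<circ> \<phi>)"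
  shows "apply_bcontfun (S t g) \<omega> = apply_bcontfun (S t f) (\<omega> \<circ> \<phi>)"
proof (rule S_symmetry[where \<phi> = \<phi> and \<theta> = "\<lambda>\<omega>. \<omega> \<circ> \<phi>"])
  show inj: "inj \<phi>" using assms(1) by (simp add: automorphism_def bij_is_inj)
  show "continuous_on UNIV (\<lambda>\<omega> :: 'v \<Rightarrow> bool. \<omega> \<circ> \<phi>)"
    by (rule continuous_on_coordinatewise_then_product) simp
  show "update E \<omega> (\<phi> x) \<circ> \<phi> = update E (\<omega> \<circ> \<phi>) x" for \<omega> x
    using inj by (auto simp: update_def fun_eq_iff automorphism_majority[OF assms(1)] inj_eq)
qed (use assms in auto)

lemma mean_at_layer_product:
  assumes s: "0 \<le> s" and A: "finite A" "A \<subseteq> V k" and F: "\<And>x. x \<in> A \<Longrightarrow> F x \<in> obs_on (desc x)"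
  shows "mean_at s (bprod F A) = (\<Prod>x\<in>A. mean_at s (F x))"
  using A F
proof (induction A rule: finite_induct)
  case (insert x A)
  have obs_on: "bprod F A \<in> obs_on (\<Union>y\<in>A. desc y)"
  proof (rule obs_on_bprod[OF insert.hyps(1)])
    fix i assume "i \<in> A"
    then show "F i \<in> obs_on (\<Union>y\<in>A. desc y)" using insert.prems obs_on_mono[of "desc i" "\<Union>y\<in>A. desc y"] by blast
  qed
  have dis: "desc x \<inter> (\<Union>y\<in>A. desc y) = {}"
  proof -
    have "desc x \<inter> desc y = {}" if "y \<in> A" for y
    proof (rule desc_disjoint)
      show "ht x = ht y" using insert.prems(1) that ht_iff by (metis insert_subset subsetD)
      show "x \<noteq> y" using insert.hyps that by blast
    qed
    then show ?thesis by blast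
  qed
  have "mean_at s (bprod F (insert x A)) = mean_at s (F x) * mean_at s (bprod F A)"
    unfolding bprod_insert[OF insert.hyps]
    by (rule mean_at_product[OF closed_desc closed_UN dis _ obs_on s]) (auto intro: closed_desc insert.prems)
  then show ?case using insert by simp
qed (simp add: mean_at_one s)

lemma mean_at_ind: "0 \<le> s \<Longrightarrow> mean_at s (ind x b) = 1 / 2"
proof -
  assume s: "0 \<le> s"
  have "ind x b = (1 / 2) *\<^sub>R (one + sgn_of b *\<^sub>R chi x)"
    by (rule bcontfun_eqI) (simp add: apply_ind apply_chi scaleR_bcontfun.rep_eq plus_bcontfun.rep_eq const_bcontfun.rep_eq sgn_of_def)
  then show ?thesis using mean_at_bounded_linear[OF s] by (simp add: linear_simps mean_at_one s mean_at_chi_zero)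
qed

text \<open>The indicator of agreement is half of one plus the product of \<open>chi x\<close> and
  \<open>Maj x\<close>, so its mean is at most \<open>(1 + 7/8) / 2 = 15/16\<close>.\<close>

lemma mean_at_agree:
  assumes s: "0 \<le> s" and f: "\<And>\<omega>. apply_bcontfun f \<omega> = (if \<omega> x = majority E \<omega> x then 1 else 0)"
  shows "f \<in> obs_on (desc x)" "0 \<le> mean_at s f" "mean_at s f \<le> 15 / 16"
proof -
  have eq: "f = (1 / 2) *\<^sub>R (one + bmul (chi x) (Maj x))"
    by (rule bcontfun_eqI) (simp add: f apply_bmul apply_chi apply_Maj scaleR_bcontfun.rep_eq plus_bcontfun.rep_eq const_bcontfun.rep_eq sgn_of_def)
  have "kids x \<subseteq> desc x"
  proof
    fix z assume "z \<in> kids x"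
    then have "(par ^^ 1) z = x" by (simp add: kids_iff)
    then show "z \<in> desc x" unfolding desc_def by blast
  qed
  then show "f \<in> obs_on (desc x)"
    unfolding eq using obs_on_chi[of x] obs_on_Maj[of x] obs_on_mono[of "{x}" "desc x"] obs_on_mono[of "kids x" "desc x"]
    by (intro obs_on_scale obs_on_add obs_on_bmul obs_on_const) auto
  have "mean_at s f = (1 + corr_maj x s s) / 2"
    unfolding eq using mean_at_bounded_linear[OF s] by (simp add: linear_simps mean_at_one s corr_maj_def)
  then show "0 \<le> mean_at s f" "mean_at s f \<le> 15 / 16" using corr_maj_diag_bound[OF s, of x] by (auto simp: abs_le_iff)
qed

lemma mean_at_continuous: "continuous_on {0..} (\<lambda>u. mean_at u f)"
proof -
  have "continuous_on {0..} (\<lambda>u. m0 (S u f))"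
    by (rule continuous_on_compose2[OF linear_continuous_on[OF m0_bounded_linear] HY.S_continuous_time]) auto
  then show ?thesis by (simp add: mean_at_def)
qed

lemma mean_at_automorphism:
  assumes "automorphism E \<phi>" "0 \<le> u" "\<And>\<omega>. apply_bcontfun g \<omega> = apply_bcontfun f (\<omega> \<circ> \<phi>)"
  shows "mean_at u g = mean_at u f"
  unfolding mean_at_def
proof (rule m0_symmetry[of \<phi> _ _ True])
  show "inj \<phi>" using assms(1) by (simp add: automorphism_def bij_is_inj)
  show "apply_bcontfun (S u g) \<omega> = apply_bcontfun (S u f) (\<lambda>x. \<omega> (\<phi> x) = True)" for \<omega>
    using S_automorphism[OF assms] by (simp add: o_def)
qed

lemma stationary_state_exists: "\<exists>m. stationary_state E r V m"
proof -
  define \<phi> where "\<phi> n f = integral {0..real (Suc n)} (\<lambda>u. mean_at u f) / real (Suc n)" for n f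
  have cont: "continuous_on {a..b} (\<lambda>u. mean_at u f)" if "0 \<le> a" for a b f
    using mean_at_continuous by (rule continuous_on_subset) (use that in auto)
  have int: "(\<lambda>u. mean_at u f) integrable_on {a..b}" if "0 \<le> a" for a b f
    using cont[OF that] by (rule integrable_continuous_real)
  have phi_le: "\<phi> n f \<le> c" if "\<And>u. 0 \<le> u \<Longrightarrow> mean_at u f \<le> c" for n f c
    using continuous_integral_bound[OF _ cont, of 0 "real (Suc n)" f c] that
    by (simp add: \<phi>_def divide_le_eq)
  have phi_add: "\<phi> n (f + g) = \<phi> n f + \<phi> n g" for n f g
  proof -
    have "integral {0..real (Suc n)} (\<lambda>u. mean_at u (f + g)) = integral {0..real (Suc n)} (\<lambda>u. mean_at u f + mean_at u g)"
      by (rule integral_cong) (use mean_at_bounded_linear in \<open>simp add: linear_simps\<close>)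
    also have "\<dots> = integral {0..real (Suc n)} (\<lambda>u. mean_at u f) + integral {0..real (Suc n)} (\<lambda>u. mean_at u g)"
      by (intro integral_add int) auto
    finally show ?thesis by (simp add: \<phi>_def add_divide_distrib)
  qed
  have phi_scale: "\<phi> n (c *\<^sub>R f) = c * \<phi> n f" for n c f
  proof -
    have "integral {0..real (Suc n)} (\<lambda>u. mean_at u (c *\<^sub>R f)) = integral {0..real (Suc n)} (\<lambda>u. c * mean_at u f)"
      by (rule integral_cong) (use mean_at_bounded_linear in \<open>simp add: linear_simps\<close>)
    then show ?thesis by (simp add: \<phi>_def)
  qed
  have phi_neg: "\<phi> n (- f) = - \<phi> n f" for n f using phi_scale[of n "-1" f] by simp
  have phi_norm: "\<bar>\<phi> n f\<bar> \<le> norm f" for n f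
  proof -
    have le: "mean_at u f \<le> norm f" "mean_at u (- f) \<le> norm f" if "0 \<le> u" for u f
      using mean_at_norm[OF that, of f] mean_at_norm[OF that, of "- f"] by auto
    show ?thesis using phi_le[of f "norm f" n] phi_le[of "- f" "norm f" n] le by (simp add: abs_le_iff phi_neg)
  qed
  have phi_S: "\<bar>\<phi> n (S t f) - \<phi> n f\<bar> \<le> 2 * t * norm f / real (Suc n)" if t: "0 \<le> t" for n t f
  proof -
    let ?N = "real (Suc n)" and ?I = "\<lambda>a b. integral {a..b} (\<lambda>u. mean_at u f)"
    have "integral {0..?N} (\<lambda>u. mean_at u (S t f)) = integral {0..?N} (\<lambda>u. mean_at (u + t) f)"
      by (rule integral_cong) (use t in \<open>simp add: mean_at_add_time\<close>)
    also have "\<dots> = ?I t (?N + t)"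
      using integral_shift_Icc_real[of 0 ?N "\<lambda>u. mean_at u f" t] by (simp add: add.commute o_def)
    finally have 1: "integral {0..?N} (\<lambda>u. mean_at u (S t f)) = ?I t (?N + t)" .
    \<comment> \<open>The integrals over \<open>[t, N + t]\<close> and \<open>[0, N]\<close> differ
      by those over two end pieces of length \<open>t\<close>, each at most
      \<open>t norm f\<close>.\<close>
    have 2: "?I 0 t + ?I t (?N + t) = ?I 0 (?N + t)"
      using t by (intro Henstock_Kurzweil_Integration.integral_combine int) auto
    have 3: "?I 0 ?N + ?I ?N (?N + t) = ?I 0 (?N + t)"
      using t by (intro Henstock_Kurzweil_Integration.integral_combine int) auto
    have b: "\<bar>?I a (a + t)\<bar> \<le> t * norm f" if "0 \<le> a" for a
    proof -
      have "norm (?I a (a + t)) \<le> norm f * ((a + t) - a)"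
        using that t mean_at_norm by (intro integral_bound cont) auto
      then show ?thesis by (simp add: mult.commute)
    qed
    have "\<bar>?I t (?N + t) - ?I 0 ?N\<bar> \<le> 2 * t * norm f"
      using 2 3 b[of 0] b[of ?N] by simp
    then have "\<bar>?I t (?N + t) - ?I 0 ?N\<bar> / ?N \<le> 2 * t * norm f / ?N" by (intro divide_right_mono) auto
    then show ?thesis unfolding \<phi>_def 1 diff_divide_distrib[symmetric] abs_divide by simp
  qed
  obtain m F where F: "F \<noteq> bot" and lim: "\<And>f. ((\<lambda>\<psi>. \<psi> f) \<longlongrightarrow> m f) F"
    and ev: "\<And>P. eventually (\<lambda>n. P (\<phi> n)) sequentially \<Longrightarrow> eventually P F"
    using functional_cluster_point[of \<phi> norm] phi_norm by metis
  have m_eq: "m f = a" if "\<And>n. \<phi> n f = a" for f a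
  proof -
    have "eventually (\<lambda>\<psi>. \<psi> f = a) F" by (rule ev) (simp add: that)
    then have "((\<lambda>\<psi>. \<psi> f) \<longlongrightarrow> a) F" by (rule tendsto_eventually)
    with lim[of f] show ?thesis using F tendsto_unique by blast
  qed
  have m_le: "m f \<le> c" if "\<And>u. 0 \<le> u \<Longrightarrow> mean_at u f \<le> c" for f c
  proof (rule tendsto_upperbound[OF lim _ F])
    show "eventually (\<lambda>\<psi>. \<psi> f \<le> c) F" by (rule ev) (simp add: phi_le that)
  qed
  have m_add: "m (f + g) = m f + m g" for f g
  proof -
    have "eventually (\<lambda>\<psi>. \<psi> f + \<psi> g = \<psi> (f + g)) F" by (rule ev) (simp add: phi_add)
    from Lim_transform_eventually[OF tendsto_add[OF lim lim] this] lim[of "f + g"] show ?thesis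
      using F tendsto_unique by blast
  qed
  have m_scale: "m (c *\<^sub>R f) = c * m f" for c f
  proof -
    have "eventually (\<lambda>\<psi>. c * \<psi> f = \<psi> (c *\<^sub>R f)) F" by (rule ev) (simp add: phi_scale)
    from Lim_transform_eventually[OF tendsto_mult_left[OF lim] this] lim[of "c *\<^sub>R f"] show ?thesis
      using F tendsto_unique by blast
  qed
  have m_neg: "m (- f) = - m f" for f using m_scale[of "-1" f] by simp
  have mean_at_neg: "mean_at u (- f) = - mean_at u f" if "0 \<le> u" for u f
    using mean_at_bounded_linear[OF that] by (rule linear_neg[OF bounded_linear.linear])
  \<comment> \<open>Upper bounds valid at all times pass to the averages and to the limit point;
    applied to \<open>f\<close> and \<open>- f\<close> they give equalities.\<close>
  have m_const: "m f = c" if "\<And>u. 0 \<le> u \<Longrightarrow> mean_at u f = c" for f c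
    using m_le[of f c] m_le[of "- f" "- c"] that by (simp add: mean_at_neg m_neg)
  have m_abs: "\<bar>m f\<bar> \<le> c" if "\<And>u. 0 \<le> u \<Longrightarrow> \<bar>mean_at u f\<bar> \<le> c" for f c
    using m_le[of f c] m_le[of "- f" "c"] that by (simp add: mean_at_neg m_neg abs_le_iff)
  have "stationary_state E r V m"
  proof (intro stationary_state.intro stationary_state_axioms.intro layered_tree_axioms)
    show "linear m" by (rule linearI) (auto simp: m_add m_scale)
    show "\<bar>m f\<bar> \<le> norm f" for f by (rule m_abs) (rule mean_at_norm)
    show "m one = 1" by (rule m_const) (rule mean_at_one)
    show "0 \<le> m f" if "\<And>\<omega>. 0 \<le> apply_bcontfun f \<omega>" for f
    proof -
      have "m (- f) \<le> 0" 
      proof (rule m_le)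
        fix u :: real assume u: "0 \<le> u"
        have "0 \<le> mean_at u f" unfolding mean_at_def by (intro m0_pos S_pos u that)
        then show "mean_at u (- f) \<le> 0" by (simp add: mean_at_neg u)
      qed
      then show ?thesis by (simp add: m_neg)
    qed
    show "m (S t f) = m f" if t: "0 \<le> t" for t f
    proof -
      have "\<bar>m (S t f) - m f\<bar> \<le> e" if e: "0 < e" for e
      proof (rule tendsto_upperbound[OF _ _ F])
        show "((\<lambda>\<psi>. \<bar>\<psi> (S t f) - \<psi> f\<bar>) \<longlongrightarrow> \<bar>m (S t f) - m f\<bar>) F" by (intro tendsto_intros lim)
        have "(\<lambda>n. 2 * t * norm f / real (Suc n)) \<longlonglongrightarrow> 0" by (intro LIMSEQ_Suc lim_const_over_n)
        then have "eventually (\<lambda>n. 2 * t * norm f / real (Suc n) < e) sequentially" using e by (rule order_tendstoD)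
        then have "eventually (\<lambda>n. \<bar>\<phi> n (S t f) - \<phi> n f\<bar> \<le> e) sequentially"
        proof eventually_elim
          case (elim n)
          then show ?case using phi_S[OF t, of n f] by linarith
        qed
        then show "eventually (\<lambda>\<psi>. \<bar>\<psi> (S t f) - \<psi> f\<bar> \<le> e) F" by (rule ev)
      qed
      from this[of "\<bar>m (S t f) - m f\<bar> / 2"] show ?thesis by auto
    qed
    show "m g = m f" if "automorphism E \<psi>" "\<And>\<omega>. apply_bcontfun g \<omega> = apply_bcontfun f (\<omega> \<circ> \<psi>)" for \<psi> f g
    proof -
      have "m (g - f) = 0"
      proof (rule m_const)
        fix u :: real assume u: "0 \<le> u"
        show "mean_at u (g - f) = 0"
          using mean_at_automorphism[OF that(1) u that(2)] mean_at_bounded_linear[OF u] by (simp add: linear_simps)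
      qed
      then show ?thesis using m_add[of "g - f" f] by simp
    qed
    show "m (bprod (\<lambda>x. ind x (b x)) A) = (1 / 2) ^ card A" if A: "finite A" "A \<subseteq> V k" for A k b
    proof (rule m_const)
      fix u :: real assume u: "0 \<le> u"
      have "mean_at u (bprod (\<lambda>x. ind x (b x)) A) = (\<Prod>x\<in>A. mean_at u (ind x (b x)))"
        by (rule mean_at_layer_product[OF u A]) (rule subsetD[OF obs_on_mono obs_on_ind], simp)
      then show "mean_at u (bprod (\<lambda>x. ind x (b x)) A) = (1 / 2) ^ card A" using u by (simp add: mean_at_ind)
    qed
    show "m (bprod G A) \<le> (15 / 16) ^ card A" if A: "finite A" "A \<subseteq> V k"
      and G: "\<And>x \<omega>. apply_bcontfun (G x) \<omega> = (if \<omega> x = majority E \<omega> x then 1 else 0)" for A k G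
    proof (rule m_le)
      fix u :: real assume u: "0 \<le> u"
      have "mean_at u (bprod G A) = (\<Prod>x\<in>A. mean_at u (G x))"
        by (rule mean_at_layer_product[OF u A]) (rule mean_at_agree(1)[OF u G])
      also have "\<dots> \<le> (\<Prod>x\<in>A. 15 / 16)" using mean_at_agree(2,3)[OF u G] by (intro prod_mono) auto
      finally show "mean_at u (bprod G A) \<le> (15 / 16) ^ card A" by simp
    qed
    show "\<bar>m (bmul (chi x) (S t (chi x)))\<bar> \<le> exp (- t / 10)" if t: "0 \<le> t" for x t
    proof (rule m_abs)
      fix u :: real assume u: "0 \<le> u"
      show "\<bar>mean_at u (bmul (chi x) (S t (chi x)))\<bar> \<le> exp (- t / 10)"
        using corr_self_bound[of u "u + t" x] u t by (simp add: corr_self_def)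
    qed
  qed
  then show ?thesis by blast
qed

end

section \<open>Finite-dimensional distributions\<close>

text \<open>\<open>W J b\<close> is the probability of the pattern \<open>b\<close> on
  \<open>J\<close>, with consistency asked for adding one index. Opinions are coded as the reals 0
  and 1, so that the projective limit theorem for Borel measures on Polish spaces applies, and are
  decoded afterwards.\<close>

lemma bool_kolmogorov_extension:
  fixes W :: "'i set \<Rightarrow> ('i \<Rightarrow> bool) \<Rightarrow> real"
  assumes nonneg: "\<And>J b. finite J \<Longrightarrow> 0 \<le> W J b"
    and empty: "\<And>b. W {} b = 1"
    and cong: "\<And>J b b'. finite J \<Longrightarrow> (\<And>j. j \<in> J \<Longrightarrow> b j = b' j) \<Longrightarrow> W J b = W J b'"
    and step: "\<And>J j b. finite J \<Longrightarrow> j \<notin> J \<Longrightarrow>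
      W J b = W (insert j J) (fun_upd b j True) + W (insert j J) (fun_upd b j False)"
  shows "\<exists>M :: ('i \<Rightarrow> bool) measure. prob_space M \<and> sets M = sets (PiM UNIV (\<lambda>_. count_space UNIV)) \<and>
    (\<forall>J b. finite J \<longrightarrow> measure M {f. \<forall>j\<in>J. f j = b j} = W J b)"
proof -
  let ?B = "\<lambda>J :: 'i set. Pi\<^sub>E J (\<lambda>_. UNIV :: bool set)"
  have finB: "finite (?B J)" if "finite J" for J using that by (intro finite_PiE) auto
  have sum_insert: "(\<Sum>b\<in>?B (insert j J). h b) = (\<Sum>b\<in>?B J. h (fun_upd b j True) + h (fun_upd b j False))"
    if "finite J" "j \<notin> J" for J j and h :: "('i \<Rightarrow> bool) \<Rightarrow> real"
  proof -
    have "(\<Sum>b\<in>?B (insert j J). h b) = (\<Sum>p\<in>UNIV \<times> ?B J. h ((\<lambda>(y, g). fun_upd g j y) p))"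
      unfolding PiE_insert_eq using inj_combinator[OF that(2), of "\<lambda>_. UNIV"]
      by (subst sum.reindex) auto
    also have "\<dots> = (\<Sum>y\<in>UNIV. \<Sum>b\<in>?B J. h (fun_upd b j y))"
      by (subst sum.cartesian_product) (simp add: split_def)
    also have "\<dots> = (\<Sum>b\<in>?B J. h (fun_upd b j True)) + (\<Sum>b\<in>?B J. h (fun_upd b j False))"
      by (simp add: UNIV_bool add.commute)
    finally show ?thesis by (simp add: sum.distrib)
  qed
  \<comment> \<open>Indices outside \<open>J\<close> are summed out one at a time by
    \<open>step\<close>; the weight \<open>h\<close> sees only the part of the pattern on
    \<open>J\<close>.\<close>
  have consist: "(\<Sum>b\<in>?B H. W H b * h (restrict b J)) = (\<Sum>b\<in>?B J. W J b * h b)"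
    if "finite H" "J \<subseteq> H" for H J and h :: "('i \<Rightarrow> bool) \<Rightarrow> real"
  proof -
    have "(\<Sum>b\<in>?B (J \<union> K). W (J \<union> K) b * h (restrict b J)) = (\<Sum>b\<in>?B J. W J b * h b)"
      if "finite K" "finite J" "K \<inter> J = {}" for K
      using that
    proof (induction K rule: finite_induct)
      case empty
      show ?case by (intro sum.cong) auto
    next
      case (insert k K)
      let ?J = "J \<union> K"
      have k: "finite ?J" "k \<notin> ?J" using insert by auto
      have r: "restrict (fun_upd b k c) J = restrict b J" for b :: "'i \<Rightarrow> bool" and c
        using insert.prems by (auto simp: restrict_def fun_eq_iff)
      have "(\<Sum>b\<in>?B (J \<union> insert k K). W (J \<union> insert k K) b * h (restrict b J))
          = (\<Sum>b\<in>?B ?J. W ?J b * h (restrict b J))"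
        by (simp add: sum_insert[OF k] r step[OF k] distrib_right)
      also have "\<dots> = (\<Sum>b\<in>?B J. W J b * h b)" using insert.prems by (intro insert.IH) auto
      finally show ?case .
    qed
    from this[of "H - J"] that show ?thesis
      using finite_subset by (auto simp: Un_absorb1)
  qed
  have total: "(\<Sum>b\<in>?B J. W J b) = 1" if "finite J" for J
    using consist[OF that, of "{}" "\<lambda>_. 1"] by (simp add: empty)
  define code where "code J b = (\<lambda>j\<in>J. of_bool (b j) :: real)" for J and b :: "'i \<Rightarrow> bool"
  define P where "P J = distr (point_measure (?B J) (\<lambda>b. ennreal (W J b))) (PiM J (\<lambda>_. borel :: real measure)) (code J)" for J
  have code_meas: "code J \<in> measurable (point_measure (?B J) f) (PiM J (\<lambda>_. borel))" for J f
    by (auto simp: code_def space_PiM)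
  have emP: "emeasure (P J) A = ennreal (\<Sum>b\<in>?B J. W J b * indicator A (code J b))"
    if "finite J" "A \<in> sets (PiM J (\<lambda>_. borel))" for J A
  proof -
    have "emeasure (P J) A = emeasure (point_measure (?B J) (\<lambda>b. ennreal (W J b))) (code J -` A \<inter> ?B J)"
      unfolding P_def using emeasure_distr[OF code_meas that(2)] by (simp add: space_point_measure)
    also have "\<dots> = (\<Sum>b\<in>code J -` A \<inter> ?B J. ennreal (W J b))"
      by (rule emeasure_point_measure_finite[OF finB[OF that(1)]]) auto
    also have "\<dots> = ennreal (\<Sum>b\<in>code J -` A \<inter> ?B J. W J b)"
      by (intro sum_ennreal nonneg that)
    also have "(\<Sum>b\<in>code J -` A \<inter> ?B J. W J b) = (\<Sum>b\<in>?B J. W J b * indicator A (code J b))"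
      using finB[OF that(1)] by (auto intro!: sum.mono_neutral_cong_left simp: indicator_def)
    finally show ?thesis .
  qed
  have setsP: "sets (P J) = sets (PiM J (\<lambda>_. borel))" "space (P J) = space (PiM J (\<lambda>_. borel))" for J by (simp_all add: P_def)
  interpret polish_projective "UNIV :: 'i set" P
  proof (intro polish_projective.intro projective_family.intro)
    fix J H :: "'i set" assume JH: "J \<subseteq> H" "finite H"
    then have finJ: "finite J" by (rule finite_subset)
    have rm: "(\<lambda>f. restrict f J) \<in> measurable (PiM H (\<lambda>_. borel :: real measure)) (PiM J (\<lambda>_. borel))"
      using JH by (intro measurable_restrict_subset)
    show "P J = distr (P H) (PiM J (\<lambda>_. borel)) (\<lambda>f. restrict f J)"
    proof (rule measure_eqI)
      fix A assume "A \<in> sets (P J)"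
      then have A: "A \<in> sets (PiM J (\<lambda>_. borel))" by (simp add: setsP)
      have corr_maj_maj: "restrict (code H b) J = code J (restrict b J)" for b
        using JH by (auto simp: code_def restrict_def fun_eq_iff)
      have "emeasure (distr (P H) (PiM J (\<lambda>_. borel)) (\<lambda>f. restrict f J)) A
          = emeasure (P H) ((\<lambda>f. restrict f J) -` A \<inter> space (PiM H (\<lambda>_. borel)))"
        using rm A by (subst emeasure_distr) (auto simp: P_def)
      also have "\<dots> = ennreal (\<Sum>b\<in>?B H. W H b * indicator ((\<lambda>f. restrict f J) -` A \<inter> space (PiM H (\<lambda>_. borel))) (code H b))"
        using measurable_sets[OF rm A] JH by (intro emP) auto
      also have "(\<Sum>b\<in>?B H. W H b * indicator ((\<lambda>f. restrict f J) -` A \<inter> space (PiM H (\<lambda>_. borel))) (code H b))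
          = (\<Sum>b\<in>?B H. W H b * indicator A (code J (restrict b J)))"
      proof (intro sum.cong refl arg_cong2[where f = "(*)"])
        fix b
        have "code H b \<in> space (PiM H (\<lambda>_. borel))" by (auto simp: space_PiM code_def)
        then show "indicator ((\<lambda>f. restrict f J) -` A \<inter> space (PiM H (\<lambda>_. borel))) (code H b) = (indicator A (code J (restrict b J)) :: real)"
          by (simp add: indicator_def corr_maj_maj)
      qed
      also have "\<dots> = (\<Sum>b\<in>?B J. W J b * indicator A (code J b))" by (rule consist[OF JH(2,1)])
      also have "ennreal \<dots> = emeasure (P J) A" using emP[OF finJ A] by simp
      finally show "emeasure (P J) A = emeasure (distr (P H) (PiM J (\<lambda>_. borel)) (\<lambda>f. restrict f J)) A" by (rule sym)
    qed (simp add: P_def)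
  next
    fix J :: "'i set" assume J: "finite J"
    show "prob_space (P J)"
    proof
      have "emeasure (P J) (space (PiM J (\<lambda>_. borel))) = ennreal (\<Sum>b\<in>?B J. W J b * 1)"
        unfolding emP[OF J sets.top]
        by (intro arg_cong[where f = ennreal] sum.cong refl arg_cong2[where f = "(*)"]) (auto simp: space_PiM code_def)
      then show "emeasure (P J) (space (P J)) = 1" by (simp add: setsP total[OF J])
    qed
  qed
  \<comment> \<open>Points of the limit space may have coordinates other than 0 and 1. Comparison
    with 1 decodes all of them and inverts the code.\<close>
  define D where "D f = (\<lambda>j. f j = (1::real))" for f :: "'i \<Rightarrow> real"
  let ?N = "PiM UNIV (\<lambda>_::'i. count_space (UNIV :: bool set))"
  have sets_lim: "sets lim = sets (PiM UNIV (\<lambda>_::'i. borel :: real measure))" by simp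
  have D: "D \<in> measurable lim ?N"
  proof (rule measurable_PiM_single')
    fix i
    have "(\<lambda>f. f i) \<in> measurable (PiM UNIV (\<lambda>_::'i. borel :: real measure)) borel" by simp
    then have "(\<lambda>f. f i) \<in> borel_measurable lim" using measurable_cong_sets[OF sets_lim refl] by blast
    then have "Measurable.pred lim (\<lambda>f. f i = 1)" by measurable
    then show "(\<lambda>f. D f i) \<in> measurable lim (count_space UNIV)" by (simp add: D_def)
  qed simp
  have "measure (distr lim ?N D) {f. \<forall>j\<in>J. f j = b j} = W J b" if J: "finite J" for J b
  proof -
    let ?X = "{g \<in> space (PiM J (\<lambda>_. borel :: real measure)). \<forall>j\<in>J. (g j = 1) = b j}"
    have X: "?X \<in> sets (PiM J (\<lambda>_. borel))" using J by measurable
    have S: "{f. \<forall>j\<in>J. f j = b j} \<in> sets ?N"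
    proof -
      have "{f \<in> space ?N. \<forall>j\<in>J. f j = b j} \<in> sets ?N" using J by measurable
      then show ?thesis by (simp add: space_PiM)
    qed
    have "emeasure (distr lim ?N D) {f. \<forall>j\<in>J. f j = b j} = emeasure lim (D -` {f. \<forall>j\<in>J. f j = b j} \<inter> space lim)"
      by (rule emeasure_distr[OF D S])
    also have "D -` {f. \<forall>j\<in>J. f j = b j} \<inter> space lim = prod_emb UNIV (\<lambda>_. borel) J ?X"
      by (auto simp: D_def prod_emb_def space_PiM)
    also have "emeasure lim \<dots> = emeasure (P J) ?X" by (rule emeasure_lim_emb[OF _ J X]) simp
    also have "\<dots> = ennreal (\<Sum>b'\<in>?B J. W J b' * indicator ?X (code J b'))" by (rule emP[OF J X])
    also have "(\<Sum>b'\<in>?B J. W J b' * indicator ?X (code J b')) = (\<Sum>b'\<in>?B J. if b' = restrict b J then W J b' else 0)"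
    proof (rule sum.cong[OF refl])
      fix b' assume b': "b' \<in> ?B J"
      have "code J b' \<in> ?X \<longleftrightarrow> (\<forall>j\<in>J. b' j = b j)" by (auto simp: code_def space_PiM)
      also have "\<dots> \<longleftrightarrow> b' = restrict b J" using b' by (auto simp: PiE_iff extensional_def restrict_def fun_eq_iff)
      finally show "W J b' * indicator ?X (code J b') = (if b' = restrict b J then W J b' else 0)"
        by (simp add: indicator_def)
    qed
    also have "\<dots> = W J (restrict b J)" using finB[OF J] by (simp add: sum.delta)
    also have "\<dots> = W J b" by (rule cong[OF J]) simp
    finally show ?thesis using nonneg[OF J] by (simp add: measure_def)
  qed
  moreover have "prob_space (distr lim ?N D)" by (rule P.prob_space_distr[OF D])
  ultimately show ?thesis by (intro exI[of _ "distr lim ?N D"]) simp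
qed

text \<open>Local observables are linear combinations of pattern indicators and are dense, so a
  bounded functional is determined by its values on patterns.\<close>

lemma vanish_on_cylinders:
  fixes \<phi> :: "'v obs \<Rightarrow> real"
  assumes bl: "bounded_linear \<phi>"
    and cyl0: "\<And>A b. finite A \<Longrightarrow> \<phi> (bprod (\<lambda>x. ind x (b x)) A) = 0"
  shows "\<phi> g = 0"
proof -
  interpret bounded_linear \<phi> by fact
  have loc: "\<phi> g = 0" if A: "finite A" and g: "g \<in> obs_on A" for A g
  proof -
    let ?B = "Pi\<^sub>E A (\<lambda>_. UNIV :: bool set)"
    have "g = (\<Sum>b\<in>?B. apply_bcontfun g b *\<^sub>R bprod (\<lambda>x. ind x (b x)) A)"
    proof (rule bcontfun_eqI)
      fix \<omega> :: "'v \<Rightarrow> bool"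
      have "apply_bcontfun (\<Sum>b\<in>?B. apply_bcontfun g b *\<^sub>R bprod (\<lambda>x. ind x (b x)) A) \<omega>
          = (\<Sum>b\<in>?B. apply_bcontfun g b * (\<Prod>x\<in>A. if \<omega> x = b x then 1 else 0))"
      proof -
        have "apply_bcontfun (\<Sum>b\<in>K. apply_bcontfun g b *\<^sub>R bprod (\<lambda>x. ind x (b x)) A) \<omega>
          = (\<Sum>b\<in>K. apply_bcontfun g b * (\<Prod>x\<in>A. if \<omega> x = b x then 1 else 0))" for K
          by (induction K rule: infinite_finite_induct)
             (auto simp: plus_bcontfun.rep_eq scaleR_bcontfun.rep_eq apply_bprod[OF A] apply_ind)
        then show ?thesis .
      qed
      also have "\<dots> = (\<Sum>b\<in>?B. if b = restrict \<omega> A then apply_bcontfun g b else 0)"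
      proof (rule sum.cong[OF refl])
        fix b assume b: "b \<in> ?B"
        have "(\<Prod>x\<in>A. if \<omega> x = b x then 1 else 0 :: real) = (if \<forall>x\<in>A. \<omega> x = b x then 1 else 0)"
          using A by (auto intro: prod_zero)
        moreover have "(\<forall>x\<in>A. \<omega> x = b x) \<longleftrightarrow> b = restrict \<omega> A"
          using b by (auto simp: PiE_iff extensional_def restrict_def fun_eq_iff)
        ultimately show "apply_bcontfun g b * (\<Prod>x\<in>A. if \<omega> x = b x then 1 else 0) = (if b = restrict \<omega> A then apply_bcontfun g b else 0)"
          by simp
      qed
      also have "\<dots> = apply_bcontfun g (restrict \<omega> A)"
        using A by (subst sum.delta) (auto intro: finite_PiE)
      also have "\<dots> = apply_bcontfun g \<omega>" by (rule obs_on_apply_eq[OF g]) simp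
      finally show "apply_bcontfun g \<omega> = apply_bcontfun (\<Sum>b\<in>?B. apply_bcontfun g b *\<^sub>R bprod (\<lambda>x. ind x (b x)) A) \<omega>" by simp
    qed
    then have "\<phi> g = \<phi> (\<Sum>b\<in>?B. apply_bcontfun g b *\<^sub>R bprod (\<lambda>x. ind x (b x)) A)" by (rule arg_cong)
    also have "\<dots> = (\<Sum>b\<in>?B. apply_bcontfun g b * \<phi> (bprod (\<lambda>x. ind x (b x)) A))" by (simp add: sum scale)
    finally show ?thesis using cyl0[OF A] by simp
  qed
  have "closed {g. \<phi> g = 0}"
    by (intro closed_Collect_eq continuous_on_const linear_continuous_on bl)
  have "g \<in> closure {g. \<phi> g = 0}"
    unfolding closure_approachable
  proof (intro allI impI)
    fix e :: real assume e: "0 < e"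
    then obtain A h where "finite A" "h \<in> obs_on A" "norm (g - h) \<le> e / 2"
      using local_dense[OF obs_on_UNIV[of g], of "e / 2"] by auto
    then show "\<exists>y\<in>{g. \<phi> g = 0}. dist y g < e"
      using loc e by (intro bexI[of _ h]) (auto simp: dist_norm norm_minus_commute)
  qed
  then show ?thesis using \<open>closed {g. \<phi> g = 0}\<close> by simp
qed

section \<open>Joint expectations at finitely many times\<close>

context stationary_state
begin

text \<open>The conditional expectation at time \<open>s\<close> of the product of the observables at the increasing times in the list.\<close>

fun path_obs :: "real \<Rightarrow> (real \<times> 'a obs) list \<Rightarrow> 'a obs" where
  "path_obs s [] = one"
| "path_obs s ((t, g) # L) = S (t - s) (bmul g (path_obs t L))"

lemma bmul_one [simp]: "bmul one f = f" "bmul f one = f"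
  by (auto intro!: bcontfun_eqI simp: apply_bmul const_bcontfun.rep_eq)

lemma path_obs_shift:
  assumes "s' \<le> s" "\<And>t g. (t, g) \<in> set L \<Longrightarrow> s \<le> t"
  shows "path_obs s' L = S (s - s') (path_obs s L)"
proof (cases L)
  case Nil
  then show ?thesis using assms by (simp add: S_one)
next
  case (Cons p L')
  obtain t g where p: "p = (t, g)" by (cases p)
  have "s \<le> t" using assms(2) by (auto simp: Cons p)
  then show ?thesis using HY.S_add[of "s - s'" "t - s"] assms(1) by (simp add: Cons p)
qed

abbreviation pts :: "(real \<Rightarrow> 'a obs) \<Rightarrow> real list \<Rightarrow> (real \<times> 'a obs) list" where
  "pts g L \<equiv> map (\<lambda>t. (t, g t)) L"

text \<open>A trivial observable only splits a waiting time in two, and the semigroup property joins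
  the pieces again.\<close>

lemma path_obs_insort:
  assumes "g t = one" "sorted L" "s \<le> t" "\<And>u. u \<in> set L \<Longrightarrow> s \<le> u"
  shows "path_obs s (pts g (insort t L)) = path_obs s (pts g L)"
  using assms(2-)
proof (induction L arbitrary: s)
  case Nil
  then show ?case using assms(1) by (simp add: S_one)
next
  case (Cons u L)
  show ?case
  proof (cases "t \<le> u")
    case True
    have "path_obs s (pts g (insort t (u # L))) = S (t - s) (path_obs t (pts g (u # L)))"
      using True assms(1) by simp
    also have "\<dots> = path_obs s (pts g (u # L))"
      by (rule path_obs_shift[symmetric]) (use Cons True in auto)
    finally show ?thesis .
  next
    case False
    then have "path_obs u (pts g (insort t L)) = path_obs u (pts g L)" using Cons by (intro Cons.IH) auto
    then show ?thesis using False by simp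
  qed
qed

text \<open>The joint expectation at the times in \<open>T\<close> under the stationary law. The
  evolution starts at \<open>Min T\<close>; by invariance every earlier starting time gives the same
  value.\<close>

definition fdd :: "real set \<Rightarrow> (real \<Rightarrow> 'a obs) \<Rightarrow> real" where
  "fdd T g = m (path_obs (if T = {} then 0 else Min T) (pts g (sorted_list_of_set T)))"

lemma m_path_obs_shift:
  assumes "finite T" "\<And>t. t \<in> T \<Longrightarrow> s \<le> t"
  shows "m (path_obs s (pts g (sorted_list_of_set T))) = fdd T g"
proof (cases "T = {}")
  case False
  have "path_obs s (pts g (sorted_list_of_set T)) = S (Min T - s) (path_obs (Min T) (pts g (sorted_list_of_set T)))"
    by (rule path_obs_shift) (use assms False in auto)
  then show ?thesis using m_S[of "Min T - s"] assms False by (simp add: fdd_def)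
qed (simp add: fdd_def)

lemma fdd_empty: "fdd {} g = 1"
  by (simp add: fdd_def m_one)

lemma fdd_insert_one:
  assumes "finite T" "g t = one" shows "fdd (insert t T) g = fdd T g"
proof (cases "t \<in> T")
  case False
  let ?s = "Min (insert t T)"
  have s: "?s \<le> t" "\<And>u. u \<in> T \<Longrightarrow> ?s \<le> u" using assms(1) by auto
  have "fdd (insert t T) g = m (path_obs ?s (pts g (sorted_list_of_set (insert t T))))" by (simp add: fdd_def)
  also have "sorted_list_of_set (insert t T) = insort t (sorted_list_of_set T)"
    using assms(1) False by (rule sorted_list_of_set_insert)
  also have "path_obs ?s (pts g (insort t (sorted_list_of_set T))) = path_obs ?s (pts g (sorted_list_of_set T))"
    by (rule path_obs_insort) (use assms s in auto)
  also have "m \<dots> = fdd T g" by (rule m_path_obs_shift) (use assms s in auto)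
  finally show ?thesis .
qed (simp add: insert_absorb)

lemma fdd_cong:
  assumes "finite T" "\<And>t. t \<in> T \<Longrightarrow> g t = g' t" shows "fdd T g = fdd T g'"
proof -
  have "pts g (sorted_list_of_set T) = pts g' (sorted_list_of_set T)" using assms by simp
  then show ?thesis unfolding fdd_def by metis
qed

lemma fdd_nonneg:
  assumes "finite T" "\<And>t \<omega>. t \<in> T \<Longrightarrow> 0 \<le> apply_bcontfun (g t) \<omega>" shows "0 \<le> fdd T g"
proof -
  have pos: "0 \<le> apply_bcontfun (path_obs s (pts g L)) \<omega>"
    if "sorted L" "\<And>t. t \<in> set L \<Longrightarrow> s \<le> t" "\<And>t \<omega>. t \<in> set L \<Longrightarrow> 0 \<le> apply_bcontfun (g t) \<omega>" for s L \<omega>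
    using that
  proof (induction L arbitrary: s \<omega>)
    case (Cons u L)
    have "0 \<le> apply_bcontfun (path_obs u (pts g L)) \<omega>" for \<omega>
      using Cons.prems by (intro Cons.IH) auto
    then show ?case using Cons.prems by (auto intro!: S_pos simp: apply_bmul)
  qed (simp add: const_bcontfun.rep_eq)
  have "0 \<le> apply_bcontfun (path_obs (if T = {} then 0 else Min T) (pts g (sorted_list_of_set T))) \<omega>" for \<omega>
    by (rule pos) (use assms in \<open>auto split: if_splits\<close>)
  then show ?thesis unfolding fdd_def by (rule m_pos)
qed

lemma m_bounded_linear: "bounded_linear m"
  using m_linear m_norm by (intro bounded_linear.intro bounded_linear_axioms.intro exI[of _ 1]) auto

lemma fdd_bounded_linear:
  assumes "finite T" "t \<in> T" shows "bounded_linear (\<lambda>a. fdd T (fun_upd g t a))"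
proof -
  have bl: "bounded_linear (\<lambda>a. path_obs s (pts (fun_upd g t a) L))"
    if "sorted L" "distinct L" "t \<in> set L" "\<And>u. u \<in> set L \<Longrightarrow> s \<le> u" for s L
    using that
  proof (induction L arbitrary: s)
    case (Cons u L)
    note SL = HY.S_bounded_linear[of "u - s"]
    show ?case
    proof (cases "u = t")
      case True
      then have "t \<notin> set L" using Cons.prems by auto
      then have pe: "pts (fun_upd g t a) L = pts g L" for a by auto
      have eq: "(\<lambda>a. path_obs s (pts (fun_upd g t a) (u # L))) = (\<lambda>a. S (t - s) (bmul a (path_obs t (pts g L))))"
        by (simp only: list.map path_obs.simps pe fun_upd_same True)
      show ?thesis unfolding eq
        using bounded_linear_compose[OF SL bounded_bilinear.bounded_linear_left[OF bounded_bilinear_bmul]] True Cons.prems by simp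
    next
      case False
      then have IH: "bounded_linear (\<lambda>a. path_obs u (pts (fun_upd g t a) L))"
        using Cons.prems by (intro Cons.IH) auto
      have eq: "(\<lambda>a. path_obs s (pts (fun_upd g t a) (u # L))) = (\<lambda>a. S (u - s) (bmul (g u) (path_obs u (pts (fun_upd g t a) L))))"
        by (simp only: list.map path_obs.simps fun_upd_other[OF False])
      show ?thesis unfolding eq
        using Cons.prems
        by (intro bounded_linear_compose[OF SL] bounded_linear_compose[OF bounded_bilinear.bounded_linear_right[OF bounded_bilinear_bmul] IH]) auto
    qed
  qed simp
  show ?thesis
    unfolding fdd_def
    by (rule bounded_linear_compose[OF m_bounded_linear bl]) (use assms in \<open>auto split: if_splits\<close>)
qed

definition slice :: "(real \<times> 'a) set \<Rightarrow> real \<Rightarrow> 'a set" where "slice J t = {x. (t, x) \<in> J}"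

lemma finite_slice: "finite J \<Longrightarrow> finite (slice J t)"
  using finite_subset[of "slice J t" "snd ` J"] by (force simp: slice_def)

definition cyl :: "(real \<times> 'a) set \<Rightarrow> (real \<times> 'a \<Rightarrow> bool) \<Rightarrow> real \<Rightarrow> 'a obs" where
  "cyl J b t = bprod (\<lambda>x. ind x (b (t, x))) (slice J t)"

text \<open>The candidate probability that the opinions at the space-time points of \<open>J\<close>
  are those of \<open>b\<close>.\<close>

definition W :: "(real \<times> 'a) set \<Rightarrow> (real \<times> 'a \<Rightarrow> bool) \<Rightarrow> real" where
  "W J b = fdd (fst ` J) (cyl J b)"

lemma bprod_cong: "finite A \<Longrightarrow> (\<And>i. i \<in> A \<Longrightarrow> F i = G i) \<Longrightarrow> bprod F A = bprod G A"
  by (rule bcontfun_eqI) (simp add: apply_bprod)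

lemma cyl_empty: "t \<notin> fst ` J \<Longrightarrow> cyl J b t = one"
proof -
  assume "t \<notin> fst ` J"
  then have "slice J t = {}" by (force simp: slice_def)
  then show ?thesis by (simp add: cyl_def)
qed

lemma cyl_insert:
  assumes J: "finite J" "(t, x) \<notin> J"
  shows "cyl (insert (t, x) J) (fun_upd b (t, x) c) = fun_upd (cyl J b) t (bmul (ind x c) (cyl J b t))"
proof
  fix u
  show "cyl (insert (t, x) J) (fun_upd b (t, x) c) u = fun_upd (cyl J b) t (bmul (ind x c) (cyl J b t)) u"
  proof (cases "u = t")
    case True
    have s: "slice (insert (t, x) J) t = insert x (slice J t)" "x \<notin> slice J t" using J by (auto simp: slice_def)
    have "bprod (\<lambda>y. ind y (fun_upd b (t, x) c (t, y))) (slice J t) = cyl J b t"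
      unfolding cyl_def by (rule bprod_cong[OF finite_slice[OF J(1)]]) (use s in auto)
    then show ?thesis using True s J by (simp add: cyl_def[of "insert _ _"] bprod_insert finite_slice)
  next
    case False
    then have "slice (insert (t, x) J) u = slice J u" by (auto simp: slice_def)
    then show ?thesis using False by (simp add: cyl_def)
  qed
qed

text \<open>The joint expectation is linear in the observable at time \<open>t\<close>, and the
  indicators of the two values at \<open>x\<close> add up to one.\<close>

lemma W_step:
  assumes J: "finite J" "j \<notin> J"
  shows "W J b = W (insert j J) (fun_upd b j True) + W (insert j J) (fun_upd b j False)"
proof -
  obtain t x where j: "j = (t, x)" by (cases j)
  let ?T = "insert t (fst ` J)" and ?g = "cyl J b"
  interpret bounded_linear "\<lambda>a. fdd ?T (fun_upd ?g t a)" by (rule fdd_bounded_linear) (use J in auto)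
  have "W J b = fdd ?T ?g"
  proof (cases "t \<in> fst ` J")
    case False
    then show ?thesis unfolding W_def using J cyl_empty[OF False] by (simp add: fdd_insert_one)
  qed (simp add: W_def insert_absorb)
  also have "?g = fun_upd ?g t (bmul (ind x True) (?g t) + bmul (ind x False) (?g t))"
    by (auto simp: fun_eq_iff intro!: bcontfun_eqI simp: apply_bmul apply_ind plus_bcontfun.rep_eq)
  also have "fdd ?T \<dots> = W (insert j J) (fun_upd b j True) + W (insert j J) (fun_upd b j False)"
    using J unfolding W_def j by (simp add: cyl_insert add)
  finally show ?thesis .
qed

lemma W_nonneg: "finite J \<Longrightarrow> 0 \<le> W J b"
  unfolding W_def cyl_def by (rule fdd_nonneg) (auto simp: apply_bprod finite_slice apply_ind intro!: prod_nonneg)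

lemma W_empty: "W {} b = 1"
  by (simp add: W_def fdd_empty)

lemma W_cong: "finite J \<Longrightarrow> (\<And>j. j \<in> J \<Longrightarrow> b j = b' j) \<Longrightarrow> W J b = W J b'"
  unfolding W_def cyl_def by (intro fdd_cong bprod_cong finite_slice) (auto simp: slice_def)

end

text \<open>\<open>Y\<close> is the raw process from the extension theorem, indexed by all real
  times and without any path regularity; the regular version \<open>X\<close> is derived from
  it.\<close>

locale path_process = stationary_state E r V m + prob_space M
  for E :: "('v \<times> 'v) set" and r V m and M :: "'w measure" +
  fixes Y :: "real \<Rightarrow> 'w \<Rightarrow> 'v \<Rightarrow> bool"
  assumes Y_meas: "\<And>t x. (\<lambda>w. Y t w x) \<in> measurable M (count_space UNIV)"
    and Y_W: "\<And>J b. finite J \<Longrightarrow> prob {w \<in> space M. \<forall>(t, x)\<in>J. Y t w x = b (t, x)} = W J b"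
begin

lemma Y_PiM: "Y t \<in> measurable M (PiM UNIV (\<lambda>_. count_space UNIV))"
  by (rule measurable_PiM_single') (use Y_meas in auto)

lemma Y_obs_measurable [measurable]: "(\<lambda>w. apply_bcontfun (f :: 'v obs) (Y t w)) \<in> borel_measurable M"
  by (rule measurable_compose[OF Y_PiM measurable_PiM_bcontfun])

lemma expectation_fdd:
  assumes T: "finite T"
  shows "expectation (\<lambda>w. \<Prod>t\<in>T. apply_bcontfun (g t) (Y t w)) = fdd T g"
proof -
  have base: "expectation (\<lambda>w. \<Prod>t\<in>T. apply_bcontfun (g t) (Y t w)) = fdd T g"
    if g: "\<And>t. t \<in> T \<Longrightarrow> finite (A t) \<and> g t = bprod (\<lambda>x. ind x (\<beta> t x)) (A t)" for g :: "real \<Rightarrow> 'v obs" and A \<beta>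
  proof -
    define J where "J = (SIGMA t:T. A t)"
    define b where "b = (\<lambda>(t, x). \<beta> t x)"
    have finJ: "finite J" using T g by (auto simp: J_def)
    have sl: "slice J t = A t" if "t \<in> T" for t using that by (auto simp: slice_def J_def)
    have cg: "cyl J b t = g t" if "t \<in> T" for t using g[OF that] sl[OF that] by (simp add: cyl_def b_def)
    \<comment> \<open>Times at which no site is constrained leave no trace in \<open>J\<close>; they
      are restored with the trivial observable.\<close>
    have *: "fdd (fst ` J \<union> T') (cyl J b) = fdd (fst ` J) (cyl J b)" if "finite T'" "T' \<inter> fst ` J = {}" for T'
      using that
    proof (induction T' rule: finite_induct)
      case (insert u T')
      then have "cyl J b u = one" by (intro cyl_empty) auto
      then have "fdd (insert u (fst ` J \<union> T')) (cyl J b) = fdd (fst ` J \<union> T') (cyl J b)"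
        using insert finJ by (intro fdd_insert_one) auto
      then show ?case using insert by simp
    qed simp
    have sub: "fst ` J \<subseteq> T" by (auto simp: J_def)
    have TJ: "fst ` J \<union> (T - fst ` J) = T" using sub by auto
    have "(T - fst ` J) \<inter> fst ` J = {}" by blast
    from *[OF finite_Diff[OF T] this] have "W J b = fdd T (cyl J b)" unfolding TJ W_def by (rule sym)
    also have "\<dots> = fdd T g" by (rule fdd_cong[OF T cg])
    finally have W: "W J b = fdd T g" .
    let ?A = "{w \<in> space M. \<forall>(t, x)\<in>J. Y t w x = b (t, x)}"
    have "expectation (\<lambda>w. \<Prod>t\<in>T. apply_bcontfun (g t) (Y t w)) = expectation (indicator ?A)"
    proof (rule Bochner_Integration.integral_cong[OF refl])
      fix w assume w: "w \<in> space M"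
      have "(\<Prod>t\<in>T. apply_bcontfun (g t) (Y t w)) = (\<Prod>t\<in>T. \<Prod>x\<in>A t. if Y t w x = \<beta> t x then 1 else 0)"
        by (rule prod.cong) (use g in \<open>auto simp: apply_bprod apply_ind\<close>)
      also have "\<dots> = (\<Prod>t\<in>T. if \<forall>x\<in>A t. Y t w x = \<beta> t x then 1 else 0)"
        by (rule prod.cong[OF refl]) (use g in \<open>auto intro: prod_zero\<close>)
      also have "\<dots> = (if \<forall>t\<in>T. \<forall>x\<in>A t. Y t w x = \<beta> t x then 1 else 0)"
        using T by (auto intro: prod_zero)
      also have "\<dots> = indicator ?A w" using w by (auto simp: indicator_def J_def b_def)
      finally show "(\<Prod>t\<in>T. apply_bcontfun (g t) (Y t w)) = indicator ?A w" .
    qed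
    also have "\<dots> = prob (?A \<inter> space M)" by simp
    also have "?A \<inter> space M = ?A" by blast
    finally show ?thesis using Y_W[OF finJ, of b] W by simp
  qed
  \<comment> \<open>\<open>T0\<close> collects the times at which the observable is already
    arbitrary.\<close>
  have "\<forall>g :: real \<Rightarrow> 'v obs. (\<forall>t\<in>T - T0. \<exists>A \<beta>. finite A \<and> g t = bprod (\<lambda>x. ind x (\<beta> x)) A) \<longrightarrow>
      expectation (\<lambda>w. \<Prod>t\<in>T. apply_bcontfun (g t) (Y t w)) = fdd T g" if "T0 \<subseteq> T" for T0
    using finite_subset[OF that T] that
  proof (induction T0 rule: finite_induct)
    case empty
    show ?case
    proof (intro allI impI)
      fix g :: "real \<Rightarrow> 'v obs" assume "\<forall>t\<in>T - {}. \<exists>A \<beta>. finite A \<and> g t = bprod (\<lambda>x. ind x (\<beta> x)) A"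
      then have "\<forall>t\<in>T. \<exists>A. \<exists>\<beta>. finite A \<and> g t = bprod (\<lambda>x. ind x (\<beta> x)) A" by simp
      then obtain A where "\<forall>t\<in>T. \<exists>\<beta>. finite (A t) \<and> g t = bprod (\<lambda>x. ind x (\<beta> x)) (A t)" by (rule bchoice[THEN exE])
      then obtain \<beta> where "\<forall>t\<in>T. finite (A t) \<and> g t = bprod (\<lambda>x. ind x (\<beta> t x)) (A t)" by (rule bchoice[THEN exE])
      then show "expectation (\<lambda>w. \<Prod>t\<in>T. apply_bcontfun (g t) (Y t w)) = fdd T g"
        by (intro base[of A g \<beta>]) blast
    qed
  next
    case (insert u T0)
    show ?case
    proof (intro allI impI)
      fix g :: "real \<Rightarrow> 'v obs" assume g: "\<forall>t\<in>T - insert u T0. \<exists>A \<beta>. finite A \<and> g t = bprod (\<lambda>x. ind x (\<beta> x)) A"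
      have u: "u \<in> T" using insert by simp
      let ?R = "\<lambda>w. \<Prod>t\<in>T - {u}. apply_bcontfun (g t) (Y t w)"
      let ?c = "\<Prod>t\<in>T - {u}. norm (g t)"
      have R: "\<bar>?R w\<bar> \<le> ?c" for w unfolding abs_prod by (intro prod_mono) (auto simp: abs_le_norm)
      have c0: "0 \<le> ?c" by (intro prod_nonneg) auto
      have eq: "(\<Prod>t\<in>T. apply_bcontfun (fun_upd g u a t) (Y t w)) = apply_bcontfun a (Y u w) * ?R w" for a w
        using T u by (subst prod.remove[of _ u]) (auto intro!: prod.cong)
      have bd: "\<bar>apply_bcontfun a (Y u w) * ?R w\<bar> \<le> norm a * ?c" for a w
        unfolding abs_mult by (intro mult_mono abs_le_norm R) auto
      have int: "integrable M (\<lambda>w. apply_bcontfun a (Y u w) * ?R w)" for a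
        by (rule integrable_const_bound[of _ "norm a * ?c"]) (use bd in auto)
      define \<psi> where "\<psi> a = expectation (\<lambda>w. apply_bcontfun a (Y u w) * ?R w)" for a
      have "bounded_linear \<psi>"
      proof (rule bounded_linear_intro)
        show "\<psi> (a + b) = \<psi> a + \<psi> b" for a b
          using int[of a] int[of b] by (simp add: \<psi>_def plus_bcontfun.rep_eq distrib_right)
        show "\<psi> (k *\<^sub>R a) = k *\<^sub>R \<psi> a" for k a
          by (simp add: \<psi>_def scaleR_bcontfun.rep_eq mult.assoc)
        show "norm (\<psi> a) \<le> norm a * ?c" for a
        proof -
          have "norm (\<psi> a) \<le> expectation (\<lambda>w. \<bar>apply_bcontfun a (Y u w) * ?R w\<bar>)"
            unfolding \<psi>_def real_norm_def by (rule integral_abs_bound)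
          also have "\<dots> \<le> norm a * ?c"
            by (rule integral_le_const) (use int bd in auto)
          finally show ?thesis .
        qed
      qed
      then have bl: "bounded_linear (\<lambda>a. \<psi> a - fdd T (fun_upd g u a))"
        by (intro bounded_linear_sub fdd_bounded_linear T u)
      have "\<psi> (g u) - fdd T (fun_upd g u (g u)) = 0"
      proof (rule vanish_on_cylinders[OF bl])
        fix A :: "'v set" and b assume A: "finite A"
        let ?a = "bprod (\<lambda>x. ind x (b x)) A"
        have "\<forall>t\<in>T - T0. \<exists>A \<beta>. finite A \<and> fun_upd g u ?a t = bprod (\<lambda>x. ind x (\<beta> x)) A"
        proof
          fix t assume t: "t \<in> T - T0"
          show "\<exists>A \<beta>. finite A \<and> fun_upd g u ?a t = bprod (\<lambda>x. ind x (\<beta> x)) A"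
          proof (cases "t = u")
            case True
            then show ?thesis using A by auto
          next
            case False
            then show ?thesis using g t by simp
          qed
        qed
        then have "expectation (\<lambda>w. \<Prod>t\<in>T. apply_bcontfun (fun_upd g u ?a t) (Y t w)) = fdd T (fun_upd g u ?a)"
          using insert by blast
        then show "\<psi> ?a - fdd T (fun_upd g u ?a) = 0" unfolding eq \<psi>_def by simp
      qed
      then show "expectation (\<lambda>w. \<Prod>t\<in>T. apply_bcontfun (g t) (Y t w)) = fdd T g"
        using eq[of "g u"] by (simp add: \<psi>_def)
    qed
  qed
  from this[of T] show ?thesis by simp
qed

end

section \<open>Right-continuous paths\<close>

definition dyadic :: "real set" where
  "dyadic = {real k / 2 ^ n |k n. True}"

lemma dyadicI: "real k / 2 ^ n \<in> dyadic"
  unfolding dyadic_def by blast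

lemma dyadic_above:
  assumes "0 \<le> t" shows "t < real (nat \<lfloor>t * 2 ^ n\<rfloor> + 1) / 2 ^ n" "real (nat \<lfloor>t * 2 ^ n\<rfloor> + 1) / 2 ^ n \<le> t + (1 / 2) ^ n"
proof -
  have "real (nat \<lfloor>t * 2 ^ n\<rfloor>) = of_int \<lfloor>t * 2 ^ n\<rfloor>" using assms by simp
  then have "t * 2 ^ n < real (nat \<lfloor>t * 2 ^ n\<rfloor> + 1)" "real (nat \<lfloor>t * 2 ^ n\<rfloor> + 1) \<le> t * 2 ^ n + 1"
    by linarith+
  then show "t < real (nat \<lfloor>t * 2 ^ n\<rfloor> + 1) / 2 ^ n" "real (nat \<lfloor>t * 2 ^ n\<rfloor> + 1) / 2 ^ n \<le> t + (1 / 2) ^ n"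
    by (simp_all add: pos_less_divide_eq pos_divide_le_eq distrib_right power_divide)
qed

lemma dyadic_between:
  assumes "0 \<le> s" "s < t" obtains q where "q \<in> dyadic" "s < q" "q < t"
proof -
  obtain n where n: "(1 / 2 :: real) ^ n < t - s" using assms real_arch_pow_inv[of "t - s" "1 / 2"] by auto
  show ?thesis
    by (rule that[of "real (nat \<lfloor>s * 2 ^ n\<rfloor> + 1) / 2 ^ n"])
       (rule dyadicI, (use dyadic_above[OF assms(1), of n] n in linarith)+)
qed

definition flips :: "(real \<Rightarrow> bool) \<Rightarrow> nat \<Rightarrow> real \<Rightarrow> nat set" where
  "flips y n q = {k. real (Suc k) / 2 ^ n \<le> q \<and> y (real k / 2 ^ n) \<noteq> y (real (Suc k) / 2 ^ n)}"

text \<open>The bound is asked along infinitely many grids because Fatou's lemma controls a lower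
  limit.\<close>

definition flip_bounded :: "(real \<Rightarrow> bool) \<Rightarrow> bool" where
  "flip_bounded y \<longleftrightarrow> (\<forall>N::nat. \<exists>K. \<exists>\<^sub>\<infinity>n. card (flips y n (real N)) \<le> K)"

lemma finite_flips: "finite (flips y n q)"
proof -
  have "flips y n q \<subseteq> {..nat \<lfloor>q * 2 ^ n\<rfloor>}"
  proof
    fix k assume "k \<in> flips y n q"
    then have "real (Suc k) \<le> q * 2 ^ n" by (simp add: flips_def pos_divide_le_eq)
    then have "int k \<le> \<lfloor>q * 2 ^ n\<rfloor>" by (simp add: le_floor_iff)
    then show "k \<in> {..nat \<lfloor>q * 2 ^ n\<rfloor>}" by simp
  qed
  then show ?thesis by (rule finite_subset) simp
qed

lemma flips_mono: "q \<le> q' \<Longrightarrow> flips y n q \<subseteq> flips y n q'"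
  by (auto simp: flips_def)

lemma dyadic_eventually_grid:
  assumes "q \<in> dyadic" obtains n0 where "\<And>n. n0 \<le> n \<Longrightarrow> \<exists>a. q = real a / 2 ^ n"
proof -
  obtain k m where q: "q = real k / 2 ^ m" using assms by (auto simp: dyadic_def)
  show ?thesis
  proof (rule that[of m])
    fix n assume "m \<le> n"
    then have "(2::real) ^ n = 2 ^ m * 2 ^ (n - m)" by (simp flip: power_add)
    then have "q = real (k * 2 ^ (n - m)) / 2 ^ n" by (simp add: q)
    then show "\<exists>a. q = real a / 2 ^ n" by blast
  qed
qed

text \<open>Two grid points with different values enclose a flip, which counts towards the later
  point but not towards the earlier one.\<close>

lemma flips_strict:
  assumes q: "q = real a / 2 ^ n" "q' = real b / 2 ^ n" "q < q'" "y q \<noteq> y q'"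
  shows "Suc (card (flips y n q)) \<le> card (flips y n q')"
proof -
  have ab: "a \<le> b" using q(1-3) by (simp add: divide_less_cancel)
  have "\<exists>k. a \<le> k \<and> k < b \<and> y (real k / 2 ^ n) \<noteq> y (real (Suc k) / 2 ^ n)"
  proof (rule ccontr)
    assume *: "\<not> ?thesis"
    have "y (real c / 2 ^ n) = y (real a / 2 ^ n)" if "a \<le> c" "c \<le> b" for c
      using that
    proof (induction c rule: dec_induct)
      case (step c)
      then have "y (real c / 2 ^ n) = y (real (Suc c) / 2 ^ n)" using * by auto
      then show ?case using step by simp
    qed simp
    from this[of b] show False using q ab by simp
  qed
  then obtain k where k: "a \<le> k" "k < b" "y (real k / 2 ^ n) \<noteq> y (real (Suc k) / 2 ^ n)" by blast
  have "k \<in> flips y n q'" using k q by (auto simp: flips_def divide_right_mono)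
  moreover have "k \<notin> flips y n q"
  proof
    assume "k \<in> flips y n q"
    then have "real (Suc k) / 2 ^ n \<le> real a / 2 ^ n" by (simp add: flips_def q(1))
    then show False using k(1) by (simp add: divide_le_cancel)
  qed
  ultimately have "flips y n q \<subset> flips y n q'" using flips_mono[of q q' y n] q(3) by auto
  then show ?thesis using psubset_card_mono[OF finite_flips] by (simp add: Suc_le_eq)
qed

text \<open>The number of flips along infinitely many dyadic grids is a nat-valued increasing function of
  the endpoint; near its minimum to the right of \<open>t\<close> (its maximum to the left) the path is constant.\<close>

definition flip_count :: "(real \<Rightarrow> bool) \<Rightarrow> real \<Rightarrow> nat" where
  "flip_count y q = (LEAST K. \<exists>\<^sub>\<infinity>n. card (flips y n q) \<le> K)"

lemma flip_count:
  assumes "flip_bounded y" shows "\<exists>\<^sub>\<infinity>n. card (flips y n q) \<le> flip_count y q"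
proof -
  obtain N :: nat where N: "q \<le> real N" using real_arch_simple by blast
  obtain K where "\<exists>\<^sub>\<infinity>n. card (flips y n (real N)) \<le> K" using assms by (auto simp: flip_bounded_def)
  then have "\<exists>\<^sub>\<infinity>n. card (flips y n q) \<le> K"
    by (rule INFM_mono) (meson N card_mono finite_flips flips_mono order_trans)
  then show ?thesis unfolding flip_count_def by (rule LeastI)
qed

lemma flip_count_le: "\<exists>\<^sub>\<infinity>n. card (flips y n q) \<le> K \<Longrightarrow> flip_count y q \<le> K"
  unfolding flip_count_def by (rule Least_le)

lemma flip_count_mono:
  assumes "flip_bounded y" "q \<le> q'" shows "flip_count y q \<le> flip_count y q'"
proof (rule flip_count_le, rule INFM_mono[OF flip_count[OF assms(1), of q']])
  fix n assume "card (flips y n q') \<le> flip_count y q'"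
  then show "card (flips y n q) \<le> flip_count y q'"
    using card_mono[OF finite_flips flips_mono[OF assms(2)], of y n] by simp
qed

text \<open>Infinitely many grids stay within the count at \<open>q'\<close>, and all fine grids
  contain both points, so on infinitely many grids one flip is saved up to \<open>q\<close>.\<close>

lemma flip_count_strict:
  assumes y: "flip_bounded y" and q: "q \<in> dyadic" "q' \<in> dyadic" "q < q'" "y q \<noteq> y q'"
  shows "flip_count y q < flip_count y q'"
proof -
  obtain n0 where n0: "\<And>n. n0 \<le> n \<Longrightarrow> \<exists>a. q = real a / 2 ^ n" using dyadic_eventually_grid[OF q(1)] by blast
  obtain n1 where n1: "\<And>n. n1 \<le> n \<Longrightarrow> \<exists>a. q' = real a / 2 ^ n" using dyadic_eventually_grid[OF q(2)] by blast
  have "\<forall>\<^sub>\<infinity>n. max n0 n1 \<le> n" unfolding MOST_nat_le by blast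
  with flip_count[OF y, of q'] have inf: "\<exists>\<^sub>\<infinity>n. card (flips y n q') \<le> flip_count y q' \<and> max n0 n1 \<le> n"
    by (rule INFM_conjI)
  have "\<exists>\<^sub>\<infinity>n. Suc (card (flips y n q)) \<le> flip_count y q'"
    using inf
  proof (rule INFM_mono)
    fix n assume n: "card (flips y n q') \<le> flip_count y q' \<and> max n0 n1 \<le> n"
    then obtain a b where "q = real a / 2 ^ n" "q' = real b / 2 ^ n" using n0[of n] n1[of n] by auto
    from flips_strict[OF this q(3,4)] n show "Suc (card (flips y n q)) \<le> flip_count y q'" by simp
  qed
  moreover from this have "0 < flip_count y q'" using INFM_EX by fastforce
  ultimately have "\<exists>\<^sub>\<infinity>n. card (flips y n q) \<le> flip_count y q' - 1" by (auto elim!: INFM_mono)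
  then have "flip_count y q \<le> flip_count y q' - 1" by (rule flip_count_le)
  then show ?thesis using \<open>0 < flip_count y q'\<close> by simp
qed

lemma right_limit:
  assumes y: "flip_bounded y" and t: "0 \<le> t"
  obtains b d where "0 < d" "\<And>q. q \<in> dyadic \<Longrightarrow> t < q \<Longrightarrow> q < t + d \<Longrightarrow> y q = b"
proof -
  obtain q1 where q1: "q1 \<in> dyadic" "t < q1" using dyadic_between[OF t, of "t + 1"] by auto
  obtain q0 where q0: "q0 \<in> dyadic \<and> t < q0" "\<And>q. q \<in> dyadic \<and> t < q \<Longrightarrow> flip_count y q0 \<le> flip_count y q"
    using ex_has_least_nat[of "\<lambda>q. q \<in> dyadic \<and> t < q" q1 "flip_count y"] q1 by blast
  show ?thesis
  proof (rule that[of "q0 - t" "y q0"])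
    fix q assume q: "q \<in> dyadic" "t < q" "q < t + (q0 - t)"
    show "y q = y q0"
    proof (rule ccontr)
      assume "y q \<noteq> y q0"
      then have "flip_count y q < flip_count y q0" using q q0 by (intro flip_count_strict[OF y]) auto
      then show False using q0(2)[of q] q by simp
    qed
  qed (use q0 in simp)
qed

lemma left_limit:
  assumes y: "flip_bounded y" and t: "0 < t"
  obtains b d where "0 < d" "d \<le> t" "\<And>q. q \<in> dyadic \<Longrightarrow> t - d < q \<Longrightarrow> q < t \<Longrightarrow> y q = b"
proof -
  have "0 \<in> dyadic" by (force simp: dyadic_def)
  obtain q0 where q0: "q0 \<in> dyadic \<and> q0 < t" "\<And>q. q \<in> dyadic \<and> q < t \<Longrightarrow> flip_count y q \<le> flip_count y q0"
    using ex_has_greatest_nat[of "\<lambda>q. q \<in> dyadic \<and> q < t" 0 "flip_count y" "Suc (flip_count y t)"]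
      \<open>0 \<in> dyadic\<close> t flip_count_mono[OF y] by (metis less_Suc_eq_le less_imp_le)
  have "0 \<le> q0" using q0 by (auto simp: dyadic_def)
  show ?thesis
  proof (rule that[of "t - q0" "y q0"])
    fix q assume q: "q \<in> dyadic" "t - (t - q0) < q" "q < t"
    show "y q = y q0"
    proof (rule ccontr)
      assume "y q \<noteq> y q0"
      then have "flip_count y q0 < flip_count y q" using q q0 by (intro flip_count_strict[OF y]) auto
      then show False using q0(2)[of q] q by simp
    qed
  qed (use q0 \<open>0 \<le> q0\<close> in auto)
qed

text \<open>The right limit along dyadic times, written with countable quantifiers so that it is
  measurable and has a value even where no limit exists.\<close>

definition right_value :: "(real \<Rightarrow> bool) \<Rightarrow> real \<Rightarrow> bool" where
  "right_value y t \<longleftrightarrow> (\<exists>m::nat. \<forall>q\<in>dyadic. t < q \<longrightarrow> q < t + 1 / real (Suc m) \<longrightarrow> y q)"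

lemma right_value_eq:
  assumes t: "0 \<le> t" "0 < d" and b: "\<And>q. q \<in> dyadic \<Longrightarrow> t < q \<Longrightarrow> q < t + d \<Longrightarrow> y q = b"
  shows "right_value y t = b"
proof (cases b)
  case True
  obtain m where m: "1 / real (Suc m) < d" using nat_approx_posE[OF t(2)] by blast
  have "\<forall>q\<in>dyadic. t < q \<longrightarrow> q < t + 1 / real (Suc m) \<longrightarrow> y q" using b m True by fastforce
  then show ?thesis using True by (auto simp: right_value_def)
next
  case False
  have "\<not> right_value y t"
  proof
    assume "right_value y t"
    then obtain m :: nat where m: "\<forall>q\<in>dyadic. t < q \<longrightarrow> q < t + 1 / real (Suc m) \<longrightarrow> y q" by (auto simp: right_value_def)
    obtain q where "q \<in> dyadic" "t < q" "q < t + min d (1 / real (Suc m))"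
      using dyadic_between[OF t(1), of "t + min d (1 / real (Suc m))"] t(2) by auto
    then have "q \<in> dyadic" "t < q" "q < t + d" "q < t + 1 / real (Suc m)" by (auto simp: min_def split: if_splits)
    then show False using b[of q] m False by auto
  qed
  then show ?thesis using False by simp
qed

lemma right_value_cadlag:
  assumes y: "flip_bounded y"
  shows "0 \<le> t \<Longrightarrow> \<forall>\<^sub>F s in at_right t. right_value y s = right_value y t"
    and "0 < t \<Longrightarrow> \<exists>b. \<forall>\<^sub>F s in at_left t. right_value y s = b"
proof -
  assume t: "0 \<le> t"
  obtain b d where bd: "0 < d" "\<And>q. q \<in> dyadic \<Longrightarrow> t < q \<Longrightarrow> q < t + d \<Longrightarrow> y q = b"
    using right_limit[OF y t] by metis
  have "right_value y s = b" if "t \<le> s" "s < t + d" for s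
    by (rule right_value_eq[of s "t + d - s"]) (use that t bd in auto)
  then have "right_value y s = right_value y t" if "s \<in> {t<..<t + d}" for s using that bd(1) by auto
  moreover have "\<forall>\<^sub>F s in at_right t. s \<in> {t<..<t + d}" using bd(1) by (intro eventually_at_right_real) simp
  ultimately show "\<forall>\<^sub>F s in at_right t. right_value y s = right_value y t" by (auto elim: eventually_mono)
next
  assume t: "0 < t"
  obtain b d where bd: "0 < d" "d \<le> t" "\<And>q. q \<in> dyadic \<Longrightarrow> t - d < q \<Longrightarrow> q < t \<Longrightarrow> y q = b"
    using left_limit[OF y t] by metis
  have "right_value y s = b" if "s \<in> {t - d<..<t}" for s
    by (rule right_value_eq[of s "t - s"]) (use that t bd in auto)
  moreover have "\<forall>\<^sub>F s in at_left t. s \<in> {t - d<..<t}" using bd(1) by (intro eventually_at_left_real) simp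
  ultimately have "\<forall>\<^sub>F s in at_left t. right_value y s = b" by (auto elim: eventually_mono)
  then show "\<exists>b. \<forall>\<^sub>F s in at_left t. right_value y s = b" by blast
qed

lemma tendsto_config:
  fixes p :: "'b \<Rightarrow> 'v \<Rightarrow> bool"
  assumes "\<And>x. \<forall>\<^sub>F s in F. p s x = l x" shows "(p \<longlongrightarrow> l) F"
proof (rule topological_tendstoI)
  fix S :: "('v \<Rightarrow> bool) set" assume "open S" "l \<in> S"
  then obtain A where A: "finite A" "{\<omega>'. \<forall>x\<in>A. \<omega>' x = l x} \<subseteq> S" by (rule cylinder_nhd)
  have "\<forall>\<^sub>F s in F. \<forall>x\<in>A. p s x = l x" using A(1) assms by (intro eventually_ball_finite) auto
  then show "\<forall>\<^sub>F s in F. p s \<in> S" by eventually_elim (use A(2) in blast)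
qed

lemma cadlag_right_value:
  assumes "\<And>x. flip_bounded (\<lambda>t. p t x)"
  shows "cadlag (\<lambda>t x. right_value (\<lambda>t. p t x) t)"
  unfolding cadlag_def
proof (intro conjI allI impI)
  fix t :: real assume "0 \<le> t"
  then show "((\<lambda>t x. right_value (\<lambda>t. p t x) t) \<longlongrightarrow> (\<lambda>x. right_value (\<lambda>t. p t x) t)) (at_right t)"
    by (intro tendsto_config right_value_cadlag(1)[OF assms])
next
  fix t :: real assume "0 < t"
  then have "\<forall>x. \<exists>b. \<forall>\<^sub>F s in at_left t. right_value (\<lambda>t. p t x) s = b"
    using right_value_cadlag(2)[OF assms] by blast
  then obtain l where "\<And>x. \<forall>\<^sub>F s in at_left t. right_value (\<lambda>t. p t x) s = l x" by metis
  then show "\<exists>l. ((\<lambda>t x. right_value (\<lambda>t. p t x) t) \<longlongrightarrow> l) (at_left t)"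
    by (intro exI[of _ l] tendsto_config)
qed

text \<open>By connectedness the vertices reached in finitely many steps from \<open>r 0\<close> are
  all vertices, and each step reaches only countably many.\<close>

lemma (in layered_tree) countable_vertices: "countable (UNIV :: 'v set)"
proof -
  define R where "R = rec_nat {r 0} (\<lambda>_ A. par ` A \<union> (\<Union>x\<in>A. kids x))"
  have R: "R 0 = {r 0}" "R (Suc n) = par ` R n \<union> (\<Union>x\<in>R n. kids x)" for n by (simp_all add: R_def)
  have cR: "countable (R n)" for n by (induction n) (auto simp: R countable_finite)
  have "y \<in> (\<Union>n. R n)" for y
  proof -
    have "(adjacent E)\<^sup>*\<^sup>* (r 0) y" using tree by (auto simp: regular_directed_tree_def directed_tree_def)
    then show ?thesis
    proof (induction rule: rtranclp_induct)
      case base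
      show ?case using R(1) by blast
    next
      case (step y z)
      then obtain n where n: "y \<in> R n" by auto
      have "z = par y \<or> z \<in> kids y" using step(2) by (auto simp: adjacent_def E_iff kids_iff)
      then have "z \<in> R (Suc n)" using n by (auto simp: R)
      then show ?case by blast
    qed
  qed
  then have "UNIV = (\<Union>n. R n)" by blast
  then show ?thesis using cR by (metis countable_UN countableI_type)
qed

context path_process
begin

section \<open>A right-continuous version of the process\<close>

lemma fdd_pair:
  assumes "s < t" shows "fdd {s, t} g = m (bmul (g s) (S (t - s) (g t)))"
proof -
  have "sorted_list_of_set {s, t} = [s, t]" using assms by simp
  then show ?thesis using assms by (simp add: fdd_def)
qed

text \<open>Disagreement has probability \<open>(1 - c) / 2\<close> with \<open>c\<close> the
  two-time correlation, and \<open>1 - c\<close> is at most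
  \<open>norm (chi x - S (t - s) (chi x)) \<le> 2 (t - s)\<close>.\<close>

lemma prob_differ:
  assumes "s \<le> t" shows "prob {w \<in> space M. Y s w x \<noteq> Y t w x} \<le> t - s"
proof (cases "s = t")
  case False
  then have st: "s < t" using assms by simp
  let ?A = "{w \<in> space M. Y s w x \<noteq> Y t w x}"
  have A: "?A \<in> events" using Y_meas[of s x] Y_meas[of t x] by measurable
  let ?I = "\<lambda>w. apply_bcontfun (chi x) (Y s w) * apply_bcontfun (chi x) (Y t w)"
  have "expectation (\<lambda>w. \<Prod>u\<in>{s, t}. apply_bcontfun (chi x) (Y u w)) = m (bmul (chi x) (S (t - s) (chi x)))"
    using expectation_fdd[of "{s, t}" "\<lambda>_. chi x"] fdd_pair[OF st] by simp
  then have E: "expectation ?I = m (bmul (chi x) (S (t - s) (chi x)))" using st by simp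
  have I: "?I w = 1 - 2 * indicator ?A w" if "w \<in> space M" for w
    using that by (simp add: apply_chi sgn_of_def indicator_def)
  have "expectation ?I = expectation (\<lambda>w. 1 - 2 * indicator ?A w)"
    by (rule Bochner_Integration.integral_cong[OF refl I])
  also have "\<dots> = expectation (\<lambda>w. 1) - expectation (\<lambda>w. 2 * indicator ?A w)"
    using A by (intro Bochner_Integration.integral_diff) (auto simp: less_top[symmetric])
  also have "\<dots> = 1 - 2 * prob (?A \<inter> space M)" by (simp add: prob_space)
  also have "?A \<inter> space M = ?A" by blast
  finally have "2 * prob ?A = 1 - m (bmul (chi x) (S (t - s) (chi x)))" using E by simp
  also have "\<dots> = m (one - bmul (chi x) (S (t - s) (chi x)))" using m_linear m_one by (simp add: linear_diff)
  also have "one - bmul (chi x) (S (t - s) (chi x)) = bmul (chi x) (chi x - S (t - s) (chi x))"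
    by (rule bcontfun_eqI) (simp add: apply_bmul minus_bcontfun.rep_eq const_bcontfun.rep_eq apply_chi right_diff_distrib)
  also have "m \<dots> \<le> norm (bmul (chi x) (chi x - S (t - s) (chi x)))" using m_norm abs_le_D1 by blast
  also have "\<dots> \<le> 1 * norm (chi x - S (t - s) (chi x))"
    using norm_bmul[of "chi x" "chi x - S (t - s) (chi x)"] norm_chi[of x] by (meson mult_right_mono norm_ge_zero order_trans)
  also have "norm (chi x - S (t - s) (chi x)) \<le> (t - s) * norm (Maj x - chi x)"
  proof -
    have "(chi x, Maj x - chi x) \<in> closed_generation UNIV" using chi_closed_generation closed_generation_mono by blast
    from HY.S_norm_diff[OF this, of "t - s"] st show ?thesis by (simp add: norm_minus_commute)
  qed
  also have "norm (Maj x - chi x) \<le> 2"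
    by (rule bcontfun_norm_le) (simp add: minus_bcontfun.rep_eq apply_Maj apply_chi sgn_of_def)
  finally show ?thesis using st by simp
qed simp

text \<open>The grid of mesh \<open>2^-n\<close> on \<open>[0, N]\<close> has \<open>N 2^n\<close>
  cells, each containing a flip with probability at most \<open>2^-n\<close>. The expected count is
  thus at most \<open>N\<close> for every \<open>n\<close>, and Fatou's lemma makes the lower limit
  finite almost surely.\<close>

lemma AE_flip_bounded: "AE w in M. flip_bounded (\<lambda>t. Y t w x)"
proof -
  have "AE w in M. \<exists>K. \<exists>\<^sub>\<infinity>n. card (flips (\<lambda>t. Y t w x) n (real N)) \<le> K" for N :: nat
  proof -
    define G where "G n k = {w \<in> space M. Y (real k / 2 ^ n) w x \<noteq> Y (real (Suc k) / 2 ^ n) w x}" for n k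
    have G: "G n k \<in> events" for n k
      unfolding G_def using Y_meas[of "real k / 2 ^ n" x] Y_meas[of "real (Suc k) / 2 ^ n" x] by measurable
    define u where "u n w = (\<Sum>k<N * 2 ^ n. indicator (G n k) w :: ennreal)" for n w
    have u_meas: "u n \<in> borel_measurable M" for n unfolding u_def using G by measurable
    have u_int: "integral\<^sup>N M (u n) \<le> ennreal (real N)" for n
    proof -
      have "integral\<^sup>N M (u n) = (\<Sum>k<N * 2 ^ n. emeasure M (G n k))"
        unfolding u_def using G by (subst nn_integral_sum) auto
      also have "\<dots> \<le> (\<Sum>k<N * 2 ^ n. ennreal ((1 / 2) ^ n))"
      proof (rule sum_mono)
        fix k
        have "prob (G n k) \<le> real (Suc k) / 2 ^ n - real k / 2 ^ n"
          unfolding G_def by (rule prob_differ) (simp add: divide_right_mono)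
        also have "\<dots> = (1 / 2) ^ n" by (simp add: diff_divide_distrib[symmetric] power_divide)
        finally show "emeasure M (G n k) \<le> ennreal ((1 / 2) ^ n)" by (simp add: emeasure_eq_measure ennreal_leI)
      qed
      also have "\<dots> = ennreal (real (N * 2 ^ n) * (1 / 2) ^ n)"
        by (simp add: ennreal_mult' ennreal_of_nat_eq_real_of_nat del: of_nat_mult of_nat_power)
      also have "real (N * 2 ^ n) * (1 / 2) ^ n = real N" by (simp add: power_divide)
      finally show ?thesis .
    qed
    have "(\<integral>\<^sup>+ w. liminf (\<lambda>n. u n w) \<partial>M) \<le> liminf (\<lambda>n. integral\<^sup>N M (u n))"
      by (rule nn_integral_liminf[OF u_meas])
    also have "\<dots> \<le> liminf (\<lambda>n::nat. ennreal (real N))" by (intro Liminf_mono always_eventually allI u_int)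
    also have "\<dots> = ennreal (real N)" by (simp add: Liminf_const)
    finally have "(\<integral>\<^sup>+ w. liminf (\<lambda>n. u n w) \<partial>M) \<noteq> \<infinity>" by (auto simp: top_unique)
    then have "AE w in M. liminf (\<lambda>n. u n w) \<noteq> \<infinity>"
      using u_meas by (intro nn_integral_PInf_AE) auto
    then show ?thesis
    proof (rule AE_mp, intro AE_I2 impI)
      fix w assume w: "w \<in> space M" and fin: "liminf (\<lambda>n. u n w) \<noteq> \<infinity>"
      have card: "u n w = of_nat (card (flips (\<lambda>t. Y t w x) n (real N)))" for n
      proof -
        have "flips (\<lambda>t. Y t w x) n (real N) = {k\<in>{..<N * 2 ^ n}. w \<in> G n k}"
        proof -
          have "real (Suc k) / 2 ^ n \<le> real N \<longleftrightarrow> k < N * 2 ^ n" for k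
          proof -
            have "real (Suc k) / 2 ^ n \<le> real N \<longleftrightarrow> real (Suc k) \<le> real (N * 2 ^ n)" by (simp add: pos_divide_le_eq)
            then show ?thesis by (simp only: of_nat_le_iff Suc_le_eq)
          qed
          then show ?thesis using w unfolding flips_def G_def by auto
        qed
        moreover have "(\<Sum>k<N * 2 ^ n. indicator (G n k) w) = (of_nat (card {k\<in>{..<N * 2 ^ n}. w \<in> G n k}) :: ennreal)"
          by (simp add: indicator_def sum.If_cases Int_def)
        ultimately show ?thesis by (simp add: u_def)
      qed
      show "\<exists>K. \<exists>\<^sub>\<infinity>n. card (flips (\<lambda>t. Y t w x) n (real N)) \<le> K"
      proof (rule ccontr)
        assume "\<not> ?thesis"
        then have ev: "\<forall>\<^sub>F n in sequentially. K < card (flips (\<lambda>t. Y t w x) n (real N))" for K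
          by (simp add: cofinite_eq_sequentially not_frequently not_le)
        have lb: "of_nat K \<le> liminf (\<lambda>n. u n w)" for K
          unfolding card by (intro Liminf_bounded eventually_mono[OF ev[of K]]) simp
        obtain K where "liminf (\<lambda>n. u n w) < of_nat K"
          using ennreal_Ex_less_of_nat[of "liminf (\<lambda>n. u n w)"] fin by (auto simp: less_top)
        then show False using lb[of K] by simp
      qed
    qed
  qed
  then show ?thesis unfolding flip_bounded_def by (simp add: AE_all_countable)
qed

definition X :: "real \<Rightarrow> 'w \<Rightarrow> 'v \<Rightarrow> bool" where
  "X t w x = right_value (\<lambda>t. Y t w x) t"

lemma AE_cadlag: "AE w in M. cadlag (\<lambda>t. X t w)"
proof -
  have "AE w in M. \<forall>x\<in>UNIV. flip_bounded (\<lambda>t. Y t w x)"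
    using AE_flip_bounded by (subst AE_ball_countable[OF countable_vertices]) auto
  then show ?thesis
    by eventually_elim (use cadlag_right_value[of "\<lambda>t x. Y t _ x"] in \<open>simp add: X_def[abs_def]\<close>)
qed

lemma X_meas: "(\<lambda>w. X t w x) \<in> measurable M (count_space UNIV)"
proof -
  have [measurable]: "Measurable.pred M (\<lambda>w. Y q w x)" for q by (rule Y_meas)
  have "Measurable.pred M (\<lambda>w. \<exists>m::nat. \<forall>k n::nat. t < real k / 2 ^ n \<longrightarrow> real k / 2 ^ n < t + 1 / real (Suc m) \<longrightarrow> Y (real k / 2 ^ n) w x)"
    by measurable
  moreover have "(\<lambda>w. X t w x) = (\<lambda>w. \<exists>m::nat. \<forall>k n::nat. t < real k / 2 ^ n \<longrightarrow> real k / 2 ^ n < t + 1 / real (Suc m) \<longrightarrow> Y (real k / 2 ^ n) w x)"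
    by (auto simp: X_def right_value_def dyadic_def fun_eq_iff)
  ultimately show ?thesis by simp
qed

text \<open>At dyadic times within \<open>2^-n\<close> above \<open>t\<close> the raw process
  differs from its value at \<open>t\<close> with summable probabilities; by Borel-Cantelli the
  right limit equals that value.\<close>

lemma X_eq_Y:
  assumes t: "0 \<le> t" shows "AE w in M. X t w x = Y t w x"
proof -
  define q where "q n = real (nat \<lfloor>t * 2 ^ n\<rfloor> + 1) / 2 ^ n" for n :: nat
  have q: "t < q n" "q n \<le> t + (1 / 2) ^ n" "q n \<in> dyadic" for n
    using dyadic_above[OF t, of n] dyadicI by (simp_all only: q_def)
  let ?A = "\<lambda>n. {w \<in> space M. Y t w x \<noteq> Y (q n) w x}"
  have "AE w in M. \<forall>\<^sub>F n in sequentially. w \<in> space M - ?A n"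
  proof (rule borel_cantelli_AE1)
    show "?A n \<in> events" for n using Y_meas[of t x] Y_meas[of "q n" x] by measurable
    show "emeasure M (?A n) < \<infinity>" for n by (simp add: emeasure_eq_measure)
    have pn: "prob (?A n) \<le> (1 / 2) ^ n" for n
      using prob_differ[of t "q n" x] q[of n] by simp
    have "summable (\<lambda>n. (1 / 2 :: real) ^ n)" by (rule summable_geometric) simp
    then show "summable (\<lambda>n. prob (?A n))"
      by (rule summable_comparison_test'[where N = 0]) (use pn in simp)
  qed
  with AE_flip_bounded[of x] show ?thesis
  proof eventually_elim
    case (elim w)
    obtain b d where bd: "0 < d" "\<And>q. q \<in> dyadic \<Longrightarrow> t < q \<Longrightarrow> q < t + d \<Longrightarrow> Y q w x = b"
      using right_limit[OF elim(1) t] by metis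
    have "X t w x = b" unfolding X_def using right_value_eq[of t d "\<lambda>t. Y t w x" b, OF t bd] by simp
    moreover have "Y t w x = b"
    proof -
      have "(\<lambda>n. (1 / 2 :: real) ^ n) \<longlonglongrightarrow> 0" by (rule LIMSEQ_power_zero) simp
      then have "\<forall>\<^sub>F n in sequentially. (1 / 2) ^ n < d" using bd(1) by (rule order_tendstoD)
      with elim(2) have "\<forall>\<^sub>F n in sequentially. Y t w x = b"
      proof eventually_elim
        case (elim n)
        then show ?case using bd(2)[of "q n"] q[of n] by auto
      qed
      then show ?thesis by simp
    qed
    ultimately show ?case by simp
  qed
qed

lemma X_eq_Y_all:
  assumes "0 \<le> t" shows "AE w in M. X t w = Y t w"
proof -
  have "AE w in M. \<forall>x\<in>UNIV. X t w x = Y t w x"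
    using X_eq_Y[OF assms] by (subst AE_ball_countable[OF countable_vertices]) auto
  then show ?thesis by eventually_elim (auto simp: fun_eq_iff)
qed

lemma X_PiM: "X t \<in> measurable M (PiM UNIV (\<lambda>_. count_space UNIV))"
  by (rule measurable_PiM_single') (use X_meas in auto)

lemma X_obs_measurable [measurable]: "(\<lambda>w. apply_bcontfun (f :: 'v obs) (X t w)) \<in> borel_measurable M"
  by (rule measurable_compose[OF X_PiM measurable_PiM_bcontfun])

lemma expectation_X:
  assumes T: "finite T" "\<And>t. t \<in> T \<Longrightarrow> 0 \<le> t"
  shows "expectation (\<lambda>w. \<Prod>t\<in>T. apply_bcontfun (g t) (X t w)) = fdd T g"
proof -
  have "AE w in M. \<forall>t\<in>T. X t w = Y t w"
    using X_eq_Y_all T by (subst AE_ball_countable) (auto simp: countable_finite)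
  then have "AE w in M. (\<Prod>t\<in>T. apply_bcontfun (g t) (X t w)) = (\<Prod>t\<in>T. apply_bcontfun (g t) (Y t w))"
    by eventually_elim (auto intro: prod.cong)
  then have "expectation (\<lambda>w. \<Prod>t\<in>T. apply_bcontfun (g t) (X t w)) = expectation (\<lambda>w. \<Prod>t\<in>T. apply_bcontfun (g t) (Y t w))"
    by (intro integral_cong_AE) auto
  then show ?thesis by (simp add: expectation_fdd[OF T(1)])
qed

end

section \<open>The stationary process\<close>

text \<open>With countably many sites every open set is a countable union of cylinders.\<close>

lemma measurable_config_borel:
  assumes c: "countable (UNIV :: 'v set)" and f: "\<And>x :: 'v. (\<lambda>w. f w x) \<in> measurable M (count_space (UNIV :: bool set))"
  shows "f \<in> borel_measurable M"
proof (rule borel_measurableI)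
  fix S :: "('v \<Rightarrow> bool) set" assume S: "open S"
  \<comment> \<open>A cylinder is coded by two finite sets, its base \<open>A\<close> and the sites
    \<open>B\<close> that fix which opinions are \<open>True\<close>, so only countably many
    occur.\<close>
  define I where "I = {(A, B). finite A \<and> finite B \<and> {\<omega> :: 'v \<Rightarrow> bool. \<forall>x\<in>A. \<omega> x = (x \<in> B)} \<subseteq> S}"
  have "I \<subseteq> {A. finite A} \<times> {B. finite B}" by (auto simp: I_def)
  moreover have "countable {A :: 'v set. finite A}" using countable_Collect_finite_subset[OF c] by simp
  ultimately have "countable I" by (meson countable_SIGMA countable_subset)
  have "w \<in> f -` S \<longleftrightarrow> (\<exists>(A, B)\<in>I. \<forall>x\<in>A. f w x = (x \<in> B))" for w
  proof
    assume "w \<in> f -` S"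
    then have "f w \<in> S" by simp
    with S obtain A where A: "finite A" "{\<omega>'. \<forall>x\<in>A. \<omega>' x = f w x} \<subseteq> S" by (rule cylinder_nhd)
    then have "(A, {x \<in> A. f w x}) \<in> I" by (auto simp: I_def)
    then show "\<exists>(A, B)\<in>I. \<forall>x\<in>A. f w x = (x \<in> B)" by (intro bexI) auto
  qed (auto simp: I_def)
  then have "f -` S \<inter> space M = (\<Union>i\<in>I. {w \<in> space M. \<forall>x\<in>fst i. f w x = (x \<in> snd i)})" by force
  also have "\<dots> \<in> sets M"
  proof (rule sets.countable_UN'[OF \<open>countable I\<close>])
    have "{w \<in> space M. \<forall>x\<in>fst i. f w x = (x \<in> snd i)} \<in> sets M" if "i \<in> I" for i
    proof -
      have "Measurable.pred M (\<lambda>w. f w x = (x \<in> snd i))" for x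
        using measurable_compose[OF f[of x], of "\<lambda>b. b = (x \<in> snd i)" "count_space UNIV"] by simp
      then have "Measurable.pred M (\<lambda>w. \<forall>x\<in>fst i. f w x = (x \<in> snd i))"
        using that by (intro pred_intros_finite(3)) (auto simp: I_def)
      then show ?thesis by (simp add: pred_def)
    qed
    then show "(\<lambda>i. {w \<in> space M. \<forall>x\<in>fst i. f w x = (x \<in> snd i)}) ` I \<subseteq> sets M" by blast
  qed
  finally show "f -` S \<inter> space M \<in> sets M" .
qed

lemma measurable_config_coordinate: "(\<lambda>\<omega> :: 'v \<Rightarrow> bool. \<omega> x) \<in> measurable borel (count_space UNIV)"
proof -
  have "open {\<omega>' :: 'v \<Rightarrow> bool. \<forall>y\<in>{x}. \<omega>' y = True}"
    using open_cylinder[of "{x}" "\<lambda>_. True"] by simp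
  then have "{\<omega> \<in> space borel. \<omega> x} \<in> sets (borel :: ('v \<Rightarrow> bool) measure)" by simp
  then show ?thesis by (simp add: pred_def)
qed

text \<open>Prescribing only the opinion \<open>True\<close> gives events that are closed under
  intersection and still generate the path sigma-algebra, so two laws can be compared on
  them.\<close>

definition all_true :: "'w set \<Rightarrow> (real \<Rightarrow> 'w \<Rightarrow> 'v \<Rightarrow> bool) \<Rightarrow> (real \<times> 'v) set \<Rightarrow> 'w set" where
  "all_true \<Omega> X J = {w \<in> \<Omega>. \<forall>(t, x)\<in>J. X t w x}"

definition all_true_events :: "'w set \<Rightarrow> (real \<Rightarrow> 'w \<Rightarrow> 'v \<Rightarrow> bool) \<Rightarrow> real set \<Rightarrow> 'w set set" where
  "all_true_events \<Omega> X I = {all_true \<Omega> X J |J. finite J \<and> J \<subseteq> I \<times> UNIV}"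

lemma Int_stable_all_true: "Int_stable (all_true_events \<Omega> X I)"
proof (rule Int_stableI)
  fix A B assume "A \<in> all_true_events \<Omega> X I" "B \<in> all_true_events \<Omega> X I"
  then obtain J K where "A = all_true \<Omega> X J" "finite J" "J \<subseteq> I \<times> UNIV" "B = all_true \<Omega> X K" "finite K" "K \<subseteq> I \<times> UNIV"
    by (auto simp: all_true_events_def)
  moreover from this have "A \<inter> B = all_true \<Omega> X (J \<union> K)" by (auto simp: all_true_def)
  ultimately show "A \<inter> B \<in> all_true_events \<Omega> X I" unfolding all_true_events_def by blast
qed

lemma all_true_events_Pow: "all_true_events \<Omega> X I \<subseteq> Pow \<Omega>"
  by (auto simp: all_true_events_def all_true_def)

lemma top_all_true: "\<Omega> \<in> all_true_events \<Omega> X I"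
proof -
  have "\<Omega> = all_true \<Omega> X {}" by (simp add: all_true_def)
  then show ?thesis unfolding all_true_events_def by blast
qed

lemma measurable_all_true:
  fixes X :: "real \<Rightarrow> 'w \<Rightarrow> 'v \<Rightarrow> bool"
  assumes c: "countable (UNIV :: 'v set)" and "t \<in> I"
  shows "X t \<in> measurable (sigma \<Omega> (all_true_events \<Omega> X I)) borel"
proof (rule measurable_config_borel[OF c])
  fix x
  have "all_true \<Omega> X {(t, x)} \<in> all_true_events \<Omega> X I" using assms unfolding all_true_events_def by blast
  moreover have "all_true \<Omega> X {(t, x)} = {w \<in> \<Omega>. X t w x}" by (auto simp: all_true_def)
  ultimately have "{w \<in> space (sigma \<Omega> (all_true_events \<Omega> X I)). X t w x} \<in> sets (sigma \<Omega> (all_true_events \<Omega> X I))"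
    using all_true_events_Pow[of \<Omega> X I] by (simp add: space_measure_of_conv sets_measure_of_conv sigma_sets.Basic)
  then show "(\<lambda>w. X t w x) \<in> measurable (sigma \<Omega> (all_true_events \<Omega> X I)) (count_space UNIV)" by (simp add: pred_def)
qed

lemma sets_path_space:
  assumes c: "countable (UNIV :: 'v set)"
  shows "sets (PiM {0..} (\<lambda>_. borel :: ('v \<Rightarrow> bool) measure)) =
    sigma_sets (Pi\<^sub>E {0..} (\<lambda>_. UNIV)) (all_true_events (Pi\<^sub>E {0..} (\<lambda>_. UNIV)) (\<lambda>t p. p t) {0..})"
    (is "sets ?P = sigma_sets ?\<Omega> ?G")
proof (rule antisym)
  have "sets (sigma ?\<Omega> ?G) = sigma_sets ?\<Omega> ?G" using all_true_events_Pow by (rule sets_measure_of)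
  have "{p \<in> ?\<Omega>. p t \<in> B} \<in> sigma_sets ?\<Omega> ?G" if "t \<in> {0..}" "B \<in> sets borel" for t and B :: "('v \<Rightarrow> bool) set"
  proof -
    have "(\<lambda>p. p t) -` B \<inter> space (sigma ?\<Omega> ?G) \<in> sets (sigma ?\<Omega> ?G)"
      using measurable_sets[OF measurable_all_true[OF c that(1), of "\<lambda>t p. p t" ?\<Omega>] that(2)] .
    moreover have "(\<lambda>p. p t) -` B \<inter> space (sigma ?\<Omega> ?G) = {p \<in> ?\<Omega>. p t \<in> B}"
      using all_true_events_Pow[of ?\<Omega> "\<lambda>t p. p t" "{0..}"] by (auto simp: space_measure_of)
    ultimately show ?thesis using \<open>sets (sigma ?\<Omega> ?G) = sigma_sets ?\<Omega> ?G\<close> by simp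
  qed
  then show "sets ?P \<subseteq> sigma_sets ?\<Omega> ?G"
    unfolding sets_PiM_single space_borel by (intro sigma_sets_mono) auto
  have "all_true ?\<Omega> (\<lambda>t p. p t) J \<in> sets ?P" if J: "finite J" "J \<subseteq> {0..} \<times> UNIV" for J :: "(real \<times> 'v) set"
  proof -
    have "Measurable.pred ?P (\<lambda>p. \<forall>j\<in>J. p (fst j) (snd j))"
    proof (rule pred_intros_finite(3)[OF J(1)])
      fix j assume "j \<in> J"
      then have "(\<lambda>p. p (fst j)) \<in> measurable ?P borel" using J by (intro measurable_component_singleton) auto
      from measurable_compose[OF this measurable_config_coordinate[of "snd j"]]
      show "Measurable.pred ?P (\<lambda>p. p (fst j) (snd j))" .
    qed
    moreover have "all_true ?\<Omega> (\<lambda>t p. p t) J = {p \<in> space ?P. \<forall>j\<in>J. p (fst j) (snd j)}"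
      by (auto simp: all_true_def space_PiM split_def)
    ultimately show ?thesis by (simp add: pred_def)
  qed
  then have "?G \<subseteq> sets ?P" by (auto simp: all_true_events_def)
  moreover have "space ?P = ?\<Omega>" by (simp add: space_PiM)
  ultimately show "sigma_sets ?\<Omega> ?G \<subseteq> sets ?P" by (metis sets.sigma_sets_subset)
qed

lemma process_law_eqI:
  fixes X X' :: "real \<Rightarrow> 'w \<Rightarrow> 'v \<Rightarrow> bool"
  assumes M: "prob_space M" and c: "countable (UNIV :: 'v set)"
    and X: "\<And>t. 0 \<le> t \<Longrightarrow> X t \<in> borel_measurable M" and X': "\<And>t. 0 \<le> t \<Longrightarrow> X' t \<in> borel_measurable M"
    and eq: "\<And>J. finite J \<Longrightarrow> J \<subseteq> {0..} \<times> UNIV \<Longrightarrow> measure M (all_true (space M) X J) = measure M (all_true (space M) X' J)"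
  shows "process_law M X = process_law M X'"
proof -
  interpret prob_space M by fact
  let ?P = "PiM {0..} (\<lambda>_. borel :: ('v \<Rightarrow> bool) measure)"
  let ?\<Omega> = "Pi\<^sub>E {0::real..} (\<lambda>_. UNIV :: ('v \<Rightarrow> bool) set)"
  let ?G = "all_true_events ?\<Omega> (\<lambda>t p. p t) {0..}"
  have meas: "(\<lambda>w. \<lambda>t\<in>{0..}. Z t w) \<in> measurable M ?P" if "\<And>t. 0 \<le> t \<Longrightarrow> Z t \<in> borel_measurable M" for Z
    using that by (intro measurable_restrict) auto
  have em: "emeasure (process_law M Z) (all_true ?\<Omega> (\<lambda>t p. p t) J) = ennreal (measure M (all_true (space M) Z J))"
    if Z: "\<And>t. 0 \<le> t \<Longrightarrow> Z t \<in> borel_measurable M" and J: "finite J" "J \<subseteq> {0..} \<times> UNIV" for Z J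
  proof -
    have "all_true ?\<Omega> (\<lambda>t p. p t) J \<in> ?G" using J unfolding all_true_events_def by blast
    then have S: "all_true ?\<Omega> (\<lambda>t p. p t) J \<in> sets ?P"
      unfolding sets_path_space[OF c] by (rule sigma_sets.Basic)
    have "emeasure (process_law M Z) (all_true ?\<Omega> (\<lambda>t p. p t) J)
        = emeasure M ((\<lambda>w. \<lambda>t\<in>{0..}. Z t w) -` all_true ?\<Omega> (\<lambda>t p. p t) J \<inter> space M)"
      unfolding process_law_def by (rule emeasure_distr[OF meas[OF Z] S])
    also have "(\<lambda>w. \<lambda>t\<in>{0..}. Z t w) -` all_true ?\<Omega> (\<lambda>t p. p t) J \<inter> space M = all_true (space M) Z J"
      using J(2) by (fastforce simp: all_true_def)
    finally show ?thesis by (simp add: emeasure_eq_measure)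
  qed
  have emX: "emeasure (process_law M X) (all_true ?\<Omega> (\<lambda>t p. p t) J) = ennreal (measure M (all_true (space M) X J))"
    "emeasure (process_law M X') (all_true ?\<Omega> (\<lambda>t p. p t) J) = ennreal (measure M (all_true (space M) X' J))"
    if "finite J" "J \<subseteq> {0..} \<times> UNIV" for J
    using that by (auto intro!: em X X')
  show ?thesis
  proof (rule measure_eqI_generator_eq[where E = ?G and \<Omega> = ?\<Omega> and A = "\<lambda>_. ?\<Omega>"])
    show "Int_stable ?G" by (rule Int_stable_all_true)
    show "?G \<subseteq> Pow ?\<Omega>" by (rule all_true_events_Pow)
    show "sets (process_law M X) = sigma_sets ?\<Omega> ?G" "sets (process_law M X') = sigma_sets ?\<Omega> ?G"
      by (simp_all add: process_law_def sets_path_space[OF c])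
    show "range (\<lambda>_. ?\<Omega>) \<subseteq> ?G" using top_all_true by auto
    show "emeasure (process_law M X) ?\<Omega> \<noteq> \<infinity>" for i :: nat
    proof -
      have "all_true ?\<Omega> (\<lambda>t p. p t) {} = ?\<Omega>" by (simp add: all_true_def)
      then show ?thesis using emX[of "{}"] by simp
    qed
    fix A assume "A \<in> ?G"
    then obtain J where J: "finite J" "J \<subseteq> {0..} \<times> UNIV" "A = all_true ?\<Omega> (\<lambda>t p. p t) J" by (auto simp: all_true_events_def)
    show "emeasure (process_law M X) A = emeasure (process_law M X') A"
      unfolding J(3) emX[OF J(1,2)] eq[OF J(1,2)] ..
  qed simp
qed

context path_process
begin

text \<open>The observable at the last time is conditioned away: it enters as \<open>S t f\<close>
  at the time before.\<close>

lemma fdd_markov: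
  assumes T: "finite T" "s \<in> T" "\<And>u. u \<in> T \<Longrightarrow> u \<le> s" and t: "0 < t"
  shows "fdd (insert (s + t) T) (fun_upd g (s + t) f) = fdd T (fun_upd g s (bmul (g s) (S t f)))"
proof -
  define L where "L = sorted_list_of_set (T - {s})"
  have L: "sorted L" "distinct L" "set L = T - {s}" using T(1) by (auto simp: L_def)
  have "sorted (L @ [s])" "distinct (L @ [s])" "set (L @ [s]) = T" using L T by (auto simp: sorted_append)
  then have 1: "sorted_list_of_set T = L @ [s]" by (metis sorted_list_of_set.idem_if_sorted_distinct)
  have le: "u \<le> s + t" if "u \<in> T" for u using T(3)[OF that] t by simp
  have "s + t \<notin> T" using T(3)[of "s + t"] t by auto
  have "sorted (L @ [s, s + t])" "distinct (L @ [s, s + t])" "set (L @ [s, s + t]) = insert (s + t) T"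
    using L T t \<open>s + t \<notin> T\<close> le by (auto simp: sorted_append)
  then have 2: "sorted_list_of_set (insert (s + t) T) = L @ [s, s + t]" by (metis sorted_list_of_set.idem_if_sorted_distinct)
  let ?g1 = "fun_upd g (s + t) f" and ?g2 = "fun_upd g s (bmul (g s) (S t f))"
  have eq: "path_obs a (pts ?g1 (K @ [s, s + t])) = path_obs a (pts ?g2 (K @ [s]))" if "s \<notin> set K" "s + t \<notin> set K" for a K
    using that
  proof (induction K arbitrary: a)
    case Nil
    then show ?case using t by simp
  next
    case (Cons u K)
    then have "u \<noteq> s" "u \<noteq> s + t" by auto
    then show ?case using Cons by simp
  qed
  have "fdd (insert (s + t) T) ?g1 = m (path_obs (Min T) (pts ?g1 (L @ [s, s + t])))"
    unfolding 2[symmetric] by (rule m_path_obs_shift[symmetric]) (use T t in \<open>auto intro: order_trans[OF Min_le]\<close>)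
  also have "\<dots> = m (path_obs (Min T) (pts ?g2 (L @ [s])))"
    using eq[of L] L \<open>s + t \<notin> T\<close> by simp
  also have "\<dots> = fdd T ?g2"
    unfolding 1[symmetric] by (rule m_path_obs_shift) (use T in auto)
  finally show ?thesis .
qed

lemma prod_cyl:
  assumes "finite J" "finite T" "fst ` J \<subseteq> T"
  shows "(\<Prod>u\<in>T. apply_bcontfun (cyl J b u) (p u)) = (if \<forall>(u, x)\<in>J. p u x = b (u, x) then 1 else 0)"
proof -
  have "(\<Prod>u\<in>T. apply_bcontfun (cyl J b u) (p u)) = (\<Prod>u\<in>T. if \<forall>x\<in>slice J u. p u x = b (u, x) then 1 else 0)"
  proof (rule prod.cong[OF refl])
    fix u
    show "apply_bcontfun (cyl J b u) (p u) = (if \<forall>x\<in>slice J u. p u x = b (u, x) then 1 else 0)"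
      using finite_slice[OF assms(1), of u] by (auto simp: cyl_def apply_bprod apply_ind intro: prod_zero)
  qed
  also have "\<dots> = (if \<forall>u\<in>T. \<forall>x\<in>slice J u. p u x = b (u, x) then 1 else 0)"
    using assms(2) by (auto intro: prod_zero)
  also have "(\<forall>u\<in>T. \<forall>x\<in>slice J u. p u x = b (u, x)) \<longleftrightarrow> (\<forall>(u, x)\<in>J. p u x = b (u, x))"
    using assms(3) by (force simp: slice_def)
  finally show ?thesis .
qed

section \<open>The Markov property\<close>

abbreviation ev :: "(real \<times> 'v) set \<Rightarrow> 'w set" where "ev J \<equiv> all_true (space M) X J"

lemma ev_events: "finite J \<Longrightarrow> ev J \<in> events"
proof -
  assume J: "finite J"
  have "Measurable.pred M (\<lambda>w. \<forall>j\<in>J. X (fst j) w (snd j))" by (rule pred_intros_finite(3)[OF J X_meas])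
  then show ?thesis by (simp add: pred_def all_true_def split_def)
qed

lemma indicator_ev:
  assumes "finite J" "finite T" "fst ` J \<subseteq> T" "w \<in> space M"
  shows "(\<Prod>u\<in>T. apply_bcontfun (cyl J (\<lambda>_. True) u) (X u w)) = indicator (ev J) w"
  using prod_cyl[OF assms(1-3), of "\<lambda>_. True" "\<lambda>u. X u w"] assms(4) by (auto simp: indicator_def all_true_def)

lemma prob_ev:
  assumes "finite J" "J \<subseteq> {0..} \<times> UNIV" shows "prob (ev J) = fdd (fst ` J) (cyl J (\<lambda>_. True))"
proof -
  have "expectation (\<lambda>w. \<Prod>u\<in>fst ` J. apply_bcontfun (cyl J (\<lambda>_. True) u) (X u w)) = fdd (fst ` J) (cyl J (\<lambda>_. True))"
    by (rule expectation_X) (use assms in auto)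
  moreover have "expectation (\<lambda>w. \<Prod>u\<in>fst ` J. apply_bcontfun (cyl J (\<lambda>_. True) u) (X u w)) = expectation (indicator (ev J))"
    by (rule Bochner_Integration.integral_cong[OF refl]) (use indicator_ev assms in auto)
  moreover have "ev J \<inter> space M = ev J" by (auto simp: all_true_def)
  ultimately show ?thesis by simp
qed

lemma markov_ev:
  assumes J: "finite J" "J \<subseteq> {0..s} \<times> UNIV" and st: "0 \<le> s" "0 \<le> t"
  shows "expectation (\<lambda>w. indicator (ev J) w * apply_bcontfun f (X (s + t) w))
       = expectation (\<lambda>w. indicator (ev J) w * apply_bcontfun (S t f) (X s w))"
proof (cases "t = 0")
  case False
  then have t: "0 < t" using st by simp
  \<comment> \<open>\<open>s\<close> is inserted because the event may not involve this time, while
    the conditioned observable has to be placed there.\<close>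
  let ?T = "insert s (fst ` J)" and ?g = "cyl J (\<lambda>_. True)"
  have T: "finite ?T" "\<And>u. u \<in> ?T \<Longrightarrow> 0 \<le> u \<and> u \<le> s" using J st by auto
  have stT: "s + t \<notin> ?T" using T(2)[of "s + t"] t by auto
  have "expectation (\<lambda>w. indicator (ev J) w * apply_bcontfun f (X (s + t) w))
      = expectation (\<lambda>w. \<Prod>u\<in>insert (s + t) ?T. apply_bcontfun (fun_upd ?g (s + t) f u) (X u w))"
  proof (rule Bochner_Integration.integral_cong[OF refl])
    fix w assume w: "w \<in> space M"
    have "(\<Prod>u\<in>insert (s + t) ?T. apply_bcontfun (fun_upd ?g (s + t) f u) (X u w))
        = apply_bcontfun f (X (s + t) w) * (\<Prod>u\<in>?T. apply_bcontfun (fun_upd ?g (s + t) f u) (X u w))"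
      using T(1) stT by (subst prod.insert) auto
    also have "(\<Prod>u\<in>?T. apply_bcontfun (fun_upd ?g (s + t) f u) (X u w)) = (\<Prod>u\<in>?T. apply_bcontfun (?g u) (X u w))"
      using stT by (intro prod.cong) auto
    also have "\<dots> = indicator (ev J) w" by (rule indicator_ev[OF J(1) T(1) _ w]) auto
    finally show "indicator (ev J) w * apply_bcontfun f (X (s + t) w)
        = (\<Prod>u\<in>insert (s + t) ?T. apply_bcontfun (fun_upd ?g (s + t) f u) (X u w))" by simp
  qed
  also have "\<dots> = fdd (insert (s + t) ?T) (fun_upd ?g (s + t) f)"
    by (rule expectation_X) (use T st in auto)
  also have "\<dots> = fdd ?T (fun_upd ?g s (bmul (?g s) (S t f)))"
    by (rule fdd_markov) (use T t in auto)
  also have "\<dots> = expectation (\<lambda>w. \<Prod>u\<in>?T. apply_bcontfun (fun_upd ?g s (bmul (?g s) (S t f)) u) (X u w))"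
    by (rule expectation_X[symmetric]) (use T in auto)
  also have "\<dots> = expectation (\<lambda>w. indicator (ev J) w * apply_bcontfun (S t f) (X s w))"
  proof (rule Bochner_Integration.integral_cong[OF refl])
    fix w assume w: "w \<in> space M"
    let ?T' = "?T - {s}"
    have "(\<Prod>u\<in>?T. apply_bcontfun (fun_upd ?g s (bmul (?g s) (S t f)) u) (X u w))
        = apply_bcontfun (bmul (?g s) (S t f)) (X s w) * (\<Prod>u\<in>?T'. apply_bcontfun (fun_upd ?g s (bmul (?g s) (S t f)) u) (X u w))"
      using T(1) by (subst prod.remove[of _ s]) auto
    also have "(\<Prod>u\<in>?T'. apply_bcontfun (fun_upd ?g s (bmul (?g s) (S t f)) u) (X u w)) = (\<Prod>u\<in>?T'. apply_bcontfun (?g u) (X u w))"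
      by (intro prod.cong) auto
    also have "apply_bcontfun (bmul (?g s) (S t f)) (X s w) * (\<Prod>u\<in>?T'. apply_bcontfun (?g u) (X u w))
        = (\<Prod>u\<in>?T. apply_bcontfun (?g u) (X u w)) * apply_bcontfun (S t f) (X s w)"
      using T(1) by (subst (2) prod.remove[of _ s]) (auto simp: apply_bmul)
    also have "(\<Prod>u\<in>?T. apply_bcontfun (?g u) (X u w)) = indicator (ev J) w" by (rule indicator_ev[OF J(1) T(1) _ w]) auto
    finally show "(\<Prod>u\<in>?T. apply_bcontfun (fun_upd ?g s (bmul (?g s) (S t f)) u) (X u w))
        = indicator (ev J) w * apply_bcontfun (S t f) (X s w)" .
  qed
  finally show ?thesis .
qed simp

lemma X_borel: "X t \<in> borel_measurable M"
  by (rule measurable_config_borel[OF countable_vertices X_meas])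

lemma integrable_X [simp]: "integrable M (\<lambda>w. apply_bcontfun (f :: 'v obs) (X t w))"
  by (rule integrable_const_bound[of _ "norm f"]) (auto simp: abs_le_norm)

lemma markov_property:
  assumes st: "0 \<le> s" "0 \<le> t"
  shows "AE w in M. real_cond_exp M (natural_filtration M X s) (\<lambda>w. apply_bcontfun f (X (s + t) w)) w = apply_bcontfun (S t f) (X s w)"
proof -
  let ?F = "natural_filtration M X s"
  let ?E = "\<Union>u\<in>{0..s}. {X u -` B \<inter> space M |B. B \<in> sets borel}"
  let ?G = "all_true_events (space M) X {0..s}"
  have EP: "?E \<subseteq> Pow (space M)" by auto
  have setsF: "sets ?F = sigma_sets (space M) ?E" and spF: "space ?F = space M"
    unfolding natural_filtration_def using EP by (simp_all add: sets_measure_of space_measure_of)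
  have Emeas: "?E \<subseteq> events" using measurable_sets[OF X_borel] by auto
  have sub: "subalgebra M ?F"
    unfolding subalgebra_def setsF spF using Emeas by (auto intro: sets.sigma_sets_subset[THEN subsetD])
  have FG: "sets ?F \<subseteq> sigma_sets (space M) ?G"
    unfolding setsF
  proof (rule sigma_sets_mono, safe)
    fix u and B :: "('v \<Rightarrow> bool) set" assume u: "u \<in> {0..s}" and B: "B \<in> sets borel"
    from measurable_sets[OF measurable_all_true[OF countable_vertices u, where X = X and \<Omega> = "space M"] B]
    show "X u -` B \<inter> space M \<in> sigma_sets (space M) ?G"
      using all_true_events_Pow[of "space M" X "{0..s}"] by (simp add: sets_measure_of space_measure_of)
  qed
  have Gev: "?G \<subseteq> events" using ev_events by (auto simp: all_true_events_def)
  interpret finite_measure_subalgebra M ?F by unfold_locales (rule sub)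
  let ?f = "\<lambda>w. apply_bcontfun f (X (s + t) w)" and ?g = "\<lambda>w. apply_bcontfun (S t f) (X s w)"
  \<comment> \<open>Both sides respect complements and countable disjoint unions, so agreement on
    the intersection-stable all-true events spreads to the generated sigma-algebra.\<close>
  have eqI: "(\<integral>w\<in>A. ?f w \<partial>M) = (\<integral>w\<in>A. ?g w \<partial>M)" if A: "A \<in> sigma_sets (space M) ?G" for A
    using Int_stable_all_true all_true_events_Pow A
  proof (induction A rule: sigma_sets_induct_disjoint)
    case (basic A)
    then obtain J where J: "finite J" "J \<subseteq> {0..s} \<times> UNIV" "A = ev J" by (auto simp: all_true_events_def)
    show ?case unfolding set_lebesgue_integral_def J(3) using markov_ev[OF J(1,2) st, of f] by simp
  next
    case empty
    show ?case by (simp add: set_lebesgue_integral_def)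
  next
    case (compl A)
    have A: "A \<in> events" using compl(1) Gev sets.sigma_sets_subset by blast
    have c: "(\<integral>w\<in>space M - A. h w \<partial>M) = expectation h - (\<integral>w\<in>A. h w \<partial>M)" if h: "integrable M h" for h :: "'w \<Rightarrow> real"
    proof -
      have "(\<integral>w\<in>space M - A. h w \<partial>M) = expectation (\<lambda>w. h w - indicator A w *\<^sub>R h w)"
        unfolding set_lebesgue_integral_def by (rule Bochner_Integration.integral_cong[OF refl]) (simp add: indicator_def)
      also have "\<dots> = expectation h - expectation (\<lambda>w. indicator A w *\<^sub>R h w)"
        using h integrable_mult_indicator[OF A h] by (rule Bochner_Integration.integral_diff)
      finally show ?thesis by (simp add: set_lebesgue_integral_def)
    qed
    have "expectation ?f = expectation ?g"
      using markov_ev[of "{}" s t f] st by (simp add: all_true_def cong: Bochner_Integration.integral_cong)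
    then show ?case using c[of ?f] c[of ?g] compl(2) by simp
  next
    case (union A)
    have A: "A i \<in> events" for i using union(2) Gev sets.sigma_sets_subset by blast
    have d: "\<And>i j. i \<noteq> j \<Longrightarrow> A i \<inter> A j = {}" using union(1) by (auto simp: disjoint_family_on_def)
    have u: "(\<integral>w\<in>(\<Union>i. A i). h w \<partial>M) = (\<Sum>i. \<integral>w\<in>A i. h w \<partial>M)" if h: "integrable M h" for h :: "'w \<Rightarrow> real"
    proof (rule lebesgue_integral_countable_add[OF A d])
      show "set_integrable M (\<Union>i. A i) h"
        unfolding set_integrable_def using A h by (intro integrable_mult_indicator) auto
    qed
    show ?case using u[of ?f] u[of ?g] union(3) by simp
  qed
  show ?thesis
  proof (rule real_cond_exp_charact)
    show "(\<integral>w\<in>A. ?f w \<partial>M) = (\<integral>w\<in>A. ?g w \<partial>M)" if "A \<in> sets ?F" for A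
      using eqI FG that by blast
    show "?g \<in> borel_measurable ?F"
    proof -
      have "X s \<in> measurable ?F borel"
      proof (rule measurableI)
        fix B :: "('v \<Rightarrow> bool) set" assume "B \<in> sets borel"
        then have "X s -` B \<inter> space M \<in> ?E" using st by (intro UN_I[of s]) auto
        then show "X s -` B \<inter> space ?F \<in> sets ?F" unfolding setsF spF by (rule sigma_sets.Basic)
      qed simp
      moreover have "apply_bcontfun (S t f) \<in> borel_measurable borel"
        by (intro borel_measurable_continuous_onI) simp
      ultimately show ?thesis by (rule measurable_compose)
    qed
  qed simp_all
qed

lemma markov_process: "markov_process_with_generator (majority_generator E) M X"
  unfolding markov_process_with_generator_def
  using prob_space_axioms X_borel AE_cadlag markov_semigroup_S semigroup_generator_S markov_property by blast

section \<open>Stationarity and invariance under automorphisms\<close>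

lemma stationary_X: "stationary M X"
  unfolding stationary_def
proof (intro allI impI)
  fix h :: real assume h: "0 \<le> h"
  show "process_law M (\<lambda>t. X (t + h)) = process_law M X"
  proof (rule process_law_eqI[OF prob_space_axioms countable_vertices X_borel X_borel])
    fix J :: "(real \<times> 'v) set" assume J: "finite J" "J \<subseteq> {0..} \<times> UNIV"
    let ?\<sigma> = "\<lambda>(t, x). (t + h, x)"
    have "all_true (space M) (\<lambda>t. X (t + h)) J = ev (?\<sigma> ` J)" by (auto simp: all_true_def)
    moreover have "prob (ev (?\<sigma> ` J)) = fdd (fst ` ?\<sigma> ` J) (cyl (?\<sigma> ` J) (\<lambda>_. True))"
      by (rule prob_ev) (use J h in auto)
    moreover have "fst ` ?\<sigma> ` J = (\<lambda>t. t + h) ` fst ` J" by (force simp: image_image split_def)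
    \<comment> \<open>Only differences of times enter \<open>path_obs\<close>, and an earlier start
      makes no difference under the invariant \<open>m\<close>.\<close>
    moreover have "fdd ((\<lambda>t. t + h) ` T) g' = fdd T g" if T: "finite T" and g: "\<And>t. g' (t + h) = g t" for T g g'
    proof -
      let ?L = "sorted_list_of_set T"
      have "sorted (map (\<lambda>t. t + h) ?L)" using sorted_sorted_list_of_set[of T] by (simp add: sorted_map)
      moreover have "distinct (map (\<lambda>t. t + h) ?L)" by (simp add: distinct_map inj_on_def)
      moreover have "set (map (\<lambda>t. t + h) ?L) = (\<lambda>t. t + h) ` T" using T by simp
      ultimately have L: "sorted_list_of_set ((\<lambda>t. t + h) ` T) = map (\<lambda>t. t + h) ?L"
        by (metis sorted_list_of_set.idem_if_sorted_distinct)
      have p: "path_obs (s + h) (pts g' (map (\<lambda>t. t + h) K)) = path_obs s (pts g K)" for s K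
        by (induction K arbitrary: s) (auto simp: g)
      let ?a = "if T = {} then 0 else Min T"
      have "fdd ((\<lambda>t. t + h) ` T) g' = m (path_obs (?a + h) (pts g' (map (\<lambda>t. t + h) ?L)))"
        unfolding L[symmetric] by (rule m_path_obs_shift[symmetric]) (use T in auto)
      then show ?thesis unfolding p by (simp add: fdd_def)
    qed
    moreover have "cyl (?\<sigma> ` J) (\<lambda>_. True) (t + h) = cyl J (\<lambda>_. True) t" for t
    proof -
      have "slice (?\<sigma> ` J) (t + h) = slice J t" by (force simp: slice_def)
      then show ?thesis by (simp add: cyl_def)
    qed
    ultimately show "prob (all_true (space M) (\<lambda>t. X (t + h)) J) = prob (ev J)"
      using prob_ev[OF J] J by simp
  qed
qed

lemma automorphism_invariant_X: "automorphism_invariant E M X"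
  unfolding automorphism_invariant_def
proof (intro allI impI)
  fix \<phi> assume \<phi>: "automorphism E \<phi>"
  have inj: "inj \<phi>" using \<phi> by (simp add: automorphism_def bij_is_inj)
  have meas: "(\<lambda>w. X t w \<circ> \<phi>) \<in> borel_measurable M" for t
    by (rule measurable_config_borel[OF countable_vertices]) (simp add: X_meas)
  show "process_law M (\<lambda>t w. X t w \<circ> \<phi>) = process_law M X"
  proof (rule process_law_eqI[OF prob_space_axioms countable_vertices meas X_borel])
    fix J :: "(real \<times> 'v) set" assume J: "finite J" "J \<subseteq> {0..} \<times> UNIV"
    let ?\<sigma> = "\<lambda>(t, x). (t, \<phi> x)"
    have "all_true (space M) (\<lambda>t w. X t w \<circ> \<phi>) J = ev (?\<sigma> ` J)" by (auto simp: all_true_def)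
    moreover have "prob (ev (?\<sigma> ` J)) = fdd (fst ` ?\<sigma> ` J) (cyl (?\<sigma> ` J) (\<lambda>_. True))"
      by (rule prob_ev) (use J in auto)
    moreover have "fst ` ?\<sigma> ` J = fst ` J" by (force simp: image_image split_def)
    moreover have "fdd T g' = fdd T g" if T: "finite T" and g: "\<And>t \<omega>. apply_bcontfun (g' t) \<omega> = apply_bcontfun (g t) (\<omega> \<circ> \<phi>)" for T g g'
    proof -
      have P: "apply_bcontfun (path_obs s (pts g' K)) \<omega> = apply_bcontfun (path_obs s (pts g K)) (\<omega> \<circ> \<phi>)"
        if "sorted K" "\<And>t. t \<in> set K \<Longrightarrow> s \<le> t" for s K \<omega>
        using that
      proof (induction K arbitrary: s \<omega>)
        case (Cons u K)
        have "apply_bcontfun (bmul (g' u) (path_obs u (pts g' K))) \<omega> = apply_bcontfun (bmul (g u) (path_obs u (pts g K))) (\<omega> \<circ> \<phi>)" for \<omega>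
          unfolding apply_bmul g by (rule arg_cong2[where f = "(*)", OF refl Cons.IH]) (use Cons.prems in auto)
        from S_automorphism[OF \<phi> _ this, of "u - s"] show ?case using Cons.prems by (simp add: o_def)
      qed (simp add: const_bcontfun.rep_eq)
      show ?thesis unfolding fdd_def by (rule m_automorphism[OF \<phi>], rule P) (use T in auto)
    qed
    moreover have "apply_bcontfun (cyl (?\<sigma> ` J) (\<lambda>_. True) t) \<omega> = apply_bcontfun (cyl J (\<lambda>_. True) t) (\<omega> \<circ> \<phi>)" for t \<omega>
    proof -
      have "slice (?\<sigma> ` J) t = \<phi> ` slice J t" by (force simp: slice_def)
      then show ?thesis using inj finite_slice[OF J(1), of t]
        by (simp add: cyl_def apply_bprod apply_ind prod.reindex inj_on_subset)
    qed
    ultimately show "prob (all_true (space M) (\<lambda>t w. X t w \<circ> \<phi>) J) = prob (ev J)"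
      using prob_ev[OF J] J by simp
  qed
qed

section \<open>Non-frozen states, correlations and layers\<close>

lemma expectation_single: "0 \<le> t \<Longrightarrow> expectation (\<lambda>w. apply_bcontfun f (X t w)) = m f"
  using expectation_X[of "{t}" "\<lambda>_. f"] by (simp add: fdd_def)

text \<open>A frozen configuration agrees with the majority throughout each generation below
  \<open>r 0\<close>. The \<open>n\<close>-th generation lies in a single layer and has
  \<open>3^n\<close> vertices, so this has probability at most \<open>(15/16)^(3^n)\<close>.\<close>

lemma not_frozen:
  assumes t: "0 \<le> t" shows "AE w in M. \<not> frozen E (X t w)"
proof -
  define F where "F x = (1 / 2) *\<^sub>R (one + bmul (chi x) (Maj x))" for x
  have F: "apply_bcontfun (F x) \<omega> = (if \<omega> x = majority E \<omega> x then 1 else 0)" for x \<omega>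
    by (simp add: F_def apply_bmul apply_chi apply_Maj scaleR_bcontfun.rep_eq plus_bcontfun.rep_eq const_bcontfun.rep_eq sgn_of_def)
  define A where "A n = generation {r 0} n" for n
  have ht: "A n \<subseteq> V (ht (r 0) - int n)" for n
  proof
    fix x assume "x \<in> A n"
    then have "(par ^^ n) x = r 0" by (simp add: A_def generation_def)
    then show "x \<in> V (ht (r 0) - int n)" using ht_funpow_par[of n x] by (simp add: ht_iff)
  qed
  have A: "finite (A n)" "card (A n) = 3 ^ n" for n
  proof -
    have "finite (A n) \<and> card (A n) = 3 ^ n"
    proof (induction n)
      case (Suc n)
      have "card (A (Suc n)) = (\<Sum>y\<in>A n. card (kids y))"
        unfolding A_def generation_Suc using Suc by (intro card_UN_disjoint) (auto simp: A_def kids_iff)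
      then show ?case using Suc by (simp add: card_kids A_def generation_Suc)
    qed (simp add: A_def generation_def)
    then show "finite (A n)" "card (A n) = 3 ^ n" by auto
  qed
  let ?B = "\<lambda>n. {w \<in> space M. apply_bcontfun (bprod F (A n)) (X t w) = 1}"
  have B: "?B n \<in> events" for n by measurable
  have B01: "apply_bcontfun (bprod F (A n)) \<omega> = (if \<forall>x\<in>A n. \<omega> x = majority E \<omega> x then 1 else 0)" for n \<omega>
    using A(1)[of n] by (auto simp: apply_bprod F intro: prod_zero)
  have pB: "prob (?B n) \<le> (15 / 16) ^ (3 ^ n)" for n
  proof -
    have "prob (?B n) = expectation (indicator (?B n))" using B[of n] by simp
    also have "\<dots> = expectation (\<lambda>w. apply_bcontfun (bprod F (A n)) (X t w))"
      by (rule Bochner_Integration.integral_cong[OF refl]) (simp add: B01 indicator_def)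
    also have "\<dots> = m (bprod F (A n))" by (rule expectation_single[OF t])
    also have "\<dots> \<le> (15 / 16) ^ card (A n)" by (rule m_agree[OF A(1) ht F])
    finally show ?thesis by (simp add: A)
  qed
  let ?N = "\<Inter>n. ?B n"
  have N: "?N \<in> events" using B by (intro sets.countable_INT) auto
  have "prob ?N \<le> 0"
  proof (rule tendsto_lowerbound)
    have "(\<lambda>n. (15 / 16 :: real) ^ n) \<longlonglongrightarrow> 0" by (rule LIMSEQ_power_zero) simp
    then show "(\<lambda>n. (15 / 16 :: real) ^ n) \<longlonglongrightarrow> 0" .
    have "prob ?N \<le> (15 / 16) ^ n" for n
    proof -
      have "prob ?N \<le> prob (?B n)" by (rule finite_measure_mono[OF _ B]) blast
      also have "\<dots> \<le> (15 / 16) ^ (3 ^ n)" by (rule pB)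
      also have "\<dots> \<le> (15 / 16) ^ n" by (intro power_decreasing less_imp_le[OF power_gt_expt]) auto
      finally show ?thesis .
    qed
    then show "\<forall>\<^sub>F n in sequentially. prob ?N \<le> (15 / 16) ^ n" by simp
  qed simp
  then have "emeasure M ?N = 0" by (simp add: emeasure_eq_measure measure_le_0_iff)
  show ?thesis
  proof (rule AE_I[OF _ \<open>emeasure M ?N = 0\<close> N])
    show "{w \<in> space M. \<not> \<not> frozen E (X t w)} \<subseteq> ?N" by (auto simp: frozen_def B01)
  qed
qed

lemma correlation:
  assumes t: "0 \<le> t" shows "opinion_correlation M X x t = (if t = 0 then 1 else m (bmul (chi x) (S t (chi x))))"
proof -
  let ?A = "{w \<in> space M. X 0 w x = X t w x}" and ?B = "{w \<in> space M. X 0 w x \<noteq> X t w x}"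
  have A: "?A \<in> events" "?B \<in> events" using X_meas[of 0 x] X_meas[of t x] by measurable
  have "expectation (\<lambda>w. apply_bcontfun (chi x) (X 0 w) * apply_bcontfun (chi x) (X t w)) = expectation (\<lambda>w. indicator ?A w - indicator ?B w)"
    by (rule Bochner_Integration.integral_cong[OF refl]) (simp add: apply_chi sgn_of_def indicator_def)
  also have "\<dots> = expectation (indicator ?A) - expectation (indicator ?B)"
    using A by (intro Bochner_Integration.integral_diff) (auto simp: less_top[symmetric])
  also have "\<dots> = opinion_correlation M X x t"
    using A by (simp add: opinion_correlation_def Int_absorb2)
  finally have E: "opinion_correlation M X x t = expectation (\<lambda>w. apply_bcontfun (chi x) (X 0 w) * apply_bcontfun (chi x) (X t w))" by simp
  \<comment> \<open>At \<open>t = 0\<close> the set \<open>{0, t}\<close> has one element and the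
    product over it loses a factor, hence the separate value.\<close>
  show ?thesis
  proof (cases "t = 0")
    case True
    then show ?thesis unfolding E by (simp add: apply_chi prob_space)
  next
    case False
    then have "expectation (\<lambda>w. \<Prod>u\<in>{0, t}. apply_bcontfun (chi x) (X u w)) = fdd {0, t} (\<lambda>_. chi x)"
      using t by (intro expectation_X) auto
    then show ?thesis using False t fdd_pair[of 0 t "\<lambda>_. chi x"] unfolding E by simp
  qed
qed

lemma correlation_decay: "decays_exponentially (opinion_correlation M X x)"
proof -
  have "\<bar>opinion_correlation M X x t\<bar> \<le> 1 * exp (- (1 / 10) * t)" if t: "0 \<le> t" for t
    using correlation[OF t, of x] m_correlation[OF t, of x] by auto
  then show ?thesis unfolding decays_exponentially_def
    by (intro exI[of _ "1 :: real"] exI[of _ "1 / 10 :: real"] conjI allI impI) simp_all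
qed

lemma iid_layer:
  assumes t: "0 \<le> t" shows "iid_on M (X t) (V k)"
proof -
  have pr: "prob {w \<in> space M. \<forall>x\<in>A. X t w x = b x} = (1 / 2) ^ card A" if A: "finite A" "A \<subseteq> V k" for A b
  proof -
    let ?C = "{w \<in> space M. \<forall>x\<in>A. X t w x = b x}"
    have "expectation (\<lambda>w. apply_bcontfun (bprod (\<lambda>x. ind x (b x)) A) (X t w)) = expectation (indicator ?C)"
      by (rule Bochner_Integration.integral_cong[OF refl]) (use A in \<open>auto simp: apply_bprod apply_ind indicator_def intro: prod_zero\<close>)
    also have "\<dots> = prob (?C \<inter> space M)" by simp
    also have "?C \<inter> space M = ?C" by blast
    finally show ?thesis using m_layer[OF A, of b] expectation_single[OF t] by simp
  qed
  have rv: "random_variable (count_space UNIV) (\<lambda>w. X t w x)" for x by (rule X_meas)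
  have ind: "indep_vars (\<lambda>_. count_space UNIV) (\<lambda>x w. X t w x) (V k)"
  proof -
    \<comment> \<open>For each site the single event of opinion \<open>True\<close> generates its
      sigma-algebra, so independence is checked on intersections of these events.\<close>
    let ?F = "\<lambda>x. {{w \<in> space M. X t w x}}"
    have ev: "{w \<in> space M. X t w x} \<in> events" for x using rv[of x] by measurable
    have "indep_sets ?F (V k)"
    proof (rule indep_setsI)
      fix A J assume J: "J \<noteq> {}" "J \<subseteq> V k" "finite J" "\<forall>j\<in>J. A j \<in> ?F j"
      then have "(\<Inter>j\<in>J. A j) = {w \<in> space M. \<forall>x\<in>J. X t w x = True}" by auto
      then have "prob (\<Inter>j\<in>J. A j) = (1 / 2) ^ card J" using pr[OF J(3,2), of "\<lambda>_. True"] by simp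
      moreover have "prob (A j) = 1 / 2" if "j \<in> J" for j
        using pr[of "{j}" "\<lambda>_. True"] J that by auto
      then have "(\<Prod>j\<in>J. prob (A j)) = (\<Prod>j\<in>J. 1 / 2)" by (intro prod.cong) auto
      ultimately show "prob (\<Inter>j\<in>J. A j) = (\<Prod>j\<in>J. prob (A j))" by (simp only: prod_constant)
    qed (use ev in auto)
    then have "indep_sets (\<lambda>x. sigma_sets (space M) (?F x)) (V k)"
      by (rule indep_sets_sigma) (auto simp: Int_stable_def)
    then have "indep_sets (\<lambda>x. {(\<lambda>w. X t w x) -` A \<inter> space M |A. A \<in> sets (count_space UNIV)}) (V k)"
    proof (rule indep_sets_mono_sets)
      fix x
      let ?\<Sigma> = "sigma_sets (space M) (?F x)"
      have T: "{w \<in> space M. X t w x} \<in> ?\<Sigma>" by (rule sigma_sets.Basic) simp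
      have "(\<lambda>w. X t w x) -` B \<inter> space M \<in> ?\<Sigma>" for B
      proof -
        let ?T = "{w \<in> space M. X t w x}"
        have T': "space M - ?T \<in> ?\<Sigma>" by (rule sigma_sets.Compl[OF T])
        have "(\<lambda>w. X t w x) -` B \<inter> space M = (if True \<in> B then ?T else {}) \<union> (if False \<in> B then space M - ?T else {})"
        proof (rule set_eqI)
          fix w
          show "w \<in> (\<lambda>w. X t w x) -` B \<inter> space M \<longleftrightarrow> w \<in> (if True \<in> B then ?T else {}) \<union> (if False \<in> B then space M - ?T else {})"
            by (cases "X t w x") auto
        qed
        also have "\<dots> \<in> ?\<Sigma>" using T T' by (intro sigma_sets_Un) (simp_all add: sigma_sets.Empty)
        finally show ?thesis .
      qed
      then show "{(\<lambda>w. X t w x) -` A \<inter> space M |A. A \<in> sets (count_space UNIV)} \<subseteq> ?\<Sigma>" by blast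
    qed
    then show ?thesis unfolding indep_vars_def2 using rv by auto
  qed
  have "distr M (count_space UNIV) (\<lambda>w. X t w x) = distr M (count_space UNIV) (\<lambda>w. X t w y)" if "x \<in> V k" "y \<in> V k" for x y
  proof (rule measure_eqI_finite[where A = UNIV])
    fix c :: bool
    have *: "emeasure (distr M (count_space UNIV) (\<lambda>w. X t w z)) {c} = ennreal (1 / 2)" if "z \<in> V k" for z
    proof -
      have "(\<lambda>w. X t w z) -` {c} \<inter> space M = {w \<in> space M. \<forall>x\<in>{z}. X t w x = c}" by auto
      then have "prob ((\<lambda>w. X t w z) -` {c} \<inter> space M) = 1 / 2" using pr[of "{z}" "\<lambda>_. c"] that by simp
      then have "emeasure M ((\<lambda>w. X t w z) -` {c} \<inter> space M) = ennreal (1 / 2)" by (simp only: emeasure_eq_measure)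
      then show ?thesis by (subst emeasure_distr[OF rv]) simp_all
    qed
    show "emeasure (distr M (count_space UNIV) (\<lambda>w. X t w x)) {c} = emeasure (distr M (count_space UNIV) (\<lambda>w. X t w y)) {c}"
      using that by (simp add: *)
  qed auto
  with ind show ?thesis unfolding iid_on_def by blast
qed

end

text \<open>The extension theorem gives opinions indexed by pairs of time and vertex. Currying turns
  them into paths, and \<open>N\<close> is the sigma-algebra that corresponds to the product one
  under this bijection.\<close>

lemma (in stationary_state) path_process_exists:
  "\<exists>M :: (real \<Rightarrow> 'a \<Rightarrow> bool) measure. path_process E r V m M (\<lambda>t w. w t)"
proof -
  obtain M0 :: "(real \<times> 'a \<Rightarrow> bool) measure" where M0: "prob_space M0"
    "sets M0 = sets (PiM UNIV (\<lambda>_. count_space UNIV))"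
    "\<And>J b. finite J \<Longrightarrow> measure M0 {f. \<forall>j\<in>J. f j = b j} = W J b"
    using bool_kolmogorov_extension[of W, OF W_nonneg W_empty W_cong W_step] by blast
  interpret M0: prob_space M0 by fact
  let ?C = "PiM UNIV (\<lambda>_ :: real \<times> 'a. count_space (UNIV :: bool set))"
  define N where "N = vimage_algebra UNIV (\<lambda>(w :: real \<Rightarrow> 'a \<Rightarrow> bool) (t, x). w t x) ?C"
  have cur: "curry \<in> measurable M0 N"
    unfolding N_def
  proof (rule measurable_vimage_algebra2)
    have "(\<lambda>f. (\<lambda>(t, x). curry f t x)) = (\<lambda>f :: real \<times> 'a \<Rightarrow> bool. f)" by (auto simp: fun_eq_iff)
    then show "(\<lambda>f. (\<lambda>(w :: real \<Rightarrow> 'a \<Rightarrow> bool) (t, x). w t x) (curry f)) \<in> measurable M0 ?C"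
      using measurable_ident_sets[OF M0(2)] by simp
  qed simp
  define M where "M = distr M0 N curry"
  have unc: "(\<lambda>(w :: real \<Rightarrow> 'a \<Rightarrow> bool) (t, x). w t x) \<in> measurable N ?C"
    unfolding N_def by (rule measurable_vimage_algebra1) (auto simp: space_PiM)
  have coord: "(\<lambda>w. w t x) \<in> measurable N (count_space UNIV)" for t x
    using measurable_compose[OF unc measurable_component_singleton[of "(t, x)"]] by simp
  have spN: "space N = UNIV" by (simp add: N_def)
  have "path_process E r V m M (\<lambda>t w. w t)"
  proof (intro path_process.intro path_process_axioms.intro stationary_state_axioms)
    show "prob_space M" unfolding M_def by (rule M0.prob_space_distr[OF cur])
    show "(\<lambda>w. w t x) \<in> measurable M (count_space UNIV)" for t x
      using coord by (simp add: M_def)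
    show "measure M {w \<in> space M. \<forall>(t, x)\<in>J. w t x = b (t, x)} = W J b" if J: "finite J" for J b
    proof -
      let ?A = "{w. \<forall>(t, x)\<in>J. w t x = b (t, x)}"
      have [measurable]: "Measurable.pred N (\<lambda>w. w (fst j) (snd j))" for j by (rule coord)
      have "Measurable.pred N (\<lambda>w. \<forall>j\<in>J. w (fst j) (snd j) = b j)"
        by (rule pred_intros_finite(3)[OF J]) measurable
      then have A: "?A \<in> sets N" by (simp add: pred_def spN split_def)
      have sp0: "space M0 = UNIV" using sets_eq_imp_space_eq[OF M0(2)] by (simp add: space_PiM)
      have "measure M ?A = measure M0 (curry -` ?A \<inter> space M0)" unfolding M_def by (rule measure_distr[OF cur A])
      also have "curry -` ?A \<inter> space M0 = {f. \<forall>j\<in>J. f j = b j}" by (auto simp: sp0)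
      finally show ?thesis using M0(3)[OF J] by (simp add: M_def spN)
    qed
  qed
  then show ?thesis by blast
qed

theorem theorem2:
  fixes E :: "('v \<times> 'v) set" and r :: "int \<Rightarrow> 'v" and V :: "int \<Rightarrow> 'v set"
  assumes "regular_directed_tree 3 E"
    and "\<And>k. (r k, r (k - 1)) \<in> E"
    and "layering E r V"
  shows "\<exists>(M :: (real \<Rightarrow> 'v \<Rightarrow> bool) measure) (X :: real \<Rightarrow> (real \<Rightarrow> 'v \<Rightarrow> bool) \<Rightarrow> ('v \<Rightarrow> bool)).
           markov_process_with_generator (majority_generator E) M X \<and>
           stationary M X \<and>
           automorphism_invariant E M X \<and>
           (\<forall>t\<ge>0. AE w in M. \<not> frozen E (X t w)) \<and>
           (\<forall>x. decays_exponentially (opinion_correlation M X x)) \<and>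
           (\<forall>t\<ge>0. \<forall>k. iid_on M (X t) (V k))"
proof -
  interpret layered_tree E r V by unfold_locales (use assms in auto)
  obtain m where "stationary_state E r V m" using stationary_state_exists by blast
  then interpret stationary_state E r V m .
  obtain M :: "(real \<Rightarrow> 'v \<Rightarrow> bool) measure" where "path_process E r V m M (\<lambda>t w. w t)"
    using path_process_exists by blast
  then interpret path_process E r V m M "\<lambda>t w. w t" .
  show ?thesis
    by (intro exI[of _ M] exI[of _ X] conjI allI impI markov_process stationary_X automorphism_invariant_X
          not_frozen correlation_decay iid_layer)
qed

end
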